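(* For every $n\ge1$ the 2-group homomorphism $\mathbb{I}:\mathbb{A}_n\to\mathrm{AUT}_{CI}(\mathbb{TD}_n)$, which sends an object $(A,\eta)$ to the crossed intertwiner $(\phi_A,f_A,\eta)$ with $\phi_A(a)=Aa$ and $f_A(m,s)=(Am,\mathrm{iso}(A)s)$, and a morphism $\beta$ to the crossed transformation given by the same map $\beta$, is an equivalence of 2-groups, $$\mathbb{A}_n\cong\mathrm{AUT}_{CI}(\mathbb{TD}_n).$$
   Context: $\mathrm{U}(1)=\mathbb{R}/\mathbb{Z}$ is written additively. $[a,b]=a^{tr}Jb$ on $\mathbb{R}^{2n}$ with $J=\begin{pmatrix}0&0\\ E_n&0\end{pmatrix}$; $I=\begin{pmatrix}0&E_n\\ E_n&0\end{pmatrix}$; $\mathrm{O}^{\pm}(n,n,\mathbb{Z})=\{A\in\mathrm{GL}(2n,\mathbb{Z}):A^{tr}IA=\pm I\}$, and $\mathrm{iso}(A)\in\{\pm1\}$ is the sign with $A^{tr}IA=\mathrm{iso}(A)I$. **The strict 2-group $\mathbb{A}_n$.** Objects are pairs $(A,\eta)$ with $A\in\mathrm{O}^{\pm}(n,n,\mathbb{Z})$ and $\eta:\mathbb{R}^{2n}\times\mathbb{R}^{2n}\to\mathrm{U}(1)$ smooth such that for all $a,a',a''\in\mathbb{R}^{2n}$, $m,m'\in\mathbb{Z}^{2n}$: (A1) $\eta(m,m')=0$; (A2) $\eta(m,a)+\mathrm{iso}(A)[a,m]=\eta(a,m)+[Aa,Am]$; (A3) $\eta(a,a')+\eta(a+a',a'')=\eta(a',a'')+\eta(a,a'+a'')$.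 Product: $(A_1,\eta_1)\cdot(A_2,\eta_2)=(A_1A_2,\tilde\eta)$ with $\tilde\eta(a,a')=\eta_1(A_2a,A_2a')+\mathrm{iso}(A_1)\eta_2(a,a')$. Morphisms $(A,\eta)\to(A',\eta')$ exist only if $A=A'$ and are then smooth maps $\beta:\mathbb{R}^{2n}\to\mathrm{U}(1)$ with (A4) $\beta(m)=0$ for all $m\in\mathbb{Z}^{2n}$; (A5) $\beta(a_1)+\beta(a_2)+\eta(a_1,a_2)=\eta'(a_1,a_2)+\beta(a_1+a_2)$. Composition is pointwise addition, and the product of $\beta_1:(A_1,\eta_1)\to(A_1,\eta_1')$ and $\beta_2:(A_2,\eta_2)\to(A_2,\eta_2')$ is $(\beta_1\cdot\beta_2)(a)=\beta_1(A_2a)+\mathrm{iso}(A_1)\beta_2(a)$. **T-duality 2-group.** $\mathbb{TD}_n$ is the crossed module $(G,H,t,\alpha)$ with $G=\mathbb{R}^{2n}$, $H=\mathbb{Z}^{2n}\times\mathrm{U}(1)$, $t(m,s)=m$, $\alpha(a,(m,s))=(m,s-[a,m])$. Here $U:=\ker(t)=\mathrm{U}(1)$. **$\mathrm{AUT}_{CI}(\Gamma)$** for a crossed module of Lie groups $\Gamma=(G,H,t,\alpha)$ with $U=\ker t$ (general case written multiplicatively). Objects are invertible crossed intertwiners: triples $(\phi,f,\eta)$ of Lie group isomorphisms $\phi:G\to G$, $f:H\to H$ and a smooth map $\eta:G\times G\to U$ with $\phi(t(h))=t(f(h))$; $\eta(t(h),t(h'))=1$; $\eta(g,t(h)g^{-1})f(\alpha(g,h))=\alpha(\phi(g),\eta(t(h)g^{-1},g))\,\alpha(\phi(g),f(h))$;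 $\eta(g,g')\eta(gg',g'')=\alpha(\phi(g),\eta(g',g''))\eta(g,g'g'')$. Morphisms $(\phi,f,\eta)\Rightarrow(\phi,f',\eta')$ are crossed transformations: smooth maps $\beta:G\to U$ with $\beta(t(h))f(h)=f'(h)$ and $\beta(g_1)\alpha(\phi(g_1),\beta(g_2))\eta(g_1,g_2)=\eta'(g_1,g_2)\beta(g_1g_2)$; vertical composition is pointwise multiplication. The product on objects is $(\phi_2,f_2,\eta_2)\circ(\phi_1,f_1,\eta_1)=(\phi_2\phi_1,f_2f_1,\eta_2\circ(\phi_1\times\phi_1)\cdot f_2\circ\eta_1)$ and on morphisms $(\beta_2\circ\beta_1)(g)=\beta_2(\phi_1(g))f_2(\beta_1(g))$. An equivalence of 2-groups is a monoidal functor that is an equivalence of categories. *)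

theory Defs
  imports "HOL-Analysis.Analysis"
begin

section \<open>Smooth maps\<close>

fun Ck_on :: "nat \<Rightarrow> 'a::euclidean_space set \<Rightarrow> ('a \<Rightarrow> 'b::euclidean_space) \<Rightarrow> bool" where
  "Ck_on 0 S f \<longleftrightarrow> continuous_on S f"
| "Ck_on (Suc k) S f \<longleftrightarrow>
     (\<forall>x\<in>S. f differentiable (at x)) \<and> (\<forall>v. Ck_on k S (\<lambda>x. frechet_derivative f (at x) v))"

text \<open>Only used for open sets \<open>S\<close>.\<close>
definition smooth_on :: "'a::euclidean_space set \<Rightarrow> ('a \<Rightarrow> 'b::euclidean_space) \<Rightarrow> bool" where
  "smooth_on S f \<longleftrightarrow> (\<forall>k. Ck_on k S f)"

text \<open>
  The smooth structure of a manifold with underlying set \<open>UNIV :: 'a set\<close> is given by a set of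
  local parametrisations, i.e. inverses of charts: a pair \<open>(W, p)\<close> consists of an open subset
  \<open>W\<close> of the model space and a map \<open>p\<close> that is injective on \<open>W\<close>.  A map is smooth if it
  is smooth in charts around every point (this includes continuity).
\<close>
type_synonym ('a, 'e) atlas = "('e set \<times> ('e \<Rightarrow> 'a)) set"

definition smooth_map ::
    "('a, 'e::euclidean_space) atlas \<Rightarrow> ('b, 'k::euclidean_space) atlas \<Rightarrow> ('a \<Rightarrow> 'b) \<Rightarrow> bool" where
  "smooth_map \<A> \<B> f \<longleftrightarrow>
     (\<forall>(W, p)\<in>\<A>. \<forall>x\<in>W. \<exists>(W', q)\<in>\<B>. \<exists>V g.
        open V \<and> x \<in> V \<and> V \<subseteq> W \<and> smooth_on V g \<and> g ` V \<subseteq> W' \<and> (\<forall>y\<in>V. f (p y) = q (g y)))"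

definition euclidean_atlas :: "('e::euclidean_space, 'e) atlas" where
  "euclidean_atlas = {(UNIV, id)}"

definition prod_atlas ::
    "('a, 'e) atlas \<Rightarrow> ('b, 'k) atlas \<Rightarrow> ('a \<times> 'b, 'e \<times> 'k) atlas" where
  "prod_atlas \<A> \<B> = {(W \<times> W', map_prod p q) | W p W' q. (W, p) \<in> \<A> \<and> (W', q) \<in> \<B>}"


section \<open>The circle group as the quotient of the reals by the integers\<close>

quotient_type u1 = real / "\<lambda>x y. x - y \<in> \<int>"
  morphisms rep_u1 to_u1
proof (rule equivpI)
  show "reflp (\<lambda>x y::real. x - y \<in> \<int>)"
    by (simp add: reflp_def)
  show "symp (\<lambda>x y::real. x - y \<in> \<int>)"
  proof (rule sympI)
    fix x y :: real
    assume "x - y \<in> \<int>"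
    then have "- (x - y) \<in> \<int>" by (rule Ints_minus)
    then show "y - x \<in> \<int>" by simp
  qed
  show "transp (\<lambda>x y::real. x - y \<in> \<int>)"
  proof (rule transpI)
    fix x y z :: real
    assume "x - y \<in> \<int>" and "y - z \<in> \<int>"
    then have "(x - y) + (y - z) \<in> \<int>" by (rule Ints_add)
    then show "x - z \<in> \<int>" by simp
  qed
qed

instantiation u1 :: ab_group_add
begin

lift_definition zero_u1 :: u1 is 0 .

lift_definition plus_u1 :: "u1 \<Rightarrow> u1 \<Rightarrow> u1" is "(+)"
proof -
  fix a b c d :: real
  assume "a - b \<in> \<int>" and "c - d \<in> \<int>"
  then have "(a - b) + (c - d) \<in> \<int>" by (rule Ints_add)
  then show "a + c - (b + d) \<in> \<int>" by (simp add: algebra_simps)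
qed

lift_definition uminus_u1 :: "u1 \<Rightarrow> u1" is uminus
proof -
  fix a b :: real
  assume "a - b \<in> \<int>"
  then have "- (a - b) \<in> \<int>" by (rule Ints_minus)
  then show "- a - - b \<in> \<int>" by simp
qed

lift_definition minus_u1 :: "u1 \<Rightarrow> u1 \<Rightarrow> u1" is "(-)"
proof -
  fix a b c d :: real
  assume "a - b \<in> \<int>" and "c - d \<in> \<int>"
  then have "(a - b) - (c - d) \<in> \<int>" by (rule Ints_diff)
  then show "a - c - (b - d) \<in> \<int>" by (simp add: algebra_simps)
qed

instance
  by standard (transfer; simp add: algebra_simps)+

end

lift_definition int_scale :: "int \<Rightarrow> u1 \<Rightarrow> u1" is "\<lambda>k x. of_int k * x"
proof -
  fix k :: int and a b :: real
  assume "a - b \<in> \<int>"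
  then have "of_int k * (a - b) \<in> \<int>" by (intro Ints_mult Ints_of_int)
  then show "of_int k * a - of_int k * b \<in> \<int>" by (simp add: algebra_simps)
qed

definition u1_atlas :: "(u1, real) atlas" where
  "u1_atlas = {({c - 1/2 <..< c + 1/2}, to_u1) | c. True}"


section \<open>Strict 2-groups and their equivalences\<close>

text \<open>\<open>Comp C q p\<close> is \<open>q \<circ> p\<close>, i.e. \<open>p\<close> is applied first.\<close>
record ('o, 'm) monoidal_data =
  Obj :: "'o set"
  Arr :: "'m set"
  Dom :: "'m \<Rightarrow> 'o"
  Cod :: "'m \<Rightarrow> 'o"
  Idt :: "'o \<Rightarrow> 'm"
  Comp :: "'m \<Rightarrow> 'm \<Rightarrow> 'm"
  UnitO :: "'o"
  TensO :: "'o \<Rightarrow> 'o \<Rightarrow> 'o"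
  TensA :: "'m \<Rightarrow> 'm \<Rightarrow> 'm"

definition Hom :: "('o, 'm) monoidal_data \<Rightarrow> 'o \<Rightarrow> 'o \<Rightarrow> 'm set" where
  "Hom C X Y = {p \<in> Arr C. Dom C p = X \<and> Cod C p = Y}"

definition iso_arr :: "('o, 'm) monoidal_data \<Rightarrow> 'm \<Rightarrow> bool" where
  "iso_arr C p \<longleftrightarrow> p \<in> Arr C \<and>
     (\<exists>q\<in>Hom C (Cod C p) (Dom C p).
        Comp C q p = Idt C (Dom C p) \<and> Comp C p q = Idt C (Cod C p))"

locale category =
  fixes C :: "('o, 'm) monoidal_data"
  assumes dom_obj: "p \<in> Arr C \<Longrightarrow> Dom C p \<in> Obj C"
    and cod_obj: "p \<in> Arr C \<Longrightarrow> Cod C p \<in> Obj C"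
    and idt_hom: "X \<in> Obj C \<Longrightarrow> Idt C X \<in> Hom C X X"
    and comp_hom: "p \<in> Hom C X Y \<Longrightarrow> q \<in> Hom C Y Z \<Longrightarrow> Comp C q p \<in> Hom C X Z"
    and comp_idt: "p \<in> Hom C X Y \<Longrightarrow> Comp C p (Idt C X) = p"
    and idt_comp: "p \<in> Hom C X Y \<Longrightarrow> Comp C (Idt C Y) p = p"
    and comp_assoc: "p \<in> Hom C X Y \<Longrightarrow> q \<in> Hom C Y Z \<Longrightarrow> r \<in> Hom C Z W \<Longrightarrow>
      Comp C (Comp C r q) p = Comp C r (Comp C q p)"

locale strict_monoidal_category = category C
  for C :: "('o, 'm) monoidal_data" +
  assumes unit_obj: "UnitO C \<in> Obj C"
    and tens_obj: "X \<in> Obj C \<Longrightarrow> Y \<in> Obj C \<Longrightarrow> TensO C X Y \<in> Obj C"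
    and tens_hom: "p \<in> Hom C X X' \<Longrightarrow> q \<in> Hom C Y Y' \<Longrightarrow>
      TensA C p q \<in> Hom C (TensO C X Y) (TensO C X' Y')"
    and tens_idt: "X \<in> Obj C \<Longrightarrow> Y \<in> Obj C \<Longrightarrow>
      TensA C (Idt C X) (Idt C Y) = Idt C (TensO C X Y)"
    and tens_comp: "p \<in> Hom C X X' \<Longrightarrow> p' \<in> Hom C X' X'' \<Longrightarrow>
      q \<in> Hom C Y Y' \<Longrightarrow> q' \<in> Hom C Y' Y'' \<Longrightarrow>
      TensA C (Comp C p' p) (Comp C q' q) = Comp C (TensA C p' q') (TensA C p q)"
    and tens_assoc_obj: "X \<in> Obj C \<Longrightarrow> Y \<in> Obj C \<Longrightarrow> Z \<in> Obj C \<Longrightarrow>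
      TensO C (TensO C X Y) Z = TensO C X (TensO C Y Z)"
    and tens_assoc_arr: "p \<in> Arr C \<Longrightarrow> q \<in> Arr C \<Longrightarrow> r \<in> Arr C \<Longrightarrow>
      TensA C (TensA C p q) r = TensA C p (TensA C q r)"
    and unit_tens_obj: "X \<in> Obj C \<Longrightarrow> TensO C (UnitO C) X = X"
    and tens_unit_obj: "X \<in> Obj C \<Longrightarrow> TensO C X (UnitO C) = X"
    and unit_tens_arr: "p \<in> Arr C \<Longrightarrow> TensA C (Idt C (UnitO C)) p = p"
    and tens_unit_arr: "p \<in> Arr C \<Longrightarrow> TensA C p (Idt C (UnitO C)) = p"

locale strict_two_group = strict_monoidal_category C
  for C :: "('o, 'm) monoidal_data" +
  assumes groupoid: "p \<in> Arr C \<Longrightarrow> iso_arr C p"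
    and obj_inverse: "X \<in> Obj C \<Longrightarrow>
      \<exists>Y\<in>Obj C. TensO C X Y = UnitO C \<and> TensO C Y X = UnitO C"

locale cat_functor = C: category C + D: category D
  for C :: "('o, 'm) monoidal_data" and D :: "('p, 'l) monoidal_data" +
  fixes Fo :: "'o \<Rightarrow> 'p" and Fa :: "'m \<Rightarrow> 'l"
  assumes map_obj: "X \<in> Obj C \<Longrightarrow> Fo X \<in> Obj D"
    and map_hom: "p \<in> Hom C X Y \<Longrightarrow> Fa p \<in> Hom D (Fo X) (Fo Y)"
    and map_idt: "X \<in> Obj C \<Longrightarrow> Fa (Idt C X) = Idt D (Fo X)"
    and map_comp: "p \<in> Hom C X Y \<Longrightarrow> q \<in> Hom C Y Z \<Longrightarrow>
      Fa (Comp C q p) = Comp D (Fa q) (Fa p)"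

locale natural_iso = F: cat_functor C D Fo Fa + G: cat_functor C D Go Ga
  for C :: "('o, 'm) monoidal_data" and D :: "('p, 'l) monoidal_data" and Fo Fa Go Ga +
  fixes \<tau> :: "'o \<Rightarrow> 'l"
  assumes component: "X \<in> Obj C \<Longrightarrow> \<tau> X \<in> Hom D (Fo X) (Go X)"
    and component_iso: "X \<in> Obj C \<Longrightarrow> iso_arr D (\<tau> X)"
    and natural: "p \<in> Hom C X Y \<Longrightarrow> Comp D (Ga p) (\<tau> X) = Comp D (\<tau> Y) (Fa p)"

definition equivalence_of_categories ::
    "('o, 'm) monoidal_data \<Rightarrow> ('p, 'l) monoidal_data \<Rightarrow> ('o \<Rightarrow> 'p) \<Rightarrow> ('m \<Rightarrow> 'l) \<Rightarrow> bool" where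
  "equivalence_of_categories C D Fo Fa \<longleftrightarrow>
     cat_functor C D Fo Fa \<and>
     (\<exists>Go Ga \<sigma> \<tau>. cat_functor D C Go Ga \<and>
        natural_iso C C id id (Go \<circ> Fo) (Ga \<circ> Fa) \<sigma> \<and>
        natural_iso D D (Fo \<circ> Go) (Fa \<circ> Ga) id id \<tau>)"

text \<open>
  Strong monoidal functors between strict monoidal categories, with coherence isomorphisms
  \<open>\<mu> X Y : F X \<otimes> F Y \<rightarrow> F (X \<otimes> Y)\<close> and \<open>\<epsilon> : 1 \<rightarrow> F 1\<close>.
\<close>
locale monoidal_functor =
  C: strict_monoidal_category C + D: strict_monoidal_category D + cat_functor C D Fo Fa
  for C :: "('o, 'm) monoidal_data" and D :: "('p, 'l) monoidal_data" and Fo Fa +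
  fixes \<mu> :: "'o \<Rightarrow> 'o \<Rightarrow> 'l" and \<epsilon> :: 'l
  assumes mu_hom: "X \<in> Obj C \<Longrightarrow> Y \<in> Obj C \<Longrightarrow>
      \<mu> X Y \<in> Hom D (TensO D (Fo X) (Fo Y)) (Fo (TensO C X Y))"
    and mu_iso: "X \<in> Obj C \<Longrightarrow> Y \<in> Obj C \<Longrightarrow> iso_arr D (\<mu> X Y)"
    and eps_hom: "\<epsilon> \<in> Hom D (UnitO D) (Fo (UnitO C))"
    and eps_iso: "iso_arr D \<epsilon>"
    and mu_natural: "p \<in> Hom C X X' \<Longrightarrow> q \<in> Hom C Y Y' \<Longrightarrow>
      Comp D (Fa (TensA C p q)) (\<mu> X Y) = Comp D (\<mu> X' Y') (TensA D (Fa p) (Fa q))"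
    and mu_assoc: "X \<in> Obj C \<Longrightarrow> Y \<in> Obj C \<Longrightarrow> Z \<in> Obj C \<Longrightarrow>
      Comp D (\<mu> (TensO C X Y) Z) (TensA D (\<mu> X Y) (Idt D (Fo Z))) =
      Comp D (\<mu> X (TensO C Y Z)) (TensA D (Idt D (Fo X)) (\<mu> Y Z))"
    and mu_unit_left: "X \<in> Obj C \<Longrightarrow>
      Comp D (\<mu> (UnitO C) X) (TensA D \<epsilon> (Idt D (Fo X))) = Idt D (Fo X)"
    and mu_unit_right: "X \<in> Obj C \<Longrightarrow>
      Comp D (\<mu> X (UnitO C)) (TensA D (Idt D (Fo X)) \<epsilon>) = Idt D (Fo X)"

locale strict_two_group_hom =
  C: strict_two_group C + D: strict_two_group D + cat_functor C D Fo Fa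
  for C :: "('o, 'm) monoidal_data" and D :: "('p, 'l) monoidal_data" and Fo Fa +
  assumes map_unit: "Fo (UnitO C) = UnitO D"
    and map_tens_obj: "X \<in> Obj C \<Longrightarrow> Y \<in> Obj C \<Longrightarrow> Fo (TensO C X Y) = TensO D (Fo X) (Fo Y)"
    and map_tens_arr: "p \<in> Arr C \<Longrightarrow> q \<in> Arr C \<Longrightarrow> Fa (TensA C p q) = TensA D (Fa p) (Fa q)"

definition two_group_equivalence ::
    "('o, 'm) monoidal_data \<Rightarrow> ('p, 'l) monoidal_data \<Rightarrow> ('o \<Rightarrow> 'p) \<Rightarrow> ('m \<Rightarrow> 'l) \<Rightarrow>
     ('o \<Rightarrow> 'o \<Rightarrow> 'l) \<Rightarrow> 'l \<Rightarrow> bool" where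
  "two_group_equivalence C D Fo Fa \<mu> \<epsilon> \<longleftrightarrow>
     strict_two_group C \<and> strict_two_group D \<and>
     monoidal_functor C D Fo Fa \<mu> \<epsilon> \<and> equivalence_of_categories C D Fo Fa"


section \<open>Crossed modules of Lie groups and crossed intertwiners\<close>

text \<open>
  Both groups are written additively, although they need not be commutative, and have the
  whole type as underlying set.
\<close>
record ('g, 'h, 'e, 'k) crossed_module =
  AtlG :: "('g, 'e) atlas"
  AtlH :: "('h, 'k) atlas"
  bdry :: "'h \<Rightarrow> 'g"
  act :: "'g \<Rightarrow> 'h \<Rightarrow> 'h"

definition kerU :: "('g::group_add, 'h, 'e, 'k) crossed_module \<Rightarrow> 'h set" where
  "kerU \<Gamma> = {h. bdry \<Gamma> h = 0}"

definition lie_group_iso ::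
    "('a::group_add, 'e::euclidean_space) atlas \<Rightarrow> ('a \<Rightarrow> 'a) \<Rightarrow> bool" where
  "lie_group_iso \<A> f \<longleftrightarrow> bij f \<and> (\<forall>x y. f (x + y) = f x + f y) \<and>
     smooth_map \<A> \<A> f \<and> smooth_map \<A> \<A> (inv f)"

type_synonym ('g, 'h) intertwiner = "('g \<Rightarrow> 'g) \<times> ('h \<Rightarrow> 'h) \<times> ('g \<times> 'g \<Rightarrow> 'h)"

text \<open>
  Since \<open>kerU \<Gamma>\<close> is a closed, hence embedded, Lie subgroup of \<open>H\<close>, smooth maps into it are
  the same as smooth maps into \<open>H\<close> with values in \<open>kerU \<Gamma>\<close>.
\<close>
definition invertible_intertwiner ::
    "('g::group_add, 'h::group_add, 'e::euclidean_space, 'k::euclidean_space) crossed_module \<Rightarrow>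
     ('g, 'h) intertwiner \<Rightarrow> bool" where
  "invertible_intertwiner \<Gamma> = (\<lambda>(\<phi>, f, \<eta>).
     lie_group_iso (AtlG \<Gamma>) \<phi> \<and>
     lie_group_iso (AtlH \<Gamma>) f \<and>
     range \<eta> \<subseteq> kerU \<Gamma> \<and>
     smooth_map (prod_atlas (AtlG \<Gamma>) (AtlG \<Gamma>)) (AtlH \<Gamma>) \<eta> \<and>
     (\<forall>h. \<phi> (bdry \<Gamma> h) = bdry \<Gamma> (f h)) \<and>
     (\<forall>h h'. \<eta> (bdry \<Gamma> h, bdry \<Gamma> h') = 0) \<and>
     (\<forall>g h. \<eta> (g, bdry \<Gamma> h - g) + f (act \<Gamma> g h) =
        act \<Gamma> (\<phi> g) (\<eta> (bdry \<Gamma> h - g, g)) + act \<Gamma> (\<phi> g) (f h)) \<and>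
     (\<forall>g g' g''. \<eta> (g, g') + \<eta> (g + g', g'') =
        act \<Gamma> (\<phi> g) (\<eta> (g', g'')) + \<eta> (g, g' + g'')))"

definition crossed_transformation ::
    "('g::group_add, 'h::group_add, 'e::euclidean_space, 'k::euclidean_space) crossed_module \<Rightarrow>
     ('g, 'h) intertwiner \<Rightarrow> ('g, 'h) intertwiner \<Rightarrow> ('g \<Rightarrow> 'h) \<Rightarrow> bool" where
  "crossed_transformation \<Gamma> = (\<lambda>(\<phi>, f, \<eta>) (\<phi>', f', \<eta>') \<beta>.
     \<phi>' = \<phi> \<and>
     range \<beta> \<subseteq> kerU \<Gamma> \<and>
     smooth_map (AtlG \<Gamma>) (AtlH \<Gamma>) \<beta> \<and>
     (\<forall>h. \<beta> (bdry \<Gamma> h) + f h = f' h) \<and>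
     (\<forall>g\<^sub>1 g\<^sub>2. \<beta> g\<^sub>1 + act \<Gamma> (\<phi> g\<^sub>1) (\<beta> g\<^sub>2) + \<eta> (g\<^sub>1, g\<^sub>2) =
        \<eta>' (g\<^sub>1, g\<^sub>2) + \<beta> (g\<^sub>1 + g\<^sub>2)))"

definition AUT_CI ::
    "('g::group_add, 'h::group_add, 'e::euclidean_space, 'k::euclidean_space) crossed_module \<Rightarrow>
     (('g, 'h) intertwiner,
      ('g, 'h) intertwiner \<times> ('g, 'h) intertwiner \<times> ('g \<Rightarrow> 'h)) monoidal_data" where
  "AUT_CI \<Gamma> = \<lparr>
     Obj = {X. invertible_intertwiner \<Gamma> X},
     Arr = {(X, Y, \<beta>). invertible_intertwiner \<Gamma> X \<and> invertible_intertwiner \<Gamma> Y \<and>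
                       crossed_transformation \<Gamma> X Y \<beta>},
     Dom = (\<lambda>(X, Y, \<beta>). X),
     Cod = (\<lambda>(X, Y, \<beta>). Y),
     Idt = (\<lambda>X. (X, X, \<lambda>g. 0)),
     Comp = (\<lambda>(Y', Z, \<beta>') (X, Y, \<beta>). (X, Z, \<lambda>g. \<beta>' g + \<beta> g)),
     UnitO = (id, id, \<lambda>_. 0),
     TensO = (\<lambda>(\<phi>\<^sub>2, f\<^sub>2, \<eta>\<^sub>2) (\<phi>\<^sub>1, f\<^sub>1, \<eta>\<^sub>1).
       (\<phi>\<^sub>2 \<circ> \<phi>\<^sub>1, f\<^sub>2 \<circ> f\<^sub>1, \<lambda>(g, g'). \<eta>\<^sub>2 (\<phi>\<^sub>1 g, \<phi>\<^sub>1 g') + f\<^sub>2 (\<eta>\<^sub>1 (g, g')))),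
     TensA = (\<lambda>((\<phi>\<^sub>2, f\<^sub>2, \<eta>\<^sub>2), (\<phi>\<^sub>2', f\<^sub>2', \<eta>\<^sub>2'), \<beta>\<^sub>2) ((\<phi>\<^sub>1, f\<^sub>1, \<eta>\<^sub>1), (\<phi>\<^sub>1', f\<^sub>1', \<eta>\<^sub>1'), \<beta>\<^sub>1).
       ((\<phi>\<^sub>2 \<circ> \<phi>\<^sub>1, f\<^sub>2 \<circ> f\<^sub>1, \<lambda>(g, g'). \<eta>\<^sub>2 (\<phi>\<^sub>1 g, \<phi>\<^sub>1 g') + f\<^sub>2 (\<eta>\<^sub>1 (g, g'))),
        (\<phi>\<^sub>2' \<circ> \<phi>\<^sub>1', f\<^sub>2' \<circ> f\<^sub>1', \<lambda>(g, g'). \<eta>\<^sub>2' (\<phi>\<^sub>1' g, \<phi>\<^sub>1' g') + f\<^sub>2' (\<eta>\<^sub>1' (g, g'))),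
        \<lambda>g. \<beta>\<^sub>2 (\<phi>\<^sub>1 g) + f\<^sub>2 (\<beta>\<^sub>1 g)))
   \<rparr>"


section \<open>The T-duality 2-group\<close>

text \<open>
  The index type \<open>'n + 'n\<close>, where \<open>CARD('n) = n \<ge> 1\<close>, splits a vector of length \<open>2n\<close> into its
  first half (\<open>Inl\<close>) and its second half (\<open>Inr\<close>).
\<close>
type_synonym 'n rvec = "(real, 'n + 'n) vec"
type_synonym 'n ivec = "(int, 'n + 'n) vec"
type_synonym 'n imat = "((int, 'n + 'n) vec, 'n + 'n) vec"

definition rvec_of :: "('n::finite) ivec \<Rightarrow> 'n rvec" where
  "rvec_of m = (\<chi> i. of_int (m $ i))"

definition mat_act :: "('n::finite) imat \<Rightarrow> 'n rvec \<Rightarrow> 'n rvec" where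
  "mat_act A a = map_matrix of_int A *v a"

definition Jmat :: "((real, 'n::finite + 'n) vec, 'n + 'n) vec" where
  "Jmat = (\<chi> i j. case (i, j) of (Inr k, Inl l) \<Rightarrow> (if k = l then 1 else 0) | _ \<Rightarrow> 0)"

definition Imat :: "('n::finite) imat" where
  "Imat = (\<chi> i j. case (i, j) of
     (Inl k, Inr l) \<Rightarrow> (if k = l then 1 else 0)
   | (Inr k, Inl l) \<Rightarrow> (if k = l then 1 else 0)
   | _ \<Rightarrow> 0)"

definition bracket :: "('n::finite) rvec \<Rightarrow> 'n rvec \<Rightarrow> real" where
  "bracket a b = a \<bullet> (Jmat *v b)"

text \<open>The group \<open>\<int>\<^sup>2\<^sup>n \<times> U(1)\<close> is one-dimensional, with discrete first factor.\<close>
definition lattice_u1_atlas :: "(('n::finite) ivec \<times> u1, real) atlas" where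
  "lattice_u1_atlas = {(W, \<lambda>x. (m, p x)) | m W p. (W, p) \<in> u1_atlas}"

definition TD :: "(('n::finite) rvec, 'n ivec \<times> u1, 'n rvec, real) crossed_module" where
  "TD = \<lparr>
     AtlG = euclidean_atlas,
     AtlH = lattice_u1_atlas,
     bdry = (\<lambda>(m, s). rvec_of m),
     act = (\<lambda>a (m, s). (m, s - to_u1 (bracket a (rvec_of m))))
   \<rparr>"


section \<open>The 2-group of pairs \<open>(A, \<eta>)\<close>\<close>

definition Opm :: "('n::finite) imat set" where
  "Opm = {A. invertible A \<and>
     (transpose A ** Imat ** A = Imat \<or> transpose A ** Imat ** A = - Imat)}"

definition iso_sign :: "('n::finite) imat \<Rightarrow> int" where
  "iso_sign A = (THE e. e \<in> {1, -1} \<and> transpose A ** Imat ** A = map_matrix ((*) e) Imat)"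

type_synonym 'n pairA = "'n imat \<times> ('n rvec \<times> 'n rvec \<Rightarrow> u1)"

definition A_obj :: "('n::finite) pairA set" where
  "A_obj = {(A, \<eta>). A \<in> Opm \<and>
     smooth_map euclidean_atlas u1_atlas \<eta> \<and>
     (\<forall>m m'. \<eta> (rvec_of m, rvec_of m') = 0) \<and>
     (\<forall>a m. \<eta> (rvec_of m, a) + int_scale (iso_sign A) (to_u1 (bracket a (rvec_of m))) =
        \<eta> (a, rvec_of m) + to_u1 (bracket (mat_act A a) (mat_act A (rvec_of m)))) \<and>
     (\<forall>a a' a''. \<eta> (a, a') + \<eta> (a + a', a'') = \<eta> (a', a'') + \<eta> (a, a' + a''))}"

definition A_mor :: "('n::finite) pairA \<Rightarrow> 'n pairA \<Rightarrow> ('n rvec \<Rightarrow> u1) \<Rightarrow> bool" where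
  "A_mor = (\<lambda>(A, \<eta>) (A', \<eta>') \<beta>. A = A' \<and>
     smooth_map euclidean_atlas u1_atlas \<beta> \<and>
     (\<forall>m. \<beta> (rvec_of m) = 0) \<and>
     (\<forall>a\<^sub>1 a\<^sub>2. \<beta> a\<^sub>1 + \<beta> a\<^sub>2 + \<eta> (a\<^sub>1, a\<^sub>2) = \<eta>' (a\<^sub>1, a\<^sub>2) + \<beta> (a\<^sub>1 + a\<^sub>2)))"

definition A_prod :: "('n::finite) pairA \<Rightarrow> 'n pairA \<Rightarrow> 'n pairA" where
  "A_prod = (\<lambda>(A\<^sub>1, \<eta>\<^sub>1) (A\<^sub>2, \<eta>\<^sub>2).
     (A\<^sub>1 ** A\<^sub>2,
      \<lambda>(a, a'). \<eta>\<^sub>1 (mat_act A\<^sub>2 a, mat_act A\<^sub>2 a') + int_scale (iso_sign A\<^sub>1) (\<eta>\<^sub>2 (a, a'))))"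

definition A_two_group ::
    "(('n::finite) pairA, 'n pairA \<times> 'n pairA \<times> ('n rvec \<Rightarrow> u1)) monoidal_data" where
  "A_two_group = \<lparr>
     Obj = A_obj,
     Arr = {(X, Y, \<beta>). X \<in> A_obj \<and> Y \<in> A_obj \<and> A_mor X Y \<beta>},
     Dom = (\<lambda>(X, Y, \<beta>). X),
     Cod = (\<lambda>(X, Y, \<beta>). Y),
     Idt = (\<lambda>X. (X, X, \<lambda>a. 0)),
     Comp = (\<lambda>(Y', Z, \<beta>') (X, Y, \<beta>). (X, Z, \<lambda>a. \<beta>' a + \<beta> a)),
     UnitO = (mat 1, \<lambda>_. 0),
     TensO = A_prod,
     TensA = (\<lambda>(X\<^sub>1, Y\<^sub>1, \<beta>\<^sub>1) (X\<^sub>2, Y\<^sub>2, \<beta>\<^sub>2).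
       (A_prod X\<^sub>1 X\<^sub>2, A_prod Y\<^sub>1 Y\<^sub>2,
        \<lambda>a. \<beta>\<^sub>1 (mat_act (fst X\<^sub>2) a) + int_scale (iso_sign (fst X\<^sub>1)) (\<beta>\<^sub>2 a)))
   \<rparr>"


section \<open>The comparison functor\<close>

text \<open>The circle group is identified with the kernel \<open>{0} \<times> U(1)\<close> via \<open>s \<mapsto> (0, s)\<close>.\<close>

definition I_obj :: "('n::finite) pairA \<Rightarrow> ('n rvec, 'n ivec \<times> u1) intertwiner" where
  "I_obj = (\<lambda>(A, \<eta>).
     (mat_act A, \<lambda>(m, s). (A *v m, int_scale (iso_sign A) s), \<lambda>x. (0, \<eta> x)))"

definition I_arr ::
    "('n::finite) pairA \<times> 'n pairA \<times> ('n rvec \<Rightarrow> u1) \<Rightarrow>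
     ('n rvec, 'n ivec \<times> u1) intertwiner \<times> ('n rvec, 'n ivec \<times> u1) intertwiner \<times>
     ('n rvec \<Rightarrow> 'n ivec \<times> u1)" where
  "I_arr = (\<lambda>(X, Y, \<beta>). (I_obj X, I_obj Y, \<lambda>a. (0, \<beta> a)))"

end

theory Submission
  imports Defs
begin

text \<open>
  The comparison functor is fully faithful by inspection, because on its image the conditions on
  a crossed transformation are those on a morphism of pairs. The content is the description of
  all invertible intertwiners \<open>(\<phi>, f, \<eta>)\<close> of the T-duality 2-group.

  A Lie group automorphism \<open>\<phi>\<close> of \<open>\<real>\<^sup>2\<^sup>n\<close> is linear, and compatibility with the boundary map makes
  it preserve the lattice in both directions, so it is an integer matrix \<open>A\<close> with integral
  inverse. An automorphism \<open>f\<close> of \<open>\<int>\<^sup>2\<^sup>n \<times> U(1)\<close> over it has the form \<open>(m, s) \<mapsto> (A m, \<kappa> m + e s)\<close>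
  with a character \<open>\<kappa>\<close> of the lattice and a sign \<open>e\<close>, because the smooth automorphisms of the
  circle are \<open>\<plusminus>1\<close> (\<open>u1_endomorphism_is_int_scale\<close>, \<open>int_scale_injD\<close>). The decisive point is that
  \<open>\<eta>\<close> forces \<open>A\<close> to transform the hyperbolic form by exactly this sign \<open>e\<close>
  (\<open>cocycle_similitude\<close>): the antisymmetrisation of \<open>\<eta>\<close> is alternating and biadditive, and on
  \<open>\<real>\<^sup>2\<^sup>n \<times> \<int>\<^sup>2\<^sup>n\<close> it is the reduction of the real bilinear form \<open>e [a, b] - [A a, A b]\<close>, where
  \<open>[a, b]\<close> is \<open>bracket a b\<close>. Dividing both arguments by \<open>N\<close> shows that the diagonal values of
  this form at lattice points, divided by \<open>N\<^sup>2\<close>, are integers for every \<open>N\<close>, so they vanish.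

  Hence the invertible intertwiners are exactly the \<open>twisted X \<kappa>\<close> with \<open>X\<close> an object of the
  2-group of pairs and \<open>\<kappa>\<close> a character of the lattice (\<open>invertible_intertwiner_iff\<close>), and the
  functor hits those with \<open>\<kappa> = 0\<close>. Every character \<open>\<kappa>\<close> extends to a smooth character of \<open>\<real>\<^sup>2\<^sup>n\<close>
  (\<open>extend_lattice_character\<close>). Such an extension has trivial coboundary and is therefore a
  crossed transformation from \<open>twisted X 0\<close> to \<open>twisted X \<kappa>\<close> with the same \<open>\<eta>\<close>; this is essential
  surjectivity. The axioms of a strict 2-group are verified for twisted objects with characters
  in a class \<open>K\<close> (\<open>twisted_two_group\<close>); the class \<open>{0}\<close> gives the 2-group of pairs and the class
  of all characters gives the automorphism 2-group.
\<close>

section \<open>Smoothness under linear maps and sums\<close>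

lemma Ck_on_subset: "Ck_on k S f \<Longrightarrow> T \<subseteq> S \<Longrightarrow> Ck_on k T f"
  by (induction k arbitrary: f) (auto intro: continuous_on_subset)

text \<open>
  A derivative depends on the germ only, so it may be computed from any formula that is valid on
  the open set. Each closure property below uses this to replace the derivative of the composite
  by the formula that the usual calculus rule provides.
\<close>
lemma Ck_on_cong:
  assumes "open S" and "\<And>x. x \<in> S \<Longrightarrow> f x = g x" and "Ck_on k S f"
  shows "Ck_on k S g"
  using assms(2,3)
proof (induction k arbitrary: f g)
  case 0
  then show ?case by (simp cong: continuous_on_cong)
next
  case (Suc k)
  have der: "(g has_derivative frechet_derivative f (at x)) (at x)" if "x \<in> S" for x
  proof (rule has_derivative_transform_within_open[OF _ \<open>open S\<close> that])
    show "(f has_derivative frechet_derivative f (at x)) (at x)"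
      using Suc.prems that by (simp flip: frechet_derivative_works)
  qed (use Suc.prems in simp)
  have "Ck_on k S (\<lambda>x. frechet_derivative g (at x) v)" for v
  proof (rule Suc.IH)
    show "Ck_on k S (\<lambda>x. frechet_derivative f (at x) v)"
      using Suc.prems by simp
  qed (simp add: frechet_derivative_at[OF der, symmetric])
  then show ?case
    using der by (auto simp: differentiable_def)
qed

lemma Ck_on_const: "Ck_on k S (\<lambda>x. c)"
proof (induction k arbitrary: c)
  case (Suc k)
  have "frechet_derivative (\<lambda>x. c) (at x) = (\<lambda>v. 0)" for x :: 'a
    by (rule frechet_derivative_at[symmetric]) (rule has_derivative_const)
  then show ?case using Suc by simp
qed simp

lemma Ck_on_linear:
  assumes "linear L"
  shows "Ck_on k S L"
proof (cases k)
  case 0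
  then show ?thesis using assms by (simp add: linear_continuous_on linear_linear)
next
  case (Suc j)
  have d: "(L has_derivative L) (at x)" for x
    using assms by (simp add: linear_imp_has_derivative)
  then have "frechet_derivative L (at x) = L" for x
    by (rule frechet_derivative_at[symmetric])
  then show ?thesis using Suc d by (auto simp: differentiable_def Ck_on_const)
qed

lemma Ck_on_add:
  assumes "open S" "Ck_on k S f" "Ck_on k S g"
  shows "Ck_on k S (\<lambda>x. f x + g x)"
  using assms(2,3)
proof (induction k arbitrary: f g)
  case 0
  then show ?case by (simp add: continuous_on_add)
next
  case (Suc k)
  have "Ck_on k S (\<lambda>x. frechet_derivative (\<lambda>x. f x + g x) (at x) v)" for v
  proof (rule Ck_on_cong[OF \<open>open S\<close>])
    show "Ck_on k S (\<lambda>x. frechet_derivative f (at x) v + frechet_derivative g (at x) v)"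
      using Suc.prems by (intro Suc.IH) simp_all
    show "frechet_derivative f (at x) v + frechet_derivative g (at x) v =
        frechet_derivative (\<lambda>x. f x + g x) (at x) v" if "x \<in> S" for x
    proof -
      have "((\<lambda>x. f x + g x) has_derivative
          (\<lambda>v. frechet_derivative f (at x) v + frechet_derivative g (at x) v)) (at x)"
        using Suc.prems that by (intro has_derivative_add) (simp_all flip: frechet_derivative_works)
      then show ?thesis by (simp add: frechet_derivative_at[symmetric])
    qed
  qed
  then show ?case using Suc.prems by simp
qed

lemma Ck_on_linear_compose:
  assumes "open S" "linear L" "Ck_on k S f"
  shows "Ck_on k S (\<lambda>x. L (f x))"
  using assms(3)
proof (induction k arbitrary: f)
  case 0
  then show ?case
    using assms(2) by (simp add: linear_continuous_on_compose)
next
  case (Suc k)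
  have der: "((\<lambda>x. L (f x)) has_derivative (\<lambda>v. L (frechet_derivative f (at x) v))) (at x)"
    if "x \<in> S" for x
    using Suc.prems that assms(2)
    by (auto intro!: bounded_linear.has_derivative[of L]
        simp: linear_linear simp flip: frechet_derivative_works)
  have "Ck_on k S (\<lambda>x. frechet_derivative (\<lambda>x. L (f x)) (at x) v)" for v
  proof (rule Ck_on_cong[OF \<open>open S\<close>])
    show "Ck_on k S (\<lambda>x. L (frechet_derivative f (at x) v))"
      using Suc.prems by (intro Suc.IH) simp
  qed (simp add: frechet_derivative_at[OF der, symmetric])
  then show ?case using der by (auto simp: differentiable_def)
qed

text \<open>
  The derivative of \<open>f \<circ> L\<close> in direction \<open>v\<close> is the derivative of \<open>f\<close> in the constant direction
  \<open>L v\<close>, again composed with \<open>L\<close>. The induction therefore never meets a product, as it would for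
  the general chain rule. This special case suffices because the maps to be precomposed are
  automorphisms of \<open>\<real>\<^sup>2\<^sup>n\<close>, which are linear.
\<close>
lemma Ck_on_compose_linear:
  assumes "open S" "linear L" "Ck_on k S f"
  shows "Ck_on k (L -` S) (\<lambda>x. f (L x))"
  using assms(3)
proof (induction k arbitrary: f)
  case 0
  then show ?case
    using assms(2) continuous_on_compose2[of S f "L -` S" L]
    by (simp add: linear_continuous_on linear_linear image_vimage_subset)
next
  case (Suc k)
  have "open (L -` S)"
    using assms by (intro open_vimage linear_continuous_on) (auto simp: linear_linear)
  have der: "((\<lambda>x. f (L x)) has_derivative (\<lambda>v. frechet_derivative f (at (L x)) (L v))) (at x)"
    if "x \<in> L -` S" for x
  proof -
    have "(L has_derivative L) (at x)"
      using assms(2) by (simp add: linear_imp_has_derivative)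
    moreover have "(f has_derivative frechet_derivative f (at (L x))) (at (L x))"
      using Suc.prems that by (simp flip: frechet_derivative_works)
    ultimately show ?thesis by (rule has_derivative_compose)
  qed
  have "Ck_on k (L -` S) (\<lambda>x. frechet_derivative (\<lambda>x. f (L x)) (at x) v)" for v
  proof (rule Ck_on_cong[OF \<open>open (L -` S)\<close>])
    show "Ck_on k (L -` S) (\<lambda>x. frechet_derivative f (at (L x)) (L v))"
      using Suc.IH[of "\<lambda>y. frechet_derivative f (at y) (L v)"] Suc.prems by simp
  qed (simp add: frechet_derivative_at[OF der, symmetric])
  then show ?case using der by (auto simp: differentiable_def)
qed

lemma smooth_on_subset: "smooth_on S f \<Longrightarrow> T \<subseteq> S \<Longrightarrow> smooth_on T f"
  by (auto simp: smooth_on_def intro: Ck_on_subset)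

lemma smooth_on_continuous: "smooth_on S f \<Longrightarrow> continuous_on S f"
  unfolding smooth_on_def by (drule spec[of _ 0]) simp

lemma smooth_on_differentiable: "smooth_on S f \<Longrightarrow> x \<in> S \<Longrightarrow> f differentiable (at x)"
  unfolding smooth_on_def by (drule spec[of _ "Suc 0"]) simp

lemma smooth_on_const: "smooth_on S (\<lambda>x. c)"
  by (simp add: smooth_on_def Ck_on_const)

lemma smooth_on_linear: "linear L \<Longrightarrow> smooth_on S L"
  by (simp add: smooth_on_def Ck_on_linear)

lemma smooth_on_add:
  "open S \<Longrightarrow> smooth_on S f \<Longrightarrow> smooth_on S g \<Longrightarrow> smooth_on S (\<lambda>x. f x + g x)"
  by (simp add: smooth_on_def Ck_on_add)

lemma smooth_on_linear_compose:
  "open S \<Longrightarrow> linear L \<Longrightarrow> smooth_on S f \<Longrightarrow> smooth_on S (\<lambda>x. L (f x))"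
  by (simp add: smooth_on_def Ck_on_linear_compose)

lemma smooth_on_compose_linear:
  "open S \<Longrightarrow> linear L \<Longrightarrow> smooth_on S f \<Longrightarrow> smooth_on (L -` S) (\<lambda>x. f (L x))"
  by (simp add: smooth_on_def Ck_on_compose_linear)


section \<open>Maps into the circle\<close>

lemma to_u1_eq_iff: "to_u1 x = to_u1 y \<longleftrightarrow> x - y \<in> \<int>"
  by (rule u1.abs_eq_iff)

lemma to_u1_eq_0_iff: "to_u1 x = 0 \<longleftrightarrow> x \<in> \<int>"
  by (simp add: zero_u1_def to_u1_eq_iff)

lemma to_u1_0 [simp]: "to_u1 0 = 0"
  by (simp add: zero_u1_def)

lemma to_u1_add: "to_u1 (x + y) = to_u1 x + to_u1 y"
  by (simp add: plus_u1.abs_eq)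

lemma to_u1_diff: "to_u1 (x - y) = to_u1 x - to_u1 y"
  by (simp add: minus_u1.abs_eq)

lemma to_u1_sum: "to_u1 (sum f S) = (\<Sum>i\<in>S. to_u1 (f i))"
  by (induction S rule: infinite_finite_induct) (auto simp: to_u1_add)

lemma to_u1_surj: "\<exists>x. to_u1 x = s"
  by (metis Quotient_abs_rep Quotient_u1)

lemma int_scale_to_u1: "int_scale k (to_u1 x) = to_u1 (of_int k * x)"
  by (simp add: int_scale.abs_eq)

lemma int_scale_add: "int_scale k (s + s') = int_scale k s + int_scale k s'"
  by transfer (simp add: algebra_simps)

lemma int_scale_minus: "int_scale k (- s) = - int_scale k s"
  by transfer (simp add: algebra_simps)

lemma int_scale_diff: "int_scale k (s - s') = int_scale k s - int_scale k s'"
  by transfer (simp add: algebra_simps)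

lemma int_scale_0 [simp]: "int_scale k 0 = 0"
  by transfer simp

lemma int_scale_1 [simp]: "int_scale 1 s = s"
  by transfer simp

lemma int_scale_zero_left [simp]: "int_scale 0 s = 0"
  by transfer simp

lemma int_scale_add_left: "int_scale (k + l) s = int_scale k s + int_scale l s"
  by transfer (simp add: algebra_simps)

lemma int_scale_diff_left: "int_scale (k - l) s = int_scale k s - int_scale l s"
  by transfer (simp add: algebra_simps)

lemma int_scale_mult: "int_scale k (int_scale l s) = int_scale (k * l) s"
  by transfer (simp add: algebra_simps)

text \<open>
  The charts of the circle are defined on intervals of length one only; this normalisation can
  always be reached by shrinking the domain of a lift.
\<close>
lemma smooth_map_u1_iff:
  "smooth_map euclidean_atlas u1_atlas f \<longleftrightarrow>
     (\<forall>x. \<exists>V g. open V \<and> x \<in> V \<and> smooth_on V g \<and> (\<forall>y\<in>V. f y = to_u1 (g y)))"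
  (is "?L \<longleftrightarrow> ?R")
proof
  assume ?L
  then show ?R
    unfolding smooth_map_def euclidean_atlas_def u1_atlas_def by simp meson
next
  assume R: ?R
  have "\<exists>W' q. (W', q) \<in> u1_atlas \<and> (\<exists>V g. open V \<and> x \<in> V \<and> smooth_on V g \<and> g ` V \<subseteq> W' \<and>
      (\<forall>y\<in>V. f y = q (g y)))" for x
  proof -
    obtain V g where V: "open V" "x \<in> V" "smooth_on V g" "\<And>y. y \<in> V \<Longrightarrow> f y = to_u1 (g y)"
      using R by metis
    define W where "W = {g x - 1/2 <..< g x + 1/2}"
    have "open (V \<inter> g -` W)"
      using V by (intro continuous_open_preimage smooth_on_continuous) (auto simp: W_def)
    moreover have "(W, to_u1) \<in> u1_atlas"
      by (auto simp: W_def u1_atlas_def)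
    moreover have "x \<in> V \<inter> g -` W" using V by (auto simp: W_def)
    moreover have "smooth_on (V \<inter> g -` W) g"
      using V(3) by (rule smooth_on_subset) auto
    moreover have "g ` (V \<inter> g -` W) \<subseteq> W" by auto
    moreover have "\<forall>y\<in>V \<inter> g -` W. f y = to_u1 (g y)" using V(4) by simp
    ultimately show ?thesis by blast
  qed
  then show ?L
    unfolding smooth_map_def euclidean_atlas_def by (auto simp: Bex_def split_beta)
qed

lemma smooth_u1_const: "smooth_map euclidean_atlas u1_atlas (\<lambda>x. s)"
proof -
  obtain r where "to_u1 r = s" using to_u1_surj by blast
  then show ?thesis
    unfolding smooth_map_u1_iff
    by (intro allI exI[of _ UNIV] exI[of _ "\<lambda>x. r"]) (simp add: smooth_on_const)
qed

lemma smooth_u1_add: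
  assumes "smooth_map euclidean_atlas u1_atlas f" "smooth_map euclidean_atlas u1_atlas g"
  shows "smooth_map euclidean_atlas u1_atlas (\<lambda>x. f x + g x)"
  unfolding smooth_map_u1_iff
proof
  fix x
  obtain V f' where V: "open V" "x \<in> V" "smooth_on V f'" "\<And>y. y \<in> V \<Longrightarrow> f y = to_u1 (f' y)"
    using assms(1) unfolding smooth_map_u1_iff by meson
  obtain W g' where W: "open W" "x \<in> W" "smooth_on W g'" "\<And>y. y \<in> W \<Longrightarrow> g y = to_u1 (g' y)"
    using assms(2) unfolding smooth_map_u1_iff by meson
  have "smooth_on (V \<inter> W) (\<lambda>y. f' y + g' y)"
    using V(1) W(1) smooth_on_subset[OF V(3)] smooth_on_subset[OF W(3)]
    by (intro smooth_on_add) auto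
  then show "\<exists>V h. open V \<and> x \<in> V \<and> smooth_on V h \<and> (\<forall>y\<in>V. f y + g y = to_u1 (h y))"
    using V W by (intro exI[of _ "V \<inter> W"] exI[of _ "\<lambda>y. f' y + g' y"]) (auto simp: to_u1_add)
qed

lemma smooth_u1_int_scale:
  assumes "smooth_map euclidean_atlas u1_atlas f"
  shows "smooth_map euclidean_atlas u1_atlas (\<lambda>x. int_scale k (f x))"
  unfolding smooth_map_u1_iff
proof
  fix x
  obtain V g where V: "open V" "x \<in> V" "smooth_on V g" "\<And>y. y \<in> V \<Longrightarrow> f y = to_u1 (g y)"
    using assms unfolding smooth_map_u1_iff by meson
  have "smooth_on V (\<lambda>y. of_int k * g y)"
    by (rule smooth_on_linear_compose[OF V(1) linear_times V(3)])
  then show "\<exists>V h. open V \<and> x \<in> V \<and> smooth_on V h \<and> (\<forall>y\<in>V. int_scale k (f y) = to_u1 (h y))"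
    using V by (intro exI[of _ V] exI[of _ "\<lambda>y. of_int k * g y"]) (auto simp: int_scale_to_u1)
qed

lemma smooth_u1_minus:
  assumes "smooth_map euclidean_atlas u1_atlas f"
  shows "smooth_map euclidean_atlas u1_atlas (\<lambda>x. - f x)"
proof -
  have "int_scale (-1) s = - s" for s
    by transfer simp
  then show ?thesis
    using smooth_u1_int_scale[OF assms, of "-1"] by simp
qed

lemma smooth_u1_compose_linear:
  assumes "smooth_map euclidean_atlas u1_atlas f" "linear L"
  shows "smooth_map euclidean_atlas u1_atlas (\<lambda>x. f (L x))"
  unfolding smooth_map_u1_iff
proof
  fix x
  obtain V g where V: "open V" "L x \<in> V" "smooth_on V g" "\<And>y. y \<in> V \<Longrightarrow> f y = to_u1 (g y)"
    using assms(1) unfolding smooth_map_u1_iff by meson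
  have "open (L -` V)"
    using V assms(2) by (intro open_vimage linear_continuous_on) (auto simp: linear_linear)
  then show "\<exists>V h. open V \<and> x \<in> V \<and> smooth_on V h \<and> (\<forall>y\<in>V. f (L y) = to_u1 (h y))"
    using V smooth_on_compose_linear[OF V(1) assms(2) V(3)]
    by (intro exI[of _ "L -` V"] exI[of _ "\<lambda>y. g (L y)"]) auto
qed

lemma smooth_u1_linear:
  "linear L \<Longrightarrow> smooth_map euclidean_atlas u1_atlas (\<lambda>x. to_u1 (L x))"
  unfolding smooth_map_u1_iff
  by (intro allI exI[of _ UNIV] exI[of _ L]) (simp add: smooth_on_linear)


section \<open>Additive maps that are differentiable at the origin\<close>

text \<open>
  For an additive \<open>g\<close> the members of this sequence do not depend on \<open>N\<close>, so it computes \<open>g\<close>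
  exactly; for a local lift of an additive map into the circle they agree modulo \<open>\<int>\<close>. In both
  cases differentiability at one point determines the map globally.
\<close>
lemma scaled_differences_tendsto:
  assumes "(g has_derivative D) (at (0::'a::real_normed_vector))"
  shows "(\<lambda>N. real (Suc N) *\<^sub>R (g (inverse (real (Suc N)) *\<^sub>R x) - g 0)) \<longlonglongrightarrow> D x"
proof (cases "x = 0")
  case True
  then show ?thesis
    using linear_0[OF has_derivative_linear[OF assms]] by simp
next
  case False
  \<comment> \<open>The case \<open>x = 0\<close> is separate because the difference quotient divides by the norm of
    the increment.\<close>
  let ?h = "\<lambda>N. inverse (real (Suc N)) *\<^sub>R x"
  have lin: "linear D" using assms by (rule has_derivative_linear)
  have "?h \<longlonglongrightarrow> 0 *\<^sub>R x"
    by (intro tendsto_scaleR LIMSEQ_inverse_real_of_nat tendsto_const)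
  then have "filterlim ?h (at 0) sequentially"
    using False by (simp add: filterlim_at)
  moreover have "((\<lambda>h. norm (g h - g 0 - D h) / norm h) \<longlongrightarrow> 0) (at 0)"
    using assms by (simp add: has_derivative_at)
  ultimately have "(\<lambda>N. norm (g (?h N) - g 0 - D (?h N)) / norm (?h N)) \<longlonglongrightarrow> 0"
    by (rule filterlim_compose[rotated])
  then have "(\<lambda>N. norm x * (norm (g (?h N) - g 0 - D (?h N)) / norm (?h N))) \<longlonglongrightarrow> norm x * 0"
    by (intro tendsto_mult tendsto_const)
  moreover have "norm x * (norm (g (?h N) - g 0 - D (?h N)) / norm (?h N)) =
      norm (real (Suc N) *\<^sub>R (g (?h N) - g 0) - D x)" for N
  proof -
    have "real (Suc N) *\<^sub>R (g (?h N) - g 0) - D x =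
        real (Suc N) *\<^sub>R (g (?h N) - g 0 - D (?h N))"
      by (simp add: linear_scale[OF lin] scaleR_diff_right del: of_nat_Suc)
    then show ?thesis using False by (simp add: divide_simps del: of_nat_Suc)
  qed
  ultimately show ?thesis
    by (simp only: mult_zero_right tendsto_norm_zero_iff LIM_zero_iff)
qed

lemma additive_scaleR_nat:
  fixes f :: "'a::real_vector \<Rightarrow> 'b::real_vector"
  assumes "\<And>x y. f (x + y) = f x + f y"
  shows "f (real N *\<^sub>R x) = real N *\<^sub>R f x"
proof (induction N)
  case 0
  show ?case using assms[of 0 0] by simp
next
  case (Suc N)
  then show ?case by (simp add: scaleR_left_distrib assms add.commute)
qed

lemma additive_differentiable_linear:
  fixes f :: "'a::real_normed_vector \<Rightarrow> 'b::real_normed_vector"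
  assumes add: "\<And>x y. f (x + y) = f x + f y" and "f differentiable (at 0)"
  shows "linear f"
proof -
  obtain D where D: "(f has_derivative D) (at 0)"
    using assms(2) by (auto simp: differentiable_def)
  have "f 0 = 0" using add[of 0 0] by simp
  have "f x = D x" for x
  proof (rule LIMSEQ_unique)
    have "real (Suc N) *\<^sub>R (f (inverse (real (Suc N)) *\<^sub>R x) - f 0) = f x" for N
      using additive_scaleR_nat[of f "Suc N", OF add] \<open>f 0 = 0\<close>
      by (simp del: of_nat_Suc flip: additive_scaleR_nat[of f "Suc N", OF add])
    then show "(\<lambda>N. real (Suc N) *\<^sub>R (f (inverse (real (Suc N)) *\<^sub>R x) - f 0)) \<longlonglongrightarrow> f x"
      by simp
  qed (rule scaled_differences_tendsto[OF D])
  then have "f = D" by blast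
  then show ?thesis
    using D by (auto dest: has_derivative_bounded_linear bounded_linear.linear)
qed

text \<open>
  If \<open>g\<close> lifts \<open>h\<close> near \<open>0\<close> and \<open>c\<close> is its derivative there, then for large \<open>N\<close> the value
  \<open>h (to_u1 x)\<close> is represented by \<open>N (g (x / N) - g 0)\<close>. These reals differ by integers and
  converge to \<open>c x\<close>, hence \<open>c x\<close> represents the same value; taking \<open>x = 1\<close> shows that \<open>c\<close> is an
  integer.
\<close>
lemma u1_endomorphism_is_int_scale:
  assumes add: "\<And>s s'. h (s + s') = h s + h s'"
    and "0 \<in> V" "open V" "g differentiable (at 0)" and lift: "\<And>x. x \<in> V \<Longrightarrow> h (to_u1 x) = to_u1 (g x)"
  obtains k where "h = int_scale k"
proof -
  obtain D where D: "(g has_derivative D) (at 0)"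
    using assms(4) by (auto simp: differentiable_def)
  define c where "c = D 1"
  have Dx: "D x = c * x" for x
    using linear_scale[OF has_derivative_linear[OF D], of x 1] by (simp add: c_def)
  have h0: "h 0 = 0" using add[of 0 0] by simp
  have hN: "h (to_u1 (real N * y)) = to_u1 (real N * r)" if "h (to_u1 y) = to_u1 r" for N y r
    using that by (induction N) (auto simp: h0 algebra_simps to_u1_add add)
  have hx: "h (to_u1 x) = to_u1 (c * x)" for x
  proof -
    obtain r where r: "h (to_u1 x) = to_u1 r" by (metis to_u1_surj)
    let ?y = "\<lambda>N. real (Suc N) *\<^sub>R (g (inverse (real (Suc N)) *\<^sub>R x) - g 0)"
    have "to_u1 (g 0) = 0" using lift[OF \<open>0 \<in> V\<close>] h0 by simp
    then have lift0: "h (to_u1 t) = to_u1 (g t - g 0)" if "t \<in> V" for t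
      using lift[OF that] by (simp add: to_u1_diff)
    have "(\<lambda>N. inverse (real (Suc N)) *\<^sub>R x) \<longlonglongrightarrow> 0 *\<^sub>R x"
      by (intro tendsto_scaleR LIMSEQ_inverse_real_of_nat tendsto_const)
    then have "\<forall>\<^sub>F N in sequentially. inverse (real (Suc N)) *\<^sub>R x \<in> V"
      using assms(2,3) by (auto dest: topological_tendstoD)
    then have ev: "\<forall>\<^sub>F N in sequentially. ?y N - r \<in> \<int>"
    proof eventually_elim
      case (elim N)
      have "real (Suc N) * (inverse (real (Suc N)) *\<^sub>R x) = x"
        by (simp add: divide_simps)
      moreover have "h (to_u1 (real (Suc N) * (inverse (real (Suc N)) *\<^sub>R x))) = to_u1 (?y N)"
        using hN[OF lift0[OF elim], of "Suc N"] by (simp del: of_nat_Suc)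
      ultimately have "to_u1 (?y N) = to_u1 r" using r by metis
      then show ?case by (rule to_u1_eq_iff[THEN iffD1])
    qed
    have lim: "(\<lambda>N. ?y N - r) \<longlonglongrightarrow> c * x - r"
      using scaled_differences_tendsto[OF D, of x] by (intro tendsto_diff) (auto simp: Dx)
    have "c * x - r \<in> \<int>"
      by (rule Lim_in_closed_set[OF closed_Ints ev sequentially_bot lim])
    then have "to_u1 (c * x) = to_u1 r" by (simp only: to_u1_eq_iff)
    then show ?thesis using r by simp
  qed
  have "to_u1 1 = 0" by (simp add: to_u1_eq_0_iff)
  then have "to_u1 c = 0" using hx[of 1] h0 by simp
  then have "c \<in> \<int>" by (simp only: to_u1_eq_0_iff)
  then obtain k where k: "c = of_int k" by (elim Ints_cases)
  have "h s = int_scale k s" for s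
  proof -
    obtain x where "s = to_u1 x" by (metis to_u1_surj)
    then show ?thesis by (simp add: hx k int_scale_to_u1)
  qed
  then show thesis using that by blast
qed

text \<open>
  Multiplication by \<open>k \<noteq> 0\<close> kills the class of \<open>1 / k\<close>, and multiplication by \<open>0\<close> that of
  \<open>1 / 2\<close>.
\<close>
lemma int_scale_injD:
  assumes "inj (int_scale k)"
  shows "k \<in> {1, -1}"
proof -
  have "\<bar>k\<bar> = 1"
  proof (cases "k = 0")
    case True
    then have "int_scale k (to_u1 (1/2)) = int_scale k 0" by (simp add: int_scale_to_u1)
    then have "to_u1 (1/2) = 0" by (rule injD[OF assms])
    then have "(1/2 :: real) \<in> \<int>" by (simp only: to_u1_eq_0_iff)
    then obtain l where "(1/2 :: real) = of_int l" by (elim Ints_cases)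
    then have "real_of_int (2 * l) = real_of_int 1" by simp
    then have "2 * l = 1" by (simp only: of_int_eq_iff)
    then show ?thesis by presburger
  next
    case False
    have "int_scale k (to_u1 (1 / of_int k)) = int_scale k 0"
      using False by (simp add: int_scale_to_u1 to_u1_eq_0_iff)
    then have "to_u1 (1 / of_int k) = 0" by (rule injD[OF assms])
    then have "(1 / of_int k :: real) \<in> \<int>" by (simp only: to_u1_eq_0_iff)
    then obtain l where "(1 / of_int k :: real) = of_int l" by (elim Ints_cases)
    then have "of_int (k * l) = (1 :: real)" using False by (simp add: field_simps)
    then have "k * l = 1" by linarith
    then show ?thesis by (simp add: zmult_eq_1_iff) auto
  qed
  then show ?thesis by auto
qed


section \<open>Integer matrices preserving the hyperbolic form up to sign\<close>

lemma linear_mat_act: "linear (mat_act A)"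
  by (simp add: mat_act_def[abs_def])

lemma map_matrix_mult: "map_matrix of_int (A ** B) = (map_matrix of_int A :: real^'a^'b) ** map_matrix of_int B"
  by (simp add: vec_eq_iff matrix_matrix_mult_def)

lemma mat_act_mult: "mat_act (A ** B) a = mat_act A (mat_act B a)"
  by (simp add: mat_act_def map_matrix_mult matrix_vector_mul_assoc)

lemma mat_act_one [simp]: "mat_act (mat 1) a = a"
proof -
  have "map_matrix of_int (mat 1 :: int^'n^'n) = (mat 1 :: real^'n^'n)" for n :: "'n::finite"
    by (simp add: vec_eq_iff mat_def)
  then have "map_matrix of_int (mat 1 :: int^('a+'a)^('a+'a)) = (mat 1 :: real^('a+'a)^('a+'a))"
    by blast
  then show ?thesis by (simp add: mat_act_def)
qed

lemma mat_act_add: "mat_act A (a + b) = mat_act A a + mat_act A b"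
  using linear_mat_act by (rule linear_add)

lemma mat_act_scaleR: "mat_act A (r *\<^sub>R a) = r *\<^sub>R mat_act A a"
  using linear_mat_act by (rule linear_scale)

lemma mat_act_rvec_of: "mat_act A (rvec_of m) = rvec_of (A *v m)"
  by (simp add: mat_act_def rvec_of_def vec_eq_iff matrix_vector_mult_def)

lemma rvec_of_add: "rvec_of (m + m') = rvec_of m + rvec_of m'"
  by (simp add: rvec_of_def vec_eq_iff)

lemma rvec_of_0 [simp]: "rvec_of 0 = 0"
  by (simp add: rvec_of_def vec_eq_iff)

lemma rvec_of_inject [simp]: "rvec_of m = rvec_of m' \<longleftrightarrow> m = m'"
  by (simp add: rvec_of_def vec_eq_iff)

lemma rvec_of_eq_0_iff [simp]: "rvec_of m = 0 \<longleftrightarrow> m = 0"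
  by (simp add: rvec_of_def vec_eq_iff)

lemma rvec_of_axis: "rvec_of (axis i 1) = axis i 1"
  by (simp add: rvec_of_def vec_eq_iff axis_def)

lemma mat_act_axis: "mat_act A (axis j 1) $ i = of_int (A $ i $ j)"
  by (simp add: mat_act_def matrix_vector_mult_basis column_def)

lemma mat_act_inject: "mat_act A = mat_act B \<longleftrightarrow> A = B"
  by (metis (no_types, lifting) mat_act_axis of_int_eq_iff vec_eq_iff)

lemma sum_UNIV_Plus: "(\<Sum>i\<in>UNIV. f i) = (\<Sum>k\<in>UNIV. f (Inl k)) + (\<Sum>k\<in>UNIV. f (Inr k))"
  for f :: "'a::finite + 'b::finite \<Rightarrow> 'c::comm_monoid_add"
  by (simp add: UNIV_Plus_UNIV[symmetric] sum.Plus del: UNIV_Plus_UNIV)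

lemma bracket_sum: "bracket a b = (\<Sum>k\<in>UNIV. a $ Inr k * b $ Inl k)"
  by (simp add: bracket_def inner_vec_def matrix_vector_mult_def sum_UNIV_Plus Jmat_def
      if_distrib[of "\<lambda>x. x * _"] cong: if_cong)

lemma bracket_add_left: "bracket (a + a') b = bracket a b + bracket a' b"
  by (simp add: bracket_sum sum.distrib algebra_simps)

lemma bracket_add_right: "bracket a (b + b') = bracket a b + bracket a b'"
  by (simp add: bracket_sum sum.distrib algebra_simps)

lemma bracket_scaleR_left: "bracket (r *\<^sub>R a) b = r * bracket a b"
  by (simp add: bracket_sum sum_distrib_left algebra_simps)

lemma bracket_scaleR_right: "bracket a (r *\<^sub>R b) = r * bracket a b"
  by (simp add: bracket_sum sum_distrib_left algebra_simps)

lemma bracket_0_right [simp]: "bracket a 0 = 0"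
  by (simp add: bracket_sum)

text \<open>
  The matrix \<open>Imat\<close> is \<open>Jmat\<close> plus its transpose, so it represents the polarisation of the
  quadratic form \<open>a \<mapsto> bracket a a\<close>.
\<close>
lemma inner_Imat: "a \<bullet> (map_matrix of_int Imat *v b) = bracket a b + bracket b a"
  by (simp add: bracket_sum inner_vec_def matrix_vector_mult_def sum_UNIV_Plus Imat_def
      if_distrib[of "\<lambda>x. x * _"] if_distrib[of of_int] cong: if_cong) (simp add: algebra_simps)

lemma similitude_entry:
  "real_of_int ((transpose A ** Imat ** A) $ i $ j) =
     bracket (mat_act A (axis i 1)) (mat_act A (axis j 1)) +
     bracket (mat_act A (axis j 1)) (mat_act A (axis i 1))"
proof -
  let ?A = "map_matrix of_int A :: real^_^_"
  have entry: "M $ i $ j = axis i 1 \<bullet> (M *v axis j 1)" for M :: "real^'z::finite^'z" and i j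
    by (simp add: matrix_vector_mult_basis column_def inner_axis' )
  have tr: "x \<bullet> (transpose M *v y) = (M *v x) \<bullet> y" for M :: "real^'z::finite^'z" and x y
    by (metis dot_lmul_matrix inner_commute transpose_matrix_vector)
  have "real_of_int ((transpose A ** Imat ** A) $ i $ j) =
      map_matrix of_int (transpose A ** Imat ** A) $ i $ j" by simp
  also have "map_matrix of_int (transpose A ** Imat ** A) =
      transpose ?A ** map_matrix of_int Imat ** ?A"
  proof -
    have "map_matrix real_of_int (transpose A) = transpose ?A"
      by (simp add: vec_eq_iff transpose_def)
    then show ?thesis by (simp add: map_matrix_mult)
  qed
  also have "\<dots> $ i $ j = (?A *v axis i 1) \<bullet> (map_matrix of_int Imat *v (?A *v axis j 1))"
    by (simp only: entry[of _ i j] tr matrix_vector_mul_assoc[symmetric])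
  finally show ?thesis by (simp add: inner_Imat mat_act_def)
qed

text \<open>
  A symmetric form is determined by its quadratic form, and for a matrix identity it suffices to
  evaluate on sums of two standard basis vectors, which are integral. The quadratic criterion
  behaves well under products and inverses of integer matrices, and it is the form in which the
  condition arises from an intertwiner.
\<close>
lemma similitude_iff:
  "transpose A ** Imat ** A = map_matrix ((*) e) Imat \<longleftrightarrow>
     (\<forall>m. bracket (mat_act A (rvec_of m)) (mat_act A (rvec_of m)) =
        of_int e * bracket (rvec_of m) (rvec_of m))"
  (is "?L \<longleftrightarrow> ?R")
proof -
  have Imat: "real_of_int (Imat $ i $ j) =
      bracket (axis i 1) (axis j 1) + bracket (axis j 1) (axis i 1)" for i j :: "'a + 'a"
    using similitude_entry[of "mat 1" i j] by simp
  show ?thesis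
  proof
    assume ?L
    then have e: "bracket (mat_act A (axis i 1)) (mat_act A (axis j 1)) +
        bracket (mat_act A (axis j 1)) (mat_act A (axis i 1)) =
        of_int e * (bracket (axis i 1) (axis j 1) + bracket (axis j 1) (axis i 1))" for i j
      using similitude_entry[of A i j] Imat[of i j] by simp
    let ?S = "\<lambda>a b. bracket (mat_act A a) (mat_act A b) + bracket (mat_act A b) (mat_act A a) -
        of_int e * (bracket a b + bracket b a)"
    have lin: "linear (\<lambda>a. ?S a b)" "linear (\<lambda>b. ?S a b)" for a b
      by (rule linearI; simp add: mat_act_add mat_act_scaleR bracket_add_left bracket_add_right
          bracket_scaleR_left bracket_scaleR_right algebra_simps)+
    have basis: "?S u v = 0" if uv: "u \<in> Basis" "v \<in> Basis" for u v
    proof -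
      obtain i j where "u = axis i 1" "v = axis j 1"
        using uv by (auto simp: Basis_vec_def)
      then show ?thesis using e[of i j] by simp
    qed
    have "?S u b = 0" if "u \<in> Basis" for u b
      using linear_eq_stdbasis[OF lin(2)[of u] linear_zero] basis[OF that] by meson
    then have "?S a b = 0" for a b
      using linear_eq_stdbasis[OF lin(1)[of b] linear_zero] by meson
    then have "?S a a = 0" for a .
    then show ?R by (auto simp: algebra_simps)
  next
    assume R: ?R
    have "(transpose A ** Imat ** A) $ i $ j = e * (Imat $ i $ j)" for i j
    proof -
      have "real_of_int ((transpose A ** Imat ** A) $ i $ j) = of_int (e * (Imat $ i $ j))"
        unfolding similitude_entry of_int_mult Imat
        using R[rule_format, of "axis i 1"] R[rule_format, of "axis j 1"]
          R[rule_format, of "axis i 1 + axis j 1"]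
        by (simp add: rvec_of_add rvec_of_axis mat_act_add bracket_add_left bracket_add_right
            algebra_simps)
      then show ?thesis by (simp only: of_int_eq_iff)
    qed
    then show ?L by (simp add: vec_eq_iff)
  qed
qed

text \<open>
  Membership and sign are characterised together because the sign is unique: \<open>Imat\<close> has an entry
  equal to \<open>1\<close>.
\<close>
lemma Opm_iff:
  "A \<in> Opm \<and> iso_sign A = e \<longleftrightarrow> invertible A \<and> e \<in> {1, -1} \<and>
     (\<forall>m. bracket (mat_act A (rvec_of m)) (mat_act A (rvec_of m)) =
        of_int e * bracket (rvec_of m) (rvec_of m))"
proof -
  let ?P = "\<lambda>e. e \<in> {1, -1} \<and> transpose A ** Imat ** A = map_matrix ((*) e) Imat"
  have uniq: "e = e'" if "?P e" "?P e'" for e e'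
  proof -
    \<comment> \<open>Compare the entries at a position where \<open>Imat\<close> is \<open>1\<close>.\<close>
    have "map_matrix ((*) e) Imat = map_matrix ((*) e') (Imat :: 'a imat)"
      using that by simp
    then have "e * (Imat $ Inl k $ Inr k) = e' * (Imat $ Inl k $ Inr k)" for k :: 'a
      by (metis nth_map_matrix)
    then show ?thesis by (simp add: Imat_def)
  qed
  have "map_matrix ((*) 1) Imat = (Imat :: 'a imat)" "map_matrix ((*) (-1)) Imat = - (Imat :: 'a imat)"
    by (simp_all add: vec_eq_iff)
  then have "(\<exists>e. ?P e) \<longleftrightarrow>
      transpose A ** Imat ** A = Imat \<or> transpose A ** Imat ** A = - Imat"
    by (metis insertCI insertE singletonD)
  then have mem: "A \<in> Opm \<longleftrightarrow> invertible A \<and> (\<exists>e. ?P e)"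
    unfolding Opm_def by simp
  have sign: "iso_sign A = e" if "?P e" for e
    unfolding iso_sign_def by (rule the_equality) (use that uniq in blast)+
  have "A \<in> Opm \<and> iso_sign A = e \<longleftrightarrow> invertible A \<and> ?P e"
  proof
    assume A: "A \<in> Opm \<and> iso_sign A = e"
    then obtain e' where e': "?P e'" using mem by auto
    then show "invertible A \<and> ?P e" using A mem sign[OF e'] by simp
  next
    assume A: "invertible A \<and> ?P e"
    then have "\<exists>e. ?P e" by (intro exI[of _ e]) simp
    then show "A \<in> Opm \<and> iso_sign A = e" using A mem sign[of e] by simp
  qed
  then show ?thesis by (simp only: similitude_iff)
qed

lemma iso_sign_cases: "A \<in> Opm \<Longrightarrow> iso_sign A \<in> {1, -1}"
  using Opm_iff by blast

lemma bracket_similitude: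
  "A \<in> Opm \<Longrightarrow> bracket (mat_act A (rvec_of m)) (mat_act A (rvec_of m)) =
     of_int (iso_sign A) * bracket (rvec_of m) (rvec_of m)"
  using Opm_iff by blast

lemma iso_sign_square [simp]: "A \<in> Opm \<Longrightarrow> iso_sign A * iso_sign A = 1"
  using iso_sign_cases by fastforce

lemma Opm_invertible: "A \<in> Opm \<Longrightarrow> invertible A"
  by (simp add: Opm_def)

lemma one_in_Opm [simp]: "(mat 1 :: ('n::finite) imat) \<in> Opm"
  and iso_sign_one [simp]: "iso_sign (mat 1 :: 'n imat) = 1"
proof -
  have "(mat 1 :: 'n imat) \<in> Opm \<and> iso_sign (mat 1 :: 'n imat) = 1"
    by (subst Opm_iff) (auto simp: invertible_def intro: exI[of _ "mat 1"])
  then show "(mat 1 :: 'n imat) \<in> Opm" "iso_sign (mat 1 :: 'n imat) = 1" by auto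
qed

lemma Opm_mult:
  assumes "A \<in> Opm" "B \<in> Opm"
  shows "A ** B \<in> Opm \<and> iso_sign (A ** B) = iso_sign A * iso_sign B"
proof -
  have "bracket (mat_act (A ** B) (rvec_of m)) (mat_act (A ** B) (rvec_of m)) =
      of_int (iso_sign A * iso_sign B) * bracket (rvec_of m) (rvec_of m)" for m
    using bracket_similitude[OF assms(1), of "B *v m"] bracket_similitude[OF assms(2), of m]
    by (simp add: mat_act_mult) (simp add: mat_act_rvec_of)
  moreover have "invertible (A ** B)"
    using assms by (simp add: invertible_mult Opm_invertible)
  ultimately show ?thesis
    using iso_sign_cases[OF assms(1)] iso_sign_cases[OF assms(2)] by (subst Opm_iff) auto
qed

lemma Opm_inverse:
  assumes "A \<in> Opm"
  obtains B where "B \<in> Opm" "iso_sign B = iso_sign A" "A ** B = mat 1" "B ** A = mat 1"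
proof -
  obtain B where B: "A ** B = mat 1" "B ** A = mat 1"
    using Opm_invertible[OF assms] by (auto simp: invertible_def)
  have sq: "real_of_int (iso_sign A) * real_of_int (iso_sign A) = 1"
    using iso_sign_cases[OF assms] by auto
  have "bracket (mat_act B (rvec_of m)) (mat_act B (rvec_of m)) =
      of_int (iso_sign A) * bracket (rvec_of m) (rvec_of m)" for m
  proof -
    have "bracket (rvec_of m) (rvec_of m) =
        of_int (iso_sign A) * bracket (mat_act B (rvec_of m)) (mat_act B (rvec_of m))"
      using bracket_similitude[OF assms] B(1)
      by (metis mat_act_mult mat_act_one mat_act_rvec_of)
    then show ?thesis using sq by (simp add: mult.assoc[symmetric])
  qed
  moreover have "invertible B" using B by (auto simp: invertible_def)
  ultimately have "B \<in> Opm \<and> iso_sign B = iso_sign A"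
    using iso_sign_cases[OF assms] by (subst Opm_iff) auto
  then show thesis using that B by blast
qed


section \<open>Crossed intertwiners of the T-duality 2-group\<close>

text \<open>
  The general invertible intertwiner of the T-duality 2-group. The comparison functor reaches
  those with \<open>\<kappa> = 0\<close>; the character \<open>\<kappa>\<close> of the lattice is the additional freedom in an
  automorphism of \<open>\<int>\<^sup>2\<^sup>n \<times> U(1)\<close> with prescribed action on both factors.
\<close>
definition twisted ::
    "('n::finite) pairA \<Rightarrow> ('n ivec \<Rightarrow> u1) \<Rightarrow> ('n rvec, 'n ivec \<times> u1) intertwiner" where
  "twisted = (\<lambda>(A, \<eta>) \<kappa>.
     (mat_act A, \<lambda>(m, s). (A *v m, \<kappa> m + int_scale (iso_sign A) s), \<lambda>x. (0, \<eta> x)))"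

lemma I_obj_eq_twisted: "I_obj X = twisted X (\<lambda>_. 0)"
  by (simp add: I_obj_def twisted_def fun_eq_iff split_beta)

lemma twisted_inject: "twisted X \<kappa> = twisted X' \<kappa>' \<longleftrightarrow> X = X' \<and> \<kappa> = \<kappa>'"
proof (intro iffI conjI)
  assume eq: "twisted X \<kappa> = twisted X' \<kappa>'"
  obtain A \<eta> A' \<eta>' where X: "X = (A, \<eta>)" "X' = (A', \<eta>')" by fastforce
  have "mat_act A = mat_act A'" using eq by (simp add: X twisted_def)
  moreover have "\<eta> = \<eta>'" using eq by (auto simp: X twisted_def fun_eq_iff)
  ultimately show "X = X'" by (simp add: X mat_act_inject)
  then have "A = A'" by (simp add: X)
  have "snd (fst (snd (twisted X \<kappa>)) (m, 0)) = snd (fst (snd (twisted X' \<kappa>')) (m, 0))" for m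
    by (simp add: eq)
  then show "\<kappa> = \<kappa>'" by (simp add: X twisted_def fun_eq_iff)
qed simp

lemma TD_simps [simp]:
  "AtlG TD = euclidean_atlas" "AtlH TD = lattice_u1_atlas"
  "bdry TD h = rvec_of (fst h)"
  "act TD a h = (fst h, snd h - to_u1 (bracket a (rvec_of (fst h))))"
  by (simp_all add: TD_def case_prod_unfold)

lemma kerU_TD: "h \<in> kerU TD \<longleftrightarrow> fst h = 0"
  by (simp add: kerU_def)

lemma prod_atlas_euclidean: "prod_atlas euclidean_atlas euclidean_atlas = euclidean_atlas"
  by (auto simp: prod_atlas_def euclidean_atlas_def map_prod.id)

lemma lattice_u1_atlas_iff:
  "(W, q) \<in> lattice_u1_atlas \<longleftrightarrow> (\<exists>m c. q = (\<lambda>x. (m, to_u1 x)) \<and> W = {c - 1/2 <..< c + 1/2})"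
  by (auto simp: lattice_u1_atlas_def u1_atlas_def)

lemma smooth_mapD:
  assumes "smooth_map \<A> \<B> f" "(W, p) \<in> \<A>" "x \<in> W"
  shows "\<exists>(W', q)\<in>\<B>. \<exists>V g. open V \<and> x \<in> V \<and> V \<subseteq> W \<and> smooth_on V g \<and> g ` V \<subseteq> W' \<and>
    (\<forall>y\<in>V. f (p y) = q (g y))"
  using assms unfolding smooth_map_def by fast

lemma smooth_map_euclidean_iff:
  "smooth_map euclidean_atlas \<B> f \<longleftrightarrow> (\<forall>x. \<exists>(W', q)\<in>\<B>. \<exists>V g.
     open V \<and> x \<in> V \<and> smooth_on V g \<and> g ` V \<subseteq> W' \<and> (\<forall>y\<in>V. f y = q (g y)))"
  by (simp add: smooth_map_def euclidean_atlas_def)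

lemma smooth_into_kernel_iff:
  "smooth_map euclidean_atlas (lattice_u1_atlas :: (('n::finite) ivec \<times> u1, real) atlas)
       (\<lambda>x. (0, f x)) \<longleftrightarrow>
     smooth_map euclidean_atlas u1_atlas f"
  (is "?L \<longleftrightarrow> ?R")
proof
  assume L: ?L
  show ?R
    unfolding smooth_map_u1_iff
  proof
    fix x
    have "\<exists>(W', q)\<in>(lattice_u1_atlas :: ('n ivec \<times> u1, real) atlas). \<exists>V g.
        open V \<and> x \<in> V \<and> smooth_on V g \<and> g ` V \<subseteq> W' \<and> (\<forall>y\<in>V. (0, f y) = q (g y))"
      using L unfolding smooth_map_euclidean_iff by (rule spec)
    then obtain W' q V g where q: "(W', q) \<in> (lattice_u1_atlas :: ('n ivec \<times> u1, real) atlas)"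
      and V: "open V" "x \<in> V" "smooth_on V g" "\<And>y. y \<in> V \<Longrightarrow> (0, f y) = q (g y)"
      by blast
    obtain m where "q = (\<lambda>x. (m, to_u1 x))"
      using q unfolding lattice_u1_atlas_iff by blast
    then show "\<exists>V g. open V \<and> x \<in> V \<and> smooth_on V g \<and> (\<forall>y\<in>V. f y = to_u1 (g y))"
      using V by (intro exI[of _ V] exI[of _ g]) simp
  qed
next
  assume R: ?R
  have "\<exists>W' q. (W', q) \<in> (lattice_u1_atlas :: ('n ivec \<times> u1, real) atlas) \<and>
      (\<exists>V g. open V \<and> x \<in> V \<and> smooth_on V g \<and> g ` V \<subseteq> W' \<and> (\<forall>y\<in>V. (0, f y) = q (g y)))" for x
  proof -
    have "\<exists>(W', p)\<in>u1_atlas. \<exists>V g.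
        open V \<and> x \<in> V \<and> smooth_on V g \<and> g ` V \<subseteq> W' \<and> (\<forall>y\<in>V. f y = p (g y))"
      using R unfolding smooth_map_euclidean_iff by (rule spec)
    then obtain W' p V g where p: "(W', p) \<in> u1_atlas"
      and V: "open V" "x \<in> V" "smooth_on V g" "g ` V \<subseteq> W'" "\<And>y. y \<in> V \<Longrightarrow> f y = p (g y)"
      by blast
    have "(W', \<lambda>y. (0, p y)) \<in> (lattice_u1_atlas :: ('n ivec \<times> u1, real) atlas)"
      using p unfolding lattice_u1_atlas_def by blast
    moreover have "\<exists>V g. open V \<and> x \<in> V \<and> smooth_on V g \<and> g ` V \<subseteq> W' \<and> (\<forall>y\<in>V. (0, f y) = (0, p (g y)))"
      using V by (intro exI[of _ V] exI[of _ g]) simp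
    ultimately show ?thesis by blast
  qed
  then show ?L
    unfolding smooth_map_def euclidean_atlas_def by (auto simp: Bex_def split_beta)
qed

lemma smooth_euclidean_linear: "linear L \<Longrightarrow> smooth_map euclidean_atlas euclidean_atlas L"
  unfolding smooth_map_def euclidean_atlas_def
  by (auto intro!: exI[of _ UNIV] exI[of _ L] smooth_on_linear)

lemma lie_group_iso_linear:
  assumes "lie_group_iso euclidean_atlas \<phi>"
  shows "linear \<phi>"
proof (rule additive_differentiable_linear)
  show "\<phi> (x + y) = \<phi> x + \<phi> y" for x y
    using assms by (simp add: lie_group_iso_def)
  have "\<exists>V g. open V \<and> 0 \<in> V \<and> smooth_on V g \<and> (\<forall>y\<in>V. \<phi> y = g y)"
    using assms unfolding lie_group_iso_def smooth_map_def euclidean_atlas_def by simp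
  then obtain V g where V: "open V" "0 \<in> V" "smooth_on V g" "\<And>y. y \<in> V \<Longrightarrow> \<phi> y = g y"
    by meson
  obtain D where "(g has_derivative D) (at 0)"
    using smooth_on_differentiable[OF V(3,2)] by (auto simp: differentiable_def)
  then have "(\<phi> has_derivative D) (at 0)"
    using has_derivative_transform_within_open[OF _ V(1,2)] V(4) by metis
  then show "\<phi> differentiable at 0"
    by (auto simp: differentiable_def)
qed

lemma lie_group_iso_inv:
  assumes "lie_group_iso \<A> f"
  shows "lie_group_iso \<A> (inv f)"
proof -
  have f: "bij f" "\<And>x y. f (x + y) = f x + f y"
    using assms by (auto simp: lie_group_iso_def)
  have "inv f (x + y) = inv f x + inv f y" for x y
    using f by (metis bij_inv_eq_iff)
  then show ?thesis
    using assms by (simp add: lie_group_iso_def bij_imp_bij_inv inv_inv_eq)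
qed

lemma lattice_preserving_matrix:
  fixes f :: "('n::finite) ivec \<times> u1 \<Rightarrow> 'n ivec \<times> u1"
  assumes "linear \<phi>" and lattice: "\<And>m s. \<phi> (rvec_of m) = rvec_of (fst (f (m, s)))"
  obtains A where "\<phi> = mat_act A" "\<And>m s. fst (f (m, s)) = A *v m"
proof -
  define A where "A = (\<chi> i j. fst (f (axis j 1, 0)) $ i)"
  have "\<phi> (axis j 1) = mat_act A (axis j 1)" for j
  proof -
    have "\<phi> (axis j 1) = rvec_of (fst (f (axis j 1, 0)))"
      using lattice[of "axis j 1" 0] by (simp add: rvec_of_axis)
    then show ?thesis
      by (simp add: vec_eq_iff mat_act_axis A_def) (simp add: rvec_of_def)
  qed
  then have "\<phi> b = mat_act A b" if "b \<in> Basis" for b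
    using that by (auto simp: Basis_vec_def)
  then have A: "\<phi> = mat_act A"
    by (intro linear_eq_stdbasis assms linear_mat_act)
  moreover have "fst (f (m, s)) = A *v m" for m s
    using lattice[of m s] by (simp add: A mat_act_rvec_of)
  ultimately show thesis using that by blast
qed

text \<open>
  On each sheet the map lifts to an affine map of slope \<open>\<plusminus>1\<close>, which carries intervals of length
  one to intervals of length one, that is, chart domains to chart domains.
\<close>
lemma smooth_lattice_automorphism:
  assumes "e \<in> {1, -1}"
  shows "smooth_map lattice_u1_atlas lattice_u1_atlas (\<lambda>(m, s). (A *v m, \<kappa> m + int_scale e s))"
proof -
  have "\<exists>W' q. (W', q) \<in> lattice_u1_atlas \<and> (\<exists>V g. open V \<and> x \<in> V \<and> V \<subseteq> W \<and> smooth_on V g \<and>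
      g ` V \<subseteq> W' \<and> (\<forall>y\<in>V. (\<lambda>(m, s). (A *v m, \<kappa> m + int_scale e s)) (p y) = q (g y)))"
    if p: "(W, p) \<in> lattice_u1_atlas" and "x \<in> W" for W p x
  proof -
    obtain m c where mc: "p = (\<lambda>x. (m, to_u1 x))" "W = {c - 1/2 <..< c + 1/2}"
      using p unfolding lattice_u1_atlas_iff by blast
    obtain k where k: "\<kappa> m = to_u1 k" by (metis to_u1_surj)
    let ?g = "\<lambda>y. k + of_int e * y"
    let ?W' = "{?g c - 1/2 <..< ?g c + 1/2}"
    have "(?W', \<lambda>x. (A *v m, to_u1 x)) \<in> lattice_u1_atlas"
      unfolding lattice_u1_atlas_iff by blast
    moreover have "smooth_on W ?g"
      by (rule smooth_on_add[OF _ smooth_on_const smooth_on_linear[OF linear_times]]) (simp add: mc)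
    moreover have "?g ` W \<subseteq> ?W'"
      using assms by (auto simp: mc)
    moreover have "\<forall>y\<in>W. (\<lambda>(m, s). (A *v m, \<kappa> m + int_scale e s)) (p y) = (A *v m, to_u1 (?g y))"
      by (simp add: mc k int_scale_to_u1 to_u1_add)
    moreover have "open W" by (simp add: mc)
    ultimately show ?thesis using \<open>x \<in> W\<close> by blast
  qed
  then show ?thesis
    unfolding smooth_map_def by (simp add: Bex_def split_beta)
qed

lemma lie_group_iso_mat_act:
  assumes "A ** B = mat 1" "B ** A = mat 1"
  shows "lie_group_iso euclidean_atlas (mat_act A)"
proof -
  have inv: "mat_act A \<circ> mat_act B = id" "mat_act B \<circ> mat_act A = id"
    using assms by (auto simp: fun_eq_iff mat_act_mult[symmetric])
  then have "inv (mat_act A) = mat_act B"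
    by (metis inv_unique_comp)
  then show ?thesis
    using inv by (auto simp: lie_group_iso_def mat_act_add o_bij
        intro: smooth_euclidean_linear linear_mat_act)
qed

lemma lie_group_iso_lattice:
  assumes AB: "A ** B = mat 1" "B ** A = mat 1" and e: "e \<in> {1, -1}" and \<kappa>: "Modules.additive \<kappa>"
  shows "lie_group_iso lattice_u1_atlas (\<lambda>(m, s). (A *v m, \<kappa> m + int_scale e s))"
    (is "lie_group_iso _ ?f")
proof -
  let ?g = "\<lambda>(m, s). (B *v m, - int_scale e (\<kappa> (B *v m)) + int_scale e s)"
  have "e * e = 1" using e by auto
  then have inv: "?f \<circ> ?g = id" "?g \<circ> ?f = id"
    using AB by (auto simp: fun_eq_iff matrix_vector_mul_assoc int_scale_add int_scale_minus int_scale_diff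
        int_scale_mult)
  have "inv ?f = ?g"
    by (rule inv_unique_comp[OF inv])
  then have smooth_inv: "smooth_map lattice_u1_atlas lattice_u1_atlas (inv ?f)"
    by (simp only: smooth_lattice_automorphism[OF e])
  have "bij ?f" by (rule o_bij[OF inv(2,1)])
  have "?f (x + y) = ?f x + ?f y" for x y
    by (cases x; cases y) (simp add: Modules.additive.add[OF \<kappa>] int_scale_add
        matrix_vector_right_distrib)
  then show ?thesis
    unfolding lie_group_iso_def
    by (intro conjI allI \<open>bij ?f\<close> smooth_lattice_automorphism[OF e] smooth_inv)
qed

text \<open>
  The axiom of an intertwiner involves \<open>\<eta> (g, b - g)\<close> and \<open>\<eta> (b - g, g)\<close>, while the symmetry
  condition in \<open>A_obj\<close> involves \<open>\<eta> (g, b)\<close> and \<open>\<eta> (b, g)\<close>. The cocycle identity for \<open>g, b - g, g\<close>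
  translates one into the other.
\<close>
lemma cocycle_symmetry:
  fixes \<eta> :: "'a::ab_group_add \<times> 'a \<Rightarrow> u1"
  assumes "\<And>a a' a''. \<eta> (a, a') + \<eta> (a + a', a'') = \<eta> (a', a'') + \<eta> (a, a' + a'')"
  shows "\<eta> (g, b - g) - \<eta> (b - g, g) = \<eta> (g, b) - \<eta> (b, g)"
  using assms[of g "b - g" g] by (simp add: algebra_simps)

lemma invertible_twisted:
  assumes obj: "(A, \<eta>) \<in> A_obj" and \<kappa>: "Modules.additive \<kappa>"
  shows "invertible_intertwiner TD (twisted (A, \<eta>) \<kappa>)"
proof -
  have A: "A \<in> Opm" and smooth: "smooth_map euclidean_atlas u1_atlas \<eta>"
    and int: "\<And>m m'. \<eta> (rvec_of m, rvec_of m') = 0"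
    and sym: "\<And>a m. \<eta> (rvec_of m, a) + int_scale (iso_sign A) (to_u1 (bracket a (rvec_of m))) =
        \<eta> (a, rvec_of m) + to_u1 (bracket (mat_act A a) (mat_act A (rvec_of m)))"
    and cocycle: "\<And>a a' a''. \<eta> (a, a') + \<eta> (a + a', a'') = \<eta> (a', a'') + \<eta> (a, a' + a'')"
    using obj by (auto simp: A_obj_def)
  obtain B where B: "A ** B = mat 1" "B ** A = mat 1"
    using Opm_inverse[OF A] by blast
  have compat: "\<eta> (g, rvec_of m - g) + int_scale (iso_sign A) (s - to_u1 (bracket g (rvec_of m))) =
      \<eta> (rvec_of m - g, g) + int_scale (iso_sign A) s - to_u1 (bracket (mat_act A g) (rvec_of (A *v m)))"
    for g m s
  proof -
    have "\<eta> (g, rvec_of m - g) - \<eta> (rvec_of m - g, g) =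
        int_scale (iso_sign A) (to_u1 (bracket g (rvec_of m))) -
        to_u1 (bracket (mat_act A g) (rvec_of (A *v m)))"
      using sym[of m g] unfolding cocycle_symmetry[of \<eta> g "rvec_of m", OF cocycle]
      by (simp add: mat_act_rvec_of algebra_simps)
    then show ?thesis by (simp add: int_scale_diff algebra_simps)
  qed
  show ?thesis
    unfolding invertible_intertwiner_def twisted_def prod.case
  proof (intro conjI allI)
    show "lie_group_iso (AtlG TD) (mat_act A)"
      using lie_group_iso_mat_act[OF B] by simp
    show "lie_group_iso (AtlH TD) (\<lambda>(m, s). (A *v m, \<kappa> m + int_scale (iso_sign A) s))"
      using lie_group_iso_lattice[OF B iso_sign_cases[OF A] \<kappa>] by simp
    show "range (\<lambda>x. (0, \<eta> x)) \<subseteq> kerU TD"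
      by (auto simp: kerU_TD)
    show "smooth_map (prod_atlas (AtlG TD) (AtlG TD)) (AtlH TD) (\<lambda>x. (0, \<eta> x))"
      using smooth by (simp add: prod_atlas_euclidean smooth_into_kernel_iff)
    show "mat_act A (bdry TD h) = bdry TD (case h of (m, s) \<Rightarrow> (A *v m, \<kappa> m + int_scale (iso_sign A) s))" for h
      by (simp add: mat_act_rvec_of split_beta)
    show "(0, \<eta> (bdry TD h, bdry TD h')) = 0" for h h' :: "'a ivec \<times> u1"
      by (simp add: int zero_prod_def)
    show "(0, \<eta> (g, bdry TD h - g)) +
          (case act TD g h of (m, s) \<Rightarrow> (A *v m, \<kappa> m + int_scale (iso_sign A) s)) =
        act TD (mat_act A g) (0, \<eta> (bdry TD h - g, g)) +
          act TD (mat_act A g) (case h of (m, s) \<Rightarrow> (A *v m, \<kappa> m + int_scale (iso_sign A) s))" for g h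
      using compat[of g "fst h" "snd h"] by (simp add: split_beta algebra_simps)
    show "(0, \<eta> (g, g')) + (0, \<eta> (g + g', g'')) =
        act TD (mat_act A g) (0, \<eta> (g', g'')) + (0, \<eta> (g, g' + g''))" for g g' g''
      using cocycle[of g g' g''] by simp
  qed
qed

text \<open>
  The antisymmetrisation \<open>w\<close> of a cocycle on an abelian group is biadditive, and it vanishes on
  the diagonal. By the symmetry condition it is known when the second argument is a lattice
  point: there it is the class of \<open>e [a, b] - [A a, A b]\<close>, with \<open>[a, b]\<close> for \<open>bracket a b\<close>.
  Writing \<open>D\<close> for the value of this form at \<open>(m, m)\<close>, biadditivity moves a factor \<open>N\<close> across the
  arguments and gives \<open>0 = w (m/N, m/N) = w (m/N\<^sup>2, m)\<close>, the class of \<open>D / N\<^sup>2\<close>. So \<open>D / N\<^sup>2\<close> is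
  an integer for every \<open>N\<close>, which forces \<open>D = 0\<close>.
\<close>
lemma cocycle_similitude:
  fixes \<eta> :: "'n::finite rvec \<times> 'n rvec \<Rightarrow> u1"
  assumes cocycle: "\<And>a a' a''. \<eta> (a, a') + \<eta> (a + a', a'') = \<eta> (a', a'') + \<eta> (a, a' + a'')"
    and sym: "\<And>a m. \<eta> (rvec_of m, a) + int_scale e (to_u1 (bracket a (rvec_of m))) =
        \<eta> (a, rvec_of m) + to_u1 (bracket (mat_act A a) (mat_act A (rvec_of m)))"
  shows "bracket (mat_act A (rvec_of m)) (mat_act A (rvec_of m)) =
           of_int e * bracket (rvec_of m) (rvec_of m)"
proof -
  define w where "w a b = \<eta> (a, b) - \<eta> (b, a)" for a b
  define D where "D = of_int e * bracket (rvec_of m) (rvec_of m) -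
    bracket (mat_act A (rvec_of m)) (mat_act A (rvec_of m))"
  have add_left: "w (a + a') b = w a b + w a' b" for a a' b
  proof -
    \<comment> \<open>The cocycle identities for \<open>(a, a', b)\<close>, \<open>(b, a, a')\<close> and \<open>(a, b, a')\<close>, with signs
      \<open>+, +, -\<close>.\<close>
    have "w (a + a') b - (w a b + w a' b) =
        ((\<eta> (a, a') + \<eta> (a + a', b)) - (\<eta> (a', b) + \<eta> (a, a' + b))) +
        ((\<eta> (b, a) + \<eta> (b + a, a')) - (\<eta> (a, a') + \<eta> (b, a + a'))) -
        ((\<eta> (a, b) + \<eta> (a + b, a')) - (\<eta> (b, a') + \<eta> (a, b + a')))"
      by (simp add: w_def algebra_simps)
    then show ?thesis
      unfolding cocycle[of a a' b] cocycle[of b a a'] cocycle[of a b a'] by simp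
  qed
  have anti: "w b a = - w a b" for a b
    by (simp add: w_def)
  have add_right: "w a (b + b') = w a b + w a b'" for a b b'
    using add_left[of b b' a] anti[of a] anti by (metis minus_add_distrib)
  have zero: "w 0 b = 0" "w b 0 = 0" for b
    using add_left[of 0 0 b] add_right[of b 0 0] by auto
  have move: "w (real N *\<^sub>R a) b = w a (real N *\<^sub>R b)" for N a b
    by (induction N) (auto simp: zero scaleR_left_distrib add_left add_right)
  have int: "to_u1 (D / (real N)\<^sup>2) = 0" if "N > 0" for N
  proof -
    let ?m = "rvec_of m"
    have "0 = w (inverse (real N) *\<^sub>R ?m) (inverse (real N) *\<^sub>R ?m)"
      by (simp add: w_def)
    also have "\<dots> = w (real N *\<^sub>R ((inverse (real N))\<^sup>2 *\<^sub>R ?m)) (inverse (real N) *\<^sub>R ?m)"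
      using that by (simp add: power2_eq_square flip: mult.assoc)
    also have "\<dots> = w ((inverse (real N))\<^sup>2 *\<^sub>R ?m) ?m"
      using that by (simp only: move) simp
    also have "\<dots> = to_u1 (D / (real N)\<^sup>2)"
      using sym[of m "(inverse (real N))\<^sup>2 *\<^sub>R ?m"]
      by (simp add: w_def D_def int_scale_to_u1 mat_act_scaleR bracket_scaleR_left to_u1_diff
          algebra_simps divide_inverse power_inverse)
    finally show ?thesis by simp
  qed
  \<comment> \<open>Any \<open>N\<close> above the absolute value of \<open>D\<close> makes the integer \<open>D / N\<^sup>2\<close> smaller than
    one.\<close>
  obtain N :: nat where N: "\<bar>D\<bar> < real N" by (metis reals_Archimedean2)
  then have "N > 0" by (metis abs_ge_zero gr0I le_less_trans less_irrefl of_nat_0)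
  have "real N \<le> (real N)\<^sup>2" using \<open>N > 0\<close> by (simp add: power2_eq_square)
  then have "\<bar>D\<bar> < (real N)\<^sup>2" using N by linarith
  then have "\<bar>D / (real N)\<^sup>2\<bar> < 1" using \<open>N > 0\<close> by (simp add: abs_divide)
  moreover have "D / (real N)\<^sup>2 \<in> \<int>"
    using int[OF \<open>N > 0\<close>] by (simp only: to_u1_eq_0_iff)
  ultimately have "D / (real N)\<^sup>2 = 0"
    using Ints_nonzero_abs_less1 by blast
  then show ?thesis using \<open>N > 0\<close> by (simp add: D_def)
qed

text \<open>
  Compatibility with the boundary map makes the linear map \<open>\<phi>\<close> and its inverse preserve the
  lattice, so \<open>\<phi>\<close> is an invertible integer matrix \<open>A\<close>. The second map then sends \<open>(m, s)\<close> to
  \<open>(A m, \<kappa> m + h s)\<close> with \<open>h\<close> an automorphism of the circle, hence a sign. That this sign is the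
  one by which \<open>A\<close> transforms \<open>Imat\<close>, and that \<open>A\<close> transforms \<open>Imat\<close> by a sign at all, is
  \<open>cocycle_similitude\<close>.
\<close>
lemma invertible_intertwiner_twisted:
  assumes inv: "invertible_intertwiner TD (X :: ('n::finite rvec, _) intertwiner)"
  obtains Y \<kappa> where "X = twisted Y \<kappa>" "Y \<in> A_obj" "Modules.additive \<kappa>"
proof -
  obtain \<phi> f H where X: "X = (\<phi>, f, H)" by (metis prod_cases3)
  have iso: "lie_group_iso euclidean_atlas \<phi>" "lie_group_iso lattice_u1_atlas f"
    and range: "range H \<subseteq> kerU TD"
    and smooth: "smooth_map euclidean_atlas lattice_u1_atlas H"
    and bdry: "\<And>m s. \<phi> (rvec_of m) = rvec_of (fst (f (m, s)))"
    and H0: "\<And>m m'. H (rvec_of m, rvec_of m') = 0"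
    and compat: "\<And>g h. H (g, bdry TD h - g) + f (act TD g h) =
        act TD (\<phi> g) (H (bdry TD h - g, g)) + act TD (\<phi> g) (f h)"
    and cocycle: "\<And>g g' g''. H (g, g') + H (g + g', g'') =
        act TD (\<phi> g) (H (g', g'')) + H (g, g' + g'')"
    using inv unfolding X invertible_intertwiner_def by (auto simp: prod_atlas_euclidean)
  have f_add: "f (x + y) = f x + f y" and "bij f" for x y
    using iso(2) unfolding lie_group_iso_def by blast+
  have "bij \<phi>" using iso(1) by (simp add: lie_group_iso_def)
  obtain A where A: "\<phi> = mat_act A" "\<And>m s. fst (f (m, s)) = A *v m"
    using lattice_preserving_matrix[OF lie_group_iso_linear[OF iso(1)] bdry] by blast
  \<comment> \<open>The inverse pair preserves the lattice for the same reason, so the inverse matrix is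
    integral.\<close>
  have "inv \<phi> (rvec_of m) = rvec_of (fst (inv f (m, s)))" for m s
    using bdry[of "fst (inv f (m, s))" "snd (inv f (m, s))"] \<open>bij \<phi>\<close> \<open>bij f\<close>
    by (simp add: bij_is_surj surj_f_inv_f) (metis bij_inv_eq_iff)
  then obtain B where B: "inv \<phi> = mat_act B"
    using lattice_preserving_matrix[OF lie_group_iso_linear[OF lie_group_iso_inv[OF iso(1)]]] by metis
  have "mat_act (A ** B) = mat_act (mat 1)" "mat_act (B ** A) = mat_act (mat 1)"
    using \<open>bij \<phi>\<close> unfolding fun_eq_iff mat_act_mult A(1)[symmetric] B[symmetric]
    by (simp_all add: bij_is_surj surj_f_inv_f bij_is_inj)
  then have "invertible A"
    unfolding mat_act_inject by (auto simp: invertible_def)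

  define \<kappa> where "\<kappa> m = snd (f (m, 0))" for m
  define h where "h s = snd (f (0, s))" for s
  have f: "f (m, s) = (A *v m, \<kappa> m + h s)" for m s
  proof -
    have "f (m, s) = f (m, 0) + f (0, s)" using f_add[of "(m, 0)" "(0, s)"] by simp
    then show ?thesis using A(2)[of m s] by (simp add: prod_eq_iff \<kappa>_def h_def)
  qed
  have \<kappa>: "Modules.additive \<kappa>"
    using f_add[of "(_, 0)" "(_, 0)"] by unfold_locales (simp add: \<kappa>_def)
  have h_add: "h (s + s') = h s + h s'" for s s'
    using f_add[of "(0, s)" "(0, s')"] by (simp add: h_def)
  have "inj h"
  proof (rule injI)
    fix s s' assume "h s = h s'"
    then have "f (0, s) = f (0, s')" by (simp add: f)
    then show "s = s'" using \<open>bij f\<close> by (simp add: bij_is_inj inj_eq)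
  qed
  obtain k where k: "h = int_scale k" and "k \<in> {1, -1}"
  proof -
    \<comment> \<open>The chart around the unit, read on the sheet \<open>m = 0\<close>, supplies a smooth lift of
      \<open>h\<close>.\<close>
    have chart: "({0 - 1/2 <..< 0 + 1/2}, \<lambda>x. (0, to_u1 x)) \<in> lattice_u1_atlas"
      unfolding lattice_u1_atlas_iff by blast
    have "smooth_map lattice_u1_atlas lattice_u1_atlas f"
      using iso(2) by (simp add: lie_group_iso_def)
    then have "\<exists>(W', q)\<in>lattice_u1_atlas. \<exists>V g. open V \<and> 0 \<in> V \<and>
        V \<subseteq> {0 - 1/2 <..< 0 + 1/2} \<and> smooth_on V g \<and> g ` V \<subseteq> W' \<and>
        (\<forall>y\<in>V. f (0, to_u1 y) = q (g y))"
      by (rule smooth_mapD[OF _ chart]) simp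
    then obtain W' q V g where q: "(W', q) \<in> lattice_u1_atlas"
      and V: "open V" "0 \<in> V" "smooth_on V g" "\<And>y. y \<in> V \<Longrightarrow> f (0, to_u1 y) = q (g y)"
      by blast
    obtain m where "q = (\<lambda>x. (m, to_u1 x))"
      using q unfolding lattice_u1_atlas_iff by blast
    then have "h (to_u1 y) = to_u1 (g y)" if "y \<in> V" for y
      using V(4)[OF that] by (simp add: h_def)
    then obtain k where "h = int_scale k"
      using u1_endomorphism_is_int_scale[OF h_add V(2,1) smooth_on_differentiable[OF V(3,2)]] by blast
    then show thesis using that int_scale_injD \<open>inj h\<close> by blast
  qed

  define \<eta> where "\<eta> x = snd (H x)" for x
  have H: "H x = (0, \<eta> x)" for x
    using subsetD[OF range rangeI[of H x]] by (simp add: \<eta>_def kerU_TD prod_eq_iff)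
  then have "H = (\<lambda>x. (0, \<eta> x))" by blast
  then have smooth\<eta>: "smooth_map euclidean_atlas u1_atlas \<eta>"
    using smooth by (simp add: smooth_into_kernel_iff)
  have int: "\<eta> (rvec_of m, rvec_of m') = 0" for m m'
    using H0[of m m'] by (simp add: \<eta>_def)
  have coc: "\<eta> (a, a') + \<eta> (a + a', a'') = \<eta> (a', a'') + \<eta> (a, a' + a'')" for a a' a''
    using cocycle[of a a' a''] by (simp add: H)
  have sym: "\<eta> (rvec_of m, a) + int_scale k (to_u1 (bracket a (rvec_of m))) =
        \<eta> (a, rvec_of m) + to_u1 (bracket (mat_act A a) (mat_act A (rvec_of m)))" for a m
  proof -
    have "\<eta> (a, rvec_of m - a) + (\<kappa> m + int_scale k (- to_u1 (bracket a (rvec_of m)))) =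
        \<eta> (rvec_of m - a, a) + (\<kappa> m - to_u1 (bracket (mat_act A a) (rvec_of (A *v m))))"
      using compat[of a "(m, 0)"] k by (simp add: H f A(1))
    then have "\<eta> (a, rvec_of m - a) - \<eta> (rvec_of m - a, a) = 
        int_scale k (to_u1 (bracket a (rvec_of m))) - to_u1 (bracket (mat_act A a) (rvec_of (A *v m)))"
      by (simp add: int_scale_minus algebra_simps)
    then have "\<eta> (a, rvec_of m) - \<eta> (rvec_of m, a) =
        int_scale k (to_u1 (bracket a (rvec_of m))) - to_u1 (bracket (mat_act A a) (rvec_of (A *v m)))"
      using cocycle_symmetry[of \<eta> a "rvec_of m", OF coc] by simp
    then show ?thesis by (simp add: mat_act_rvec_of algebra_simps)
  qed
  have "A \<in> Opm \<and> iso_sign A = k"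
    unfolding Opm_iff using \<open>invertible A\<close> \<open>k \<in> {1, -1}\<close> cocycle_similitude[OF coc sym] by blast
  then have "(A, \<eta>) \<in> A_obj" and "X = twisted (A, \<eta>) \<kappa>"
    using smooth\<eta> int coc sym by (auto simp: A_obj_def X twisted_def A(1) f k H fun_eq_iff)
  then show thesis using that \<kappa> by blast
qed


section \<open>The group of objects\<close>
lemma A_objD:
  assumes "(A, \<eta>) \<in> A_obj"
  shows "A \<in> Opm" "smooth_map euclidean_atlas u1_atlas \<eta>"
    "\<eta> (rvec_of m, rvec_of m') = 0"
    "\<eta> (rvec_of m, a) + int_scale (iso_sign A) (to_u1 (bracket a (rvec_of m))) =
        \<eta> (a, rvec_of m) + to_u1 (bracket (mat_act A a) (mat_act A (rvec_of m)))"
    "\<eta> (a, a') + \<eta> (a + a', a'') = \<eta> (a', a'') + \<eta> (a, a' + a'')"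
  using assms unfolding A_obj_def by blast+

lemma A_objD_Opm: "X \<in> A_obj \<Longrightarrow> fst X \<in> Opm"
  using A_objD(1) by (metis prod.collapse)

lemma linear_pair:
  assumes "linear L"
  shows "linear (\<lambda>x. (L (fst x), L (snd x)))"
  by (rule linearI) (simp_all add: linear_add[OF assms] linear_scale[OF assms])

lemma A_prod_closed:
  assumes "X\<^sub>1 \<in> A_obj" "X\<^sub>2 \<in> A_obj"
  shows "A_prod X\<^sub>1 X\<^sub>2 \<in> A_obj"
proof -
  obtain A\<^sub>1 \<eta>\<^sub>1 A\<^sub>2 \<eta>\<^sub>2 where X: "X\<^sub>1 = (A\<^sub>1, \<eta>\<^sub>1)" "X\<^sub>2 = (A\<^sub>2, \<eta>\<^sub>2)" by fastforce
  note D1 = A_objD[OF assms(1)[unfolded X]] and D2 = A_objD[OF assms(2)[unfolded X]]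
  let ?e\<^sub>1 = "iso_sign A\<^sub>1" and ?e\<^sub>2 = "iso_sign A\<^sub>2"
  let ?\<eta> = "\<lambda>(a, a'). \<eta>\<^sub>1 (mat_act A\<^sub>2 a, mat_act A\<^sub>2 a') + int_scale ?e\<^sub>1 (\<eta>\<^sub>2 (a, a'))"
  have "smooth_map euclidean_atlas u1_atlas
      (\<lambda>x. \<eta>\<^sub>1 (mat_act A\<^sub>2 (fst x), mat_act A\<^sub>2 (snd x)) + int_scale ?e\<^sub>1 (\<eta>\<^sub>2 x))"
    by (intro smooth_u1_add smooth_u1_int_scale D2(2)
        smooth_u1_compose_linear[OF D1(2) linear_pair[OF linear_mat_act]])
  then have smooth: "smooth_map euclidean_atlas u1_atlas ?\<eta>"
    by (simp add: case_prod_unfold)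
  have int: "?\<eta> (rvec_of m, rvec_of m') = 0" for m m'
    using D1(3) D2(3) by (simp add: mat_act_rvec_of)
  have sym: "?\<eta> (rvec_of m, a) + int_scale (?e\<^sub>1 * ?e\<^sub>2) (to_u1 (bracket a (rvec_of m))) =
      ?\<eta> (a, rvec_of m) + to_u1 (bracket (mat_act (A\<^sub>1 ** A\<^sub>2) a) (mat_act (A\<^sub>1 ** A\<^sub>2) (rvec_of m)))" for a m
  proof -
    have "?\<eta> (rvec_of m, a) + int_scale (?e\<^sub>1 * ?e\<^sub>2) (to_u1 (bracket a (rvec_of m))) =
        \<eta>\<^sub>1 (mat_act A\<^sub>2 (rvec_of m), mat_act A\<^sub>2 a) +
        int_scale ?e\<^sub>1 (\<eta>\<^sub>2 (rvec_of m, a) + int_scale ?e\<^sub>2 (to_u1 (bracket a (rvec_of m))))"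
      by (simp add: int_scale_add int_scale_mult add.assoc)
    also have "\<dots> = (\<eta>\<^sub>1 (rvec_of (A\<^sub>2 *v m), mat_act A\<^sub>2 a) +
        int_scale ?e\<^sub>1 (to_u1 (bracket (mat_act A\<^sub>2 a) (rvec_of (A\<^sub>2 *v m))))) + int_scale ?e\<^sub>1 (\<eta>\<^sub>2 (a, rvec_of m))"
      unfolding D2(4) by (simp add: mat_act_rvec_of int_scale_add algebra_simps)
    also have "\<dots> = ?\<eta> (a, rvec_of m) + to_u1 (bracket (mat_act (A\<^sub>1 ** A\<^sub>2) a) (mat_act (A\<^sub>1 ** A\<^sub>2) (rvec_of m)))"
      unfolding D1(4)
      by (simp add: mat_act_rvec_of mat_act_mult matrix_vector_mul_assoc algebra_simps)
    finally show ?thesis .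
  qed
  have cocycle: "?\<eta> (a, a') + ?\<eta> (a + a', a'') = ?\<eta> (a', a'') + ?\<eta> (a, a' + a'')" for a a' a''
  proof -
    have "?\<eta> (a, a') + ?\<eta> (a + a', a'') =
        (\<eta>\<^sub>1 (mat_act A\<^sub>2 a, mat_act A\<^sub>2 a') + \<eta>\<^sub>1 (mat_act A\<^sub>2 a + mat_act A\<^sub>2 a', mat_act A\<^sub>2 a'')) +
        int_scale ?e\<^sub>1 (\<eta>\<^sub>2 (a, a') + \<eta>\<^sub>2 (a + a', a''))"
      by (simp add: mat_act_add int_scale_add algebra_simps)
    also have "\<dots> = ?\<eta> (a', a'') + ?\<eta> (a, a' + a'')"
      unfolding D1(5)[of "mat_act A\<^sub>2 a" "mat_act A\<^sub>2 a'" "mat_act A\<^sub>2 a''"] D2(5)[of a a' a'']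
      by (simp add: mat_act_add int_scale_add algebra_simps)
    finally show ?thesis .
  qed
  have "(A\<^sub>1 ** A\<^sub>2, ?\<eta>) \<in> A_obj"
    unfolding A_obj_def using Opm_mult[OF D1(1) D2(1)] smooth int sym cocycle by simp
  then show ?thesis by (simp add: X A_prod_def)
qed

lemma A_unit_closed: "(mat 1, \<lambda>_. 0) \<in> A_obj"
  by (simp add: A_obj_def smooth_u1_const)

lemma fst_A_prod [simp]: "fst (A_prod X Y) = fst X ** fst Y"
  by (simp add: A_prod_def split_beta)

lemma A_prod_assoc:
  assumes "X \<in> A_obj" "Y \<in> A_obj"
  shows "A_prod (A_prod X Y) Z = A_prod X (A_prod Y Z)"
  using Opm_mult[OF A_objD_Opm[OF assms(1)] A_objD_Opm[OF assms(2)]]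
  by (simp add: A_prod_def split_beta fun_eq_iff matrix_mul_assoc mat_act_mult int_scale_add
      int_scale_mult add.assoc)

lemma A_prod_unit_left: "A_prod (mat 1, \<lambda>_. 0) X = X"
  by (simp add: A_prod_def split_beta)

lemma A_prod_unit_right: "A_prod X (mat 1, \<lambda>_. 0) = X"
  by (simp add: A_prod_def split_beta)

text \<open>
  With \<open>B\<close> the inverse of \<open>A\<close> and \<open>e\<close> the common sign, the inverse cocycle is
  \<open>- e \<eta> (B a, B a')\<close>. Its symmetry condition is that of \<open>\<eta>\<close> at \<open>(B a, B m)\<close> multiplied by \<open>e\<close>.
\<close>
lemma A_obj_inverse:
  assumes "X \<in> A_obj"
  obtains Y where "Y \<in> A_obj" "A_prod X Y = (mat 1, \<lambda>_. 0)" "A_prod Y X = (mat 1, \<lambda>_. 0)"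
proof -
  obtain A \<eta> where X: "X = (A, \<eta>)" by fastforce
  note D = A_objD[OF assms[unfolded X]]
  obtain B where B: "B \<in> Opm" "iso_sign B = iso_sign A" "A ** B = mat 1" "B ** A = mat 1"
    using Opm_inverse[OF D(1)] by blast
  let ?e = "iso_sign A"
  have sq: "?e * ?e = 1" using D(1) by simp
  let ?\<eta> = "\<lambda>(a, a'). - int_scale ?e (\<eta> (mat_act B a, mat_act B a'))"
  have AB: "mat_act A (mat_act B a) = a" "mat_act B (mat_act A a) = a" for a
    using B by (simp_all flip: mat_act_mult)
  have "smooth_map euclidean_atlas u1_atlas
      (\<lambda>x. - int_scale ?e (\<eta> (mat_act B (fst x), mat_act B (snd x))))"
    by (intro smooth_u1_minus smooth_u1_int_scale
        smooth_u1_compose_linear[OF D(2) linear_pair[OF linear_mat_act]])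
  then have smooth: "smooth_map euclidean_atlas u1_atlas ?\<eta>"
    by (simp add: case_prod_unfold)
  have int: "?\<eta> (rvec_of m, rvec_of m') = 0" for m m'
    using D(3) by (simp add: mat_act_rvec_of)
  have sym: "?\<eta> (rvec_of m, a) + int_scale ?e (to_u1 (bracket a (rvec_of m))) =
      ?\<eta> (a, rvec_of m) + to_u1 (bracket (mat_act B a) (mat_act B (rvec_of m)))" for a m
  proof -
    have "int_scale ?e (\<eta> (mat_act B (rvec_of m), mat_act B a) +
          int_scale ?e (to_u1 (bracket (mat_act B a) (mat_act B (rvec_of m))))) =
        int_scale ?e (\<eta> (mat_act B a, mat_act B (rvec_of m)) + to_u1 (bracket a (rvec_of m)))"
      using D(4)[of "B *v m" "mat_act B a"] by (simp add: AB flip: mat_act_rvec_of)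
    then show ?thesis by (simp add: int_scale_add int_scale_mult sq algebra_simps)
  qed
  have cocycle: "?\<eta> (a, a') + ?\<eta> (a + a', a'') = ?\<eta> (a', a'') + ?\<eta> (a, a' + a'')" for a a' a''
    using arg_cong[OF D(5)[of "mat_act B a" "mat_act B a'" "mat_act B a''"], of "\<lambda>s. - int_scale ?e s"]
    by (simp add: mat_act_add int_scale_add algebra_simps)
  have "(B, ?\<eta>) \<in> A_obj"
    unfolding A_obj_def using B smooth int sym cocycle by simp
  moreover have "A_prod X (B, ?\<eta>) = (mat 1, \<lambda>_. 0)" "A_prod (B, ?\<eta>) X = (mat 1, \<lambda>_. 0)"
    by (simp_all add: A_prod_def X B AB fun_eq_iff int_scale_minus int_scale_mult sq)
  ultimately show thesis using that by blast
qed


section \<open>Morphisms of twisted objects\<close>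

text \<open>
  Morphisms between \<open>twisted X \<kappa>\<close> and \<open>twisted Y \<kappa>'\<close>; the case \<open>\<kappa> = \<kappa>' = 0\<close> is \<open>A_mor\<close>.
\<close>
definition twisted_mor ::
    "('n::finite) pairA \<Rightarrow> ('n ivec \<Rightarrow> u1) \<Rightarrow> 'n pairA \<Rightarrow> ('n ivec \<Rightarrow> u1) \<Rightarrow> ('n rvec \<Rightarrow> u1) \<Rightarrow> bool"
  where "twisted_mor X \<kappa> Y \<kappa>' \<beta> \<longleftrightarrow>
    fst X = fst Y \<and> smooth_map euclidean_atlas u1_atlas \<beta> \<and>
    (\<forall>m. \<beta> (rvec_of m) + \<kappa> m = \<kappa>' m) \<and>
    (\<forall>a\<^sub>1 a\<^sub>2. \<beta> a\<^sub>1 + \<beta> a\<^sub>2 + snd X (a\<^sub>1, a\<^sub>2) = snd Y (a\<^sub>1, a\<^sub>2) + \<beta> (a\<^sub>1 + a\<^sub>2))"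

text \<open>
  The characters belonging to a composite of twisted intertwiners; \<open>mor_prod\<close> is the same
  formula for morphisms.
\<close>
definition char_prod ::
    "('n::finite) pairA \<Rightarrow> ('n ivec \<Rightarrow> u1) \<Rightarrow> 'n pairA \<Rightarrow> ('n ivec \<Rightarrow> u1) \<Rightarrow> 'n ivec \<Rightarrow> u1" where
  "char_prod X\<^sub>1 \<kappa>\<^sub>1 X\<^sub>2 \<kappa>\<^sub>2 = (\<lambda>m. \<kappa>\<^sub>1 (fst X\<^sub>2 *v m) + int_scale (iso_sign (fst X\<^sub>1)) (\<kappa>\<^sub>2 m))"

definition mor_prod ::
    "('n::finite) pairA \<Rightarrow> ('n rvec \<Rightarrow> u1) \<Rightarrow> 'n pairA \<Rightarrow> ('n rvec \<Rightarrow> u1) \<Rightarrow> 'n rvec \<Rightarrow> u1" where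
  "mor_prod X\<^sub>1 \<beta>\<^sub>1 X\<^sub>2 \<beta>\<^sub>2 = (\<lambda>a. \<beta>\<^sub>1 (mat_act (fst X\<^sub>2) a) + int_scale (iso_sign (fst X\<^sub>1)) (\<beta>\<^sub>2 a))"

lemma A_mor_iff_twisted_mor: "A_mor X Y \<beta> \<longleftrightarrow> twisted_mor X (\<lambda>_. 0) Y (\<lambda>_. 0) \<beta>"
  by (simp add: A_mor_def twisted_mor_def split_beta)

lemma crossed_transformation_iff_twisted_mor:
  "crossed_transformation TD (twisted X \<kappa>) (twisted Y \<kappa>') B \<longleftrightarrow>
     (\<exists>\<beta>. B = (\<lambda>a. (0, \<beta> a)) \<and> twisted_mor X \<kappa> Y \<kappa>' \<beta>)"
proof (cases "range B \<subseteq> kerU TD")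
  case False
  then have "B \<noteq> (\<lambda>a. (0, \<beta> a))" for \<beta>
    by (auto simp: kerU_TD)
  then show ?thesis
    using False by (auto simp: crossed_transformation_def twisted_def split_beta)
next
  case True
  define \<beta> where "\<beta> = snd \<circ> B"
  have B: "B = (\<lambda>a. (0, \<beta> a))"
  proof
    fix a
    show "B a = (0, \<beta> a)"
      using subsetD[OF True rangeI[of B a]] by (simp add: \<beta>_def kerU_TD prod_eq_iff)
  qed
  obtain A \<eta> A' \<eta>' where X: "X = (A, \<eta>)" "Y = (A', \<eta>')" by fastforce
  have "crossed_transformation TD (twisted X \<kappa>) (twisted Y \<kappa>') B \<longleftrightarrow> twisted_mor X \<kappa> Y \<kappa>' \<beta>"
    using True
    by (auto simp: X B crossed_transformation_def twisted_def twisted_mor_def mat_act_inject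
        smooth_into_kernel_iff)
  moreover have "B = (\<lambda>a. (0, \<beta>' a)) \<longleftrightarrow> \<beta>' = \<beta>" for \<beta>'
    by (auto simp: B fun_eq_iff)
  ultimately show ?thesis by auto
qed

lemma twisted_mor_id: "twisted_mor X \<kappa> X \<kappa> (\<lambda>_. 0)"
  by (simp add: twisted_mor_def smooth_u1_const)

lemma twisted_mor_comp:
  assumes "twisted_mor X \<kappa> Y \<kappa>' \<beta>" "twisted_mor Y \<kappa>' Z \<kappa>'' \<beta>'"
  shows "twisted_mor X \<kappa> Z \<kappa>'' (\<lambda>a. \<beta>' a + \<beta> a)"
proof -
  have "\<beta>' a\<^sub>1 + \<beta> a\<^sub>1 + (\<beta>' a\<^sub>2 + \<beta> a\<^sub>2) + snd X (a\<^sub>1, a\<^sub>2) = snd Z (a\<^sub>1, a\<^sub>2) + (\<beta>' (a\<^sub>1 + a\<^sub>2) + \<beta> (a\<^sub>1 + a\<^sub>2))" for a\<^sub>1 a\<^sub>2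
  proof -
    have "\<beta>' a\<^sub>1 + \<beta> a\<^sub>1 + (\<beta>' a\<^sub>2 + \<beta> a\<^sub>2) + snd X (a\<^sub>1, a\<^sub>2) =
        \<beta>' a\<^sub>1 + \<beta>' a\<^sub>2 + (\<beta> a\<^sub>1 + \<beta> a\<^sub>2 + snd X (a\<^sub>1, a\<^sub>2))" by (simp add: algebra_simps)
    also have "\<dots> = (\<beta>' a\<^sub>1 + \<beta>' a\<^sub>2 + snd Y (a\<^sub>1, a\<^sub>2)) + \<beta> (a\<^sub>1 + a\<^sub>2)"
      using assms(1) by (simp add: twisted_mor_def algebra_simps)
    also have "\<dots> = snd Z (a\<^sub>1, a\<^sub>2) + (\<beta>' (a\<^sub>1 + a\<^sub>2) + \<beta> (a\<^sub>1 + a\<^sub>2))"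
      using assms(2) by (simp add: twisted_mor_def algebra_simps)
    finally show ?thesis .
  qed
  moreover have "\<beta>' (rvec_of m) + \<beta> (rvec_of m) + \<kappa> m = \<kappa>'' m" for m
    using assms by (simp add: twisted_mor_def add.assoc)
  ultimately show ?thesis
    using assms by (simp add: twisted_mor_def smooth_u1_add)
qed

lemma twisted_mor_minus:
  assumes "twisted_mor X \<kappa> Y \<kappa>' \<beta>"
  shows "twisted_mor Y \<kappa>' X \<kappa> (\<lambda>a. - \<beta> a)"
proof -
  have b: "\<beta> a\<^sub>1 + \<beta> a\<^sub>2 + snd X (a\<^sub>1, a\<^sub>2) = snd Y (a\<^sub>1, a\<^sub>2) + \<beta> (a\<^sub>1 + a\<^sub>2)"
    and k: "\<beta> (rvec_of m) + \<kappa> m = \<kappa>' m" for a\<^sub>1 a\<^sub>2 m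
    using assms unfolding twisted_mor_def by blast+
  have "- \<beta> a\<^sub>1 + - \<beta> a\<^sub>2 + snd Y (a\<^sub>1, a\<^sub>2) = snd X (a\<^sub>1, a\<^sub>2) + - \<beta> (a\<^sub>1 + a\<^sub>2)" for a\<^sub>1 a\<^sub>2
    using b[of a\<^sub>1 a\<^sub>2] by (simp add: algebra_simps)
  moreover have "- \<beta> (rvec_of m) + \<kappa>' m = \<kappa> m" for m
    using k[of m] by (simp add: algebra_simps)
  ultimately show ?thesis
    using assms by (simp add: twisted_mor_def smooth_u1_minus)
qed

lemma twisted_mor_prod:
  assumes "twisted_mor X\<^sub>1 \<kappa>\<^sub>1 Y\<^sub>1 \<kappa>\<^sub>1' \<beta>\<^sub>1" "twisted_mor X\<^sub>2 \<kappa>\<^sub>2 Y\<^sub>2 \<kappa>\<^sub>2' \<beta>\<^sub>2"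
  shows "twisted_mor (A_prod X\<^sub>1 X\<^sub>2) (char_prod X\<^sub>1 \<kappa>\<^sub>1 X\<^sub>2 \<kappa>\<^sub>2) (A_prod Y\<^sub>1 Y\<^sub>2) (char_prod Y\<^sub>1 \<kappa>\<^sub>1' Y\<^sub>2 \<kappa>\<^sub>2')
    (mor_prod X\<^sub>1 \<beta>\<^sub>1 X\<^sub>2 \<beta>\<^sub>2)"
proof -
  obtain A\<^sub>1 \<eta>\<^sub>1 A\<^sub>2 \<eta>\<^sub>2 where X: "X\<^sub>1 = (A\<^sub>1, \<eta>\<^sub>1)" "X\<^sub>2 = (A\<^sub>2, \<eta>\<^sub>2)" by fastforce
  obtain \<eta>\<^sub>1' \<eta>\<^sub>2' where Y: "Y\<^sub>1 = (A\<^sub>1, \<eta>\<^sub>1')" "Y\<^sub>2 = (A\<^sub>2, \<eta>\<^sub>2')"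
    using assms by (auto simp: X twisted_mor_def) (metis prod.collapse)
  let ?e = "iso_sign A\<^sub>1"
  have b1: "\<beta>\<^sub>1 a + \<beta>\<^sub>1 b + \<eta>\<^sub>1 (a, b) = \<eta>\<^sub>1' (a, b) + \<beta>\<^sub>1 (a + b)" and k1: "\<beta>\<^sub>1 (rvec_of m) + \<kappa>\<^sub>1 m = \<kappa>\<^sub>1' m"
    and s1: "smooth_map euclidean_atlas u1_atlas \<beta>\<^sub>1" for a b m
    using assms(1) by (auto simp: twisted_mor_def X Y)
  have b2: "\<beta>\<^sub>2 a + \<beta>\<^sub>2 b + \<eta>\<^sub>2 (a, b) = \<eta>\<^sub>2' (a, b) + \<beta>\<^sub>2 (a + b)" and k2: "\<beta>\<^sub>2 (rvec_of m) + \<kappa>\<^sub>2 m = \<kappa>\<^sub>2' m"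
    and s2: "smooth_map euclidean_atlas u1_atlas \<beta>\<^sub>2" for a b m
    using assms(2) by (auto simp: twisted_mor_def X Y)
  let ?\<beta> = "\<lambda>a. \<beta>\<^sub>1 (mat_act A\<^sub>2 a) + int_scale ?e (\<beta>\<^sub>2 a)"
  have "smooth_map euclidean_atlas u1_atlas ?\<beta>"
    by (intro smooth_u1_add smooth_u1_int_scale s2 smooth_u1_compose_linear[OF s1 linear_mat_act])
  moreover have "?\<beta> (rvec_of m) + (\<kappa>\<^sub>1 (A\<^sub>2 *v m) + int_scale ?e (\<kappa>\<^sub>2 m)) =
      \<kappa>\<^sub>1' (A\<^sub>2 *v m) + int_scale ?e (\<kappa>\<^sub>2' m)" for m
    unfolding k1[symmetric] k2[symmetric] by (simp add: mat_act_rvec_of int_scale_add algebra_simps)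
  moreover have "?\<beta> a + ?\<beta> b + (\<eta>\<^sub>1 (mat_act A\<^sub>2 a, mat_act A\<^sub>2 b) + int_scale ?e (\<eta>\<^sub>2 (a, b))) =
      \<eta>\<^sub>1' (mat_act A\<^sub>2 a, mat_act A\<^sub>2 b) + int_scale ?e (\<eta>\<^sub>2' (a, b)) + ?\<beta> (a + b)" for a b
  proof -
    have "?\<beta> a + ?\<beta> b + (\<eta>\<^sub>1 (mat_act A\<^sub>2 a, mat_act A\<^sub>2 b) + int_scale ?e (\<eta>\<^sub>2 (a, b))) =
      (\<beta>\<^sub>1 (mat_act A\<^sub>2 a) + \<beta>\<^sub>1 (mat_act A\<^sub>2 b) + \<eta>\<^sub>1 (mat_act A\<^sub>2 a, mat_act A\<^sub>2 b)) +
      int_scale ?e (\<beta>\<^sub>2 a + \<beta>\<^sub>2 b + \<eta>\<^sub>2 (a, b))"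
      by (simp add: int_scale_add algebra_simps)
    then show ?thesis
      unfolding b1 b2 by (simp add: int_scale_add mat_act_add algebra_simps)
  qed
  ultimately show ?thesis
    by (simp add: twisted_mor_def X Y A_prod_def char_prod_def mor_prod_def)
qed

lemma mor_prod_zero: "mor_prod X (\<lambda>_. 0) Y (\<lambda>_. 0) = (\<lambda>_. 0)"
  by (simp add: mor_prod_def)

lemma mor_prod_comp:
  "mor_prod X (\<lambda>a. \<beta>\<^sub>1' a + \<beta>\<^sub>1 a) Y (\<lambda>a. \<beta>\<^sub>2' a + \<beta>\<^sub>2 a) =
     (\<lambda>a. mor_prod X \<beta>\<^sub>1' Y \<beta>\<^sub>2' a + mor_prod X \<beta>\<^sub>1 Y \<beta>\<^sub>2 a)"
  by (simp add: mor_prod_def int_scale_add fun_eq_iff algebra_simps)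

lemma mor_prod_cong:
  "fst X = fst X' \<Longrightarrow> fst Y = fst Y' \<Longrightarrow> mor_prod X \<beta> Y \<beta>' = mor_prod X' \<beta> Y' \<beta>'"
  by (simp add: mor_prod_def)

lemma mor_prod_assoc:
  assumes "X \<in> A_obj" "Y \<in> A_obj"
  shows "mor_prod (A_prod X Y) (mor_prod X \<beta>\<^sub>1 Y \<beta>\<^sub>2) Z \<beta>\<^sub>3 = mor_prod X \<beta>\<^sub>1 (A_prod Y Z) (mor_prod Y \<beta>\<^sub>2 Z \<beta>\<^sub>3)"
  using Opm_mult[OF A_objD_Opm[OF assms(1)] A_objD_Opm[OF assms(2)]]
  by (simp add: mor_prod_def fun_eq_iff mat_act_mult int_scale_add int_scale_mult add.assoc)

lemma mor_prod_unit:
  "mor_prod (mat 1, \<eta>) (\<lambda>_. 0) X \<beta> = \<beta>" "mor_prod X \<beta> (mat 1, \<eta>) (\<lambda>_. 0) = \<beta>"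
  by (simp_all add: mor_prod_def)

lemma char_prod_assoc:
  assumes "X \<in> A_obj" "Y \<in> A_obj"
  shows "char_prod (A_prod X Y) (char_prod X \<kappa>\<^sub>1 Y \<kappa>\<^sub>2) Z \<kappa>\<^sub>3 =
    char_prod X \<kappa>\<^sub>1 (A_prod Y Z) (char_prod Y \<kappa>\<^sub>2 Z \<kappa>\<^sub>3)"
  using Opm_mult[OF A_objD_Opm[OF assms(1)] A_objD_Opm[OF assms(2)]]
  by (simp add: char_prod_def fun_eq_iff matrix_vector_mul_assoc int_scale_add int_scale_mult add.assoc)

lemma char_prod_zero: "char_prod X (\<lambda>_. 0) Y (\<lambda>_. 0) = (\<lambda>_. 0)"
  by (simp add: char_prod_def)

lemma char_prod_unit:
  "char_prod (mat 1, \<eta>) (\<lambda>_. 0) X \<kappa> = \<kappa>" "char_prod X \<kappa> (mat 1, \<eta>) (\<lambda>_. 0) = \<kappa>"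
  by (simp_all add: char_prod_def)

lemma additive_char_prod:
  assumes "Modules.additive \<kappa>\<^sub>1" "Modules.additive \<kappa>\<^sub>2"
  shows "Modules.additive (char_prod X\<^sub>1 \<kappa>\<^sub>1 X\<^sub>2 \<kappa>\<^sub>2)"
  by (rule Modules.additive.intro)
     (simp add: char_prod_def matrix_vector_right_distrib Modules.additive.add[OF assms(1)]
       Modules.additive.add[OF assms(2)] int_scale_add algebra_simps)

lemma additive_zero: "Modules.additive (\<lambda>_. 0)"
  by (rule Modules.additive.intro) simp


section \<open>Fully faithful and essentially surjective functors\<close>

lemma cat_functor_id:
  assumes "category C"
  shows "cat_functor C C id id"
proof -
  interpret category C by fact
  show ?thesis by unfold_locales auto
qed

lemma cat_functor_comp:
  assumes "cat_functor C D Fo Fa" "cat_functor D E Go Ga"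
  shows "cat_functor C E (Go \<circ> Fo) (Ga \<circ> Fa)"
proof -
  interpret F: cat_functor C D Fo Fa by fact
  interpret G: cat_functor D E Go Ga by fact
  show ?thesis
    by unfold_locales
      (auto simp: F.map_obj G.map_obj F.map_idt G.map_idt
        intro: F.map_hom G.map_hom, metis F.map_comp F.map_hom G.map_comp)
qed

text \<open>
  A weak inverse is obtained by choosing for each object \<open>Y\<close> of \<open>D\<close> a preimage \<open>Go Y\<close> up to an
  isomorphism \<open>\<tau> Y\<close>, and by transporting arrows along these isomorphisms. All equations in \<open>C\<close>
  are checked after applying the faithful functor.
\<close>
lemma equivalence_if_fully_faithful_essentially_surjective:
  fixes C :: "('o, 'm) monoidal_data" and D :: "('p, 'l) monoidal_data"
  assumes F: "cat_functor C D Fo Fa"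
    and full: "\<And>X Y q. X \<in> Obj C \<Longrightarrow> Y \<in> Obj C \<Longrightarrow> q \<in> Hom D (Fo X) (Fo Y) \<Longrightarrow>
      \<exists>p\<in>Hom C X Y. Fa p = q"
    and faithful: "\<And>X Y p p'. p \<in> Hom C X Y \<Longrightarrow> p' \<in> Hom C X Y \<Longrightarrow> Fa p = Fa p' \<Longrightarrow> p = p'"
    and surj: "\<And>Y. Y \<in> Obj D \<Longrightarrow> \<exists>X\<in>Obj C. \<exists>t\<in>Hom D (Fo X) Y. iso_arr D t"
  shows "equivalence_of_categories C D Fo Fa"
proof -
  interpret F: cat_functor C D Fo Fa by fact
  have "\<exists>X t t'. X \<in> Obj C \<and> t \<in> Hom D (Fo X) Y \<and> t' \<in> Hom D Y (Fo X) \<and>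
      Comp D t' t = Idt D (Fo X) \<and> Comp D t t' = Idt D Y" if Y: "Y \<in> Obj D" for Y
  proof -
    obtain X t where t: "X \<in> Obj C" "t \<in> Hom D (Fo X) Y" "iso_arr D t"
      using surj[OF Y] by blast
    moreover from t have "Dom D t = Fo X" "Cod D t = Y" by (auto simp: Hom_def)
    ultimately show ?thesis unfolding iso_arr_def by metis
  qed
  then obtain Go \<tau> \<tau>' where
    G: "\<And>Y. Y \<in> Obj D \<Longrightarrow> Go Y \<in> Obj C" and
    t: "\<And>Y. Y \<in> Obj D \<Longrightarrow> \<tau> Y \<in> Hom D (Fo (Go Y)) Y" and
    t': "\<And>Y. Y \<in> Obj D \<Longrightarrow> \<tau>' Y \<in> Hom D Y (Fo (Go Y))" and
    t't: "\<And>Y. Y \<in> Obj D \<Longrightarrow> Comp D (\<tau>' Y) (\<tau> Y) = Idt D (Fo (Go Y))" and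
    tt': "\<And>Y. Y \<in> Obj D \<Longrightarrow> Comp D (\<tau> Y) (\<tau>' Y) = Idt D Y"
    by metis
  have hom_obj: "X \<in> Obj D" "Y \<in> Obj D" if "q \<in> Hom D X Y" for q X Y
    using that F.D.dom_obj F.D.cod_obj by (auto simp: Hom_def)
  have hom_objC: "X \<in> Obj C" "Y \<in> Obj C" if "q \<in> Hom C X Y" for q X Y
    using that F.C.dom_obj F.C.cod_obj by (auto simp: Hom_def)

  define Ga where "Ga q = (SOME p. p \<in> Hom C (Go (Dom D q)) (Go (Cod D q)) \<and>
      Fa p = Comp D (\<tau>' (Cod D q)) (Comp D q (\<tau> (Dom D q))))" for q
  have Ga: "Ga q \<in> Hom C (Go Y) (Go Z) \<and> Fa (Ga q) = Comp D (\<tau>' Z) (Comp D q (\<tau> Y))"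
    if q: "q \<in> Hom D Y Z" for q Y Z
  proof -
    have "Comp D (\<tau>' Z) (Comp D q (\<tau> Y)) \<in> Hom D (Fo (Go Y)) (Fo (Go Z))"
      using F.D.comp_hom[OF F.D.comp_hom[OF t q] t'] hom_obj[OF q] by blast
    then have "\<exists>p. p \<in> Hom C (Go Y) (Go Z) \<and> Fa p = Comp D (\<tau>' Z) (Comp D q (\<tau> Y))"
      using full G hom_obj[OF q] by blast
    moreover have "Dom D q = Y" "Cod D q = Z" using q by (auto simp: Hom_def)
    ultimately show ?thesis unfolding Ga_def by (metis (mono_tags, lifting) someI_ex)
  qed
  have cancel: "Comp D (\<tau> Z) (Comp D (\<tau>' Z) r) = r" if "r \<in> Hom D X Z" for r X Z
    using F.D.comp_assoc[OF that t' t] tt' F.D.idt_comp[OF that] hom_obj[OF that] by metis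

  have "cat_functor D C Go Ga"
  proof unfold_locales
    fix X assume X: "X \<in> Obj D"
    have idt: "Idt D X \<in> Hom D X X" using X by (rule F.D.idt_hom)
    show "Ga (Idt D X) = Idt C (Go X)"
    proof (rule faithful)
      show "Ga (Idt D X) \<in> Hom C (Go X) (Go X)" using Ga[OF idt] by blast
      show "Idt C (Go X) \<in> Hom C (Go X) (Go X)" using G[OF X] by (rule F.C.idt_hom)
      show "Fa (Ga (Idt D X)) = Fa (Idt C (Go X))"
        using Ga[OF idt] F.D.idt_comp[OF t[OF X]] t't[OF X] F.map_idt[OF G[OF X]] by simp
    qed
  next
    fix p X Y q Z
    assume p: "p \<in> Hom D X Y" and q: "q \<in> Hom D Y Z"
    have qp: "Comp D q p \<in> Hom D X Z" using p q by (rule F.D.comp_hom)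
    note Gp = Ga[OF p] and Gq = Ga[OF q]
    show "Ga (Comp D q p) = Comp C (Ga q) (Ga p)"
    proof (rule faithful)
      show "Ga (Comp D q p) \<in> Hom C (Go X) (Go Z)" using Ga[OF qp] by blast
      show "Comp C (Ga q) (Ga p) \<in> Hom C (Go X) (Go Z)"
        using F.C.comp_hom Gp Gq by blast
      have tX: "\<tau> X \<in> Hom D (Fo (Go X)) X" and tY: "\<tau> Y \<in> Hom D (Fo (Go Y)) Y"
        and tZ': "\<tau>' Z \<in> Hom D Z (Fo (Go Z))" and tY': "\<tau>' Y \<in> Hom D Y (Fo (Go Y))"
        using t t' hom_obj[OF p] hom_obj[OF q] by auto
      have ptX: "Comp D p (\<tau> X) \<in> Hom D (Fo (Go X)) Y" using tX p by (rule F.D.comp_hom)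
      have "Fa (Comp C (Ga q) (Ga p)) =
          Comp D (Comp D (\<tau>' Z) (Comp D q (\<tau> Y))) (Comp D (\<tau>' Y) (Comp D p (\<tau> X)))"
        using F.map_comp Gp Gq by metis
      also have "\<dots> = Comp D (\<tau>' Z) (Comp D (Comp D q (\<tau> Y)) (Comp D (\<tau>' Y) (Comp D p (\<tau> X))))"
        using F.D.comp_hom[OF ptX tY'] F.D.comp_hom[OF tY q] tZ' by (rule F.D.comp_assoc)
      also have "Comp D (Comp D q (\<tau> Y)) (Comp D (\<tau>' Y) (Comp D p (\<tau> X))) =
          Comp D q (Comp D (\<tau> Y) (Comp D (\<tau>' Y) (Comp D p (\<tau> X))))"
        using F.D.comp_hom[OF ptX tY'] tY q by (rule F.D.comp_assoc)
      also have "\<dots> = Comp D q (Comp D p (\<tau> X))"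
        using cancel[OF ptX] by simp
      also have "\<dots> = Comp D (Comp D q p) (\<tau> X)"
        using F.D.comp_assoc[OF tX p q] by simp
      finally show "Fa (Ga (Comp D q p)) = Fa (Comp C (Ga q) (Ga p))"
        using Ga[OF qp] by simp
    qed
  qed (use G Ga in auto)
  then interpret G: cat_functor D C Go Ga .

  define \<sigma> where "\<sigma> X = (SOME p. p \<in> Hom C X (Go (Fo X)) \<and> Fa p = \<tau>' (Fo X))" for X
  have sigma: "\<sigma> X \<in> Hom C X (Go (Fo X)) \<and> Fa (\<sigma> X) = \<tau>' (Fo X)" if X: "X \<in> Obj C" for X
  proof -
    have "\<exists>p. p \<in> Hom C X (Go (Fo X)) \<and> Fa p = \<tau>' (Fo X)"
      using full[OF X] G F.map_obj[OF X] t' by blast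
    then show ?thesis unfolding \<sigma>_def by (rule someI_ex)
  qed

  have "natural_iso C C id id (Go \<circ> Fo) (Ga \<circ> Fa) \<sigma>"
  proof (intro natural_iso.intro natural_iso_axioms.intro)
    show "cat_functor C C id id" by (rule cat_functor_id) (rule F.C.category_axioms)
    show "cat_functor C C (Go \<circ> Fo) (Ga \<circ> Fa)"
      by (rule cat_functor_comp) (rule F.cat_functor_axioms G.cat_functor_axioms)+
    fix X assume X: "X \<in> Obj C"
    note FX = F.map_obj[OF X]
    show "\<sigma> X \<in> Hom C (id X) ((Go \<circ> Fo) X)" using sigma[OF X] by simp
    obtain s where s: "s \<in> Hom C (Go (Fo X)) X" "Fa s = \<tau> (Fo X)"
      using full[OF G[OF FX] X t[OF FX]] by blast
    have "Comp C s (\<sigma> X) = Idt C X"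
    proof (rule faithful)
      show "Comp C s (\<sigma> X) \<in> Hom C X X" using sigma[OF X] s(1) by (blast intro: F.C.comp_hom)
      show "Idt C X \<in> Hom C X X" using X by (rule F.C.idt_hom)
      show "Fa (Comp C s (\<sigma> X)) = Fa (Idt C X)"
        using F.map_comp[of "\<sigma> X" X "Go (Fo X)" s X] sigma[OF X] s tt'[OF FX] F.map_idt[OF X] by simp
    qed
    moreover have "Comp C (\<sigma> X) s = Idt C (Go (Fo X))"
    proof (rule faithful)
      show "Comp C (\<sigma> X) s \<in> Hom C (Go (Fo X)) (Go (Fo X))"
        using sigma[OF X] s(1) by (blast intro: F.C.comp_hom)
      show "Idt C (Go (Fo X)) \<in> Hom C (Go (Fo X)) (Go (Fo X))" using G[OF FX] by (rule F.C.idt_hom)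
      show "Fa (Comp C (\<sigma> X) s) = Fa (Idt C (Go (Fo X)))"
        using F.map_comp[of s "Go (Fo X)" X "\<sigma> X" "Go (Fo X)"] sigma[OF X] s t't[OF FX] F.map_idt[OF G[OF FX]]
        by simp
    qed
    ultimately show "iso_arr C (\<sigma> X)"
      using sigma[OF X] s(1) unfolding iso_arr_def Hom_def by auto
  next
    fix p X Y assume p: "p \<in> Hom C X Y"
    have X: "X \<in> Obj C" and Y: "Y \<in> Obj C" using hom_objC[OF p] by auto
    note sX = sigma[OF X] and sY = sigma[OF Y] and Fp = F.map_hom[OF p]
    note Gp = Ga[OF Fp]
    note tX = t[OF F.map_obj[OF X]] and tX' = t'[OF F.map_obj[OF X]] and tY' = t'[OF F.map_obj[OF Y]]
    show "Comp C ((Ga \<circ> Fa) p) (\<sigma> X) = Comp C (\<sigma> Y) (id p)"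
      unfolding o_apply id_apply
    proof (rule faithful)
      show "Comp C (Ga (Fa p)) (\<sigma> X) \<in> Hom C X (Go (Fo Y))" using sX Gp by (blast intro: F.C.comp_hom)
      show "Comp C (\<sigma> Y) p \<in> Hom C X (Go (Fo Y))" using sY p by (blast intro: F.C.comp_hom)
      have "Fa (Comp C (Ga (Fa p)) (\<sigma> X)) = Comp D (Comp D (\<tau>' (Fo Y)) (Comp D (Fa p) (\<tau> (Fo X)))) (\<tau>' (Fo X))"
        using F.map_comp sX Gp by metis
      also have "\<dots> = Comp D (\<tau>' (Fo Y)) (Comp D (Comp D (Fa p) (\<tau> (Fo X))) (\<tau>' (Fo X)))"
        using tX' F.D.comp_hom[OF tX Fp] tY' by (rule F.D.comp_assoc)
      also have "Comp D (Comp D (Fa p) (\<tau> (Fo X))) (\<tau>' (Fo X)) = Comp D (Fa p) (Comp D (\<tau> (Fo X)) (\<tau>' (Fo X)))"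
        using tX' tX Fp by (rule F.D.comp_assoc)
      also have "\<dots> = Fa p"
        using tt'[OF F.map_obj[OF X]] F.D.comp_idt[OF Fp] by simp
      finally show "Fa (Comp C (Ga (Fa p)) (\<sigma> X)) = Fa (Comp C (\<sigma> Y) p)"
        using F.map_comp[OF p conjunct1[OF sY]] sY by simp
    qed
  qed
  moreover have "natural_iso D D (Fo \<circ> Go) (Fa \<circ> Ga) id id \<tau>"
  proof (intro natural_iso.intro natural_iso_axioms.intro)
    show "cat_functor D D id id" by (rule cat_functor_id) (rule F.D.category_axioms)
    show "cat_functor D D (Fo \<circ> Go) (Fa \<circ> Ga)"
      by (rule cat_functor_comp) (rule F.cat_functor_axioms G.cat_functor_axioms)+
    fix Y assume Y: "Y \<in> Obj D"
    show "\<tau> Y \<in> Hom D ((Fo \<circ> Go) Y) (id Y)" using t[OF Y] by simp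
    show "iso_arr D (\<tau> Y)"
      using t[OF Y] t'[OF Y] t't[OF Y] tt'[OF Y] unfolding iso_arr_def Hom_def by auto
  next
    fix q Y Z assume q: "q \<in> Hom D Y Z"
    have Y: "Y \<in> Obj D" using hom_obj[OF q] by blast
    show "Comp D (id q) (\<tau> Y) = Comp D (\<tau> Z) ((Fa \<circ> Ga) q)"
      using cancel[OF F.D.comp_hom[OF t[OF Y] q]] Ga[OF q] by simp
  qed
  ultimately show ?thesis
    unfolding equivalence_of_categories_def using F G.cat_functor_axioms by blast
qed


section \<open>The strict 2-groups of twisted objects\<close>

text \<open>
  The predicate \<open>K\<close> selects the characters that are allowed as twists.
\<close>
definition admissible ::
    "(('n::finite ivec \<Rightarrow> u1) \<Rightarrow> bool) \<Rightarrow> 'n pairA \<Rightarrow> ('n ivec \<Rightarrow> u1) \<Rightarrow>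
     'n pairA \<Rightarrow> ('n ivec \<Rightarrow> u1) \<Rightarrow> ('n rvec \<Rightarrow> u1) \<Rightarrow> bool" where
  "admissible K X \<kappa> Y \<kappa>' \<beta> \<longleftrightarrow>
     X \<in> A_obj \<and> Y \<in> A_obj \<and> K \<kappa> \<and> K \<kappa>' \<and> twisted_mor X \<kappa> Y \<kappa>' \<beta>"

text \<open>
  Both 2-groups of the comparison have objects \<open>(X, \<kappa>)\<close> and morphisms \<open>\<beta>\<close> with the same structure
  maps; they differ in the class \<open>K\<close> of characters and in how the data are encoded. The
  constructors \<open>ob\<close> and \<open>ar\<close> abstract from the encoding, so that the axioms are verified once
  for both.
\<close>
locale twisted_two_group =
  fixes C :: "('o, 'm) monoidal_data"
    and K :: "(('n::finite) ivec \<Rightarrow> u1) \<Rightarrow> bool"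
    and ob :: "'n pairA \<Rightarrow> ('n ivec \<Rightarrow> u1) \<Rightarrow> 'o"
    and ar :: "'n pairA \<Rightarrow> ('n ivec \<Rightarrow> u1) \<Rightarrow> 'n pairA \<Rightarrow> ('n ivec \<Rightarrow> u1) \<Rightarrow> ('n rvec \<Rightarrow> u1) \<Rightarrow> 'm"
  assumes K_zero: "K (\<lambda>_. 0)"
    and K_prod: "K \<kappa> \<Longrightarrow> K \<kappa>' \<Longrightarrow> K (char_prod X \<kappa> Y \<kappa>')"
    and K_inverse: "K \<kappa> \<Longrightarrow> K (\<lambda>m. - int_scale e (\<kappa> (B *v m)))"
    and ob_inject: "K \<kappa> \<Longrightarrow> K \<kappa>' \<Longrightarrow> ob X \<kappa> = ob X' \<kappa>' \<Longrightarrow> X = X' \<and> \<kappa> = \<kappa>'"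
    and Obj_iff: "P \<in> Obj C \<longleftrightarrow> (\<exists>X \<kappa>. P = ob X \<kappa> \<and> X \<in> A_obj \<and> K \<kappa>)"
    and Arr_iff: "p \<in> Arr C \<longleftrightarrow> (\<exists>X \<kappa> Y \<kappa>' \<beta>. p = ar X \<kappa> Y \<kappa>' \<beta> \<and> admissible K X \<kappa> Y \<kappa>' \<beta>)"
    and Dom_ar: "Dom C (ar X \<kappa> Y \<kappa>' \<beta>) = ob X \<kappa>"
    and Cod_ar: "Cod C (ar X \<kappa> Y \<kappa>' \<beta>) = ob Y \<kappa>'"
    and Idt_ob: "Idt C (ob X \<kappa>) = ar X \<kappa> X \<kappa> (\<lambda>_. 0)"
    and Comp_ar: "Comp C (ar Y \<kappa>' Z \<kappa>'' \<beta>') (ar X \<kappa> Y \<kappa>' \<beta>) = ar X \<kappa> Z \<kappa>'' (\<lambda>a. \<beta>' a + \<beta> a)"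
    and UnitO_ob: "UnitO C = ob (mat 1, \<lambda>_. 0) (\<lambda>_. 0)"
    and TensO_ob: "X \<in> A_obj \<Longrightarrow> Y \<in> A_obj \<Longrightarrow> K \<kappa> \<Longrightarrow> K \<kappa>' \<Longrightarrow>
      TensO C (ob X \<kappa>) (ob Y \<kappa>') = ob (A_prod X Y) (char_prod X \<kappa> Y \<kappa>')"
    and TensA_ar: "admissible K X\<^sub>1 \<kappa>\<^sub>1 Y\<^sub>1 \<kappa>\<^sub>1' \<beta>\<^sub>1 \<Longrightarrow> admissible K X\<^sub>2 \<kappa>\<^sub>2 Y\<^sub>2 \<kappa>\<^sub>2' \<beta>\<^sub>2 \<Longrightarrow>
      TensA C (ar X\<^sub>1 \<kappa>\<^sub>1 Y\<^sub>1 \<kappa>\<^sub>1' \<beta>\<^sub>1) (ar X\<^sub>2 \<kappa>\<^sub>2 Y\<^sub>2 \<kappa>\<^sub>2' \<beta>\<^sub>2) =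
        ar (A_prod X\<^sub>1 X\<^sub>2) (char_prod X\<^sub>1 \<kappa>\<^sub>1 X\<^sub>2 \<kappa>\<^sub>2) (A_prod Y\<^sub>1 Y\<^sub>2) (char_prod Y\<^sub>1 \<kappa>\<^sub>1' Y\<^sub>2 \<kappa>\<^sub>2')
          (mor_prod X\<^sub>1 \<beta>\<^sub>1 X\<^sub>2 \<beta>\<^sub>2)"
begin

abbreviation valid where "valid \<equiv> admissible K"

lemma Hom_iff: "p \<in> Hom C P Q \<longleftrightarrow>
    (\<exists>X \<kappa> Y \<kappa>' \<beta>. P = ob X \<kappa> \<and> Q = ob Y \<kappa>' \<and> p = ar X \<kappa> Y \<kappa>' \<beta> \<and> valid X \<kappa> Y \<kappa>' \<beta>)"
proof
  assume "p \<in> Hom C P Q"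
  then have "p \<in> Arr C" "Dom C p = P" "Cod C p = Q" by (auto simp: Hom_def)
  then show "\<exists>X \<kappa> Y \<kappa>' \<beta>. P = ob X \<kappa> \<and> Q = ob Y \<kappa>' \<and> p = ar X \<kappa> Y \<kappa>' \<beta> \<and> valid X \<kappa> Y \<kappa>' \<beta>"
    unfolding Arr_iff by (metis Dom_ar Cod_ar)
next
  assume "\<exists>X \<kappa> Y \<kappa>' \<beta>. P = ob X \<kappa> \<and> Q = ob Y \<kappa>' \<and> p = ar X \<kappa> Y \<kappa>' \<beta> \<and> valid X \<kappa> Y \<kappa>' \<beta>"
  then show "p \<in> Hom C P Q"
    unfolding Hom_def using Arr_iff Dom_ar Cod_ar by blast
qed

lemma ar_in_Hom: "valid X \<kappa> Y \<kappa>' \<beta> \<Longrightarrow> ar X \<kappa> Y \<kappa>' \<beta> \<in> Hom C (ob X \<kappa>) (ob Y \<kappa>')"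
  unfolding Hom_iff by blast

lemma Obj_cases:
  assumes "P \<in> Obj C"
  obtains X \<kappa> where "P = ob X \<kappa>" "X \<in> A_obj" "K \<kappa>"
  using assms Obj_iff by blast

lemma Arr_cases:
  assumes "p \<in> Arr C"
  obtains X \<kappa> Y \<kappa>' \<beta> where "p = ar X \<kappa> Y \<kappa>' \<beta>" "valid X \<kappa> Y \<kappa>' \<beta>"
  using assms Arr_iff by blast

lemma Hom_cases:
  assumes "p \<in> Hom C P Q"
  obtains X \<kappa> Y \<kappa>' \<beta> where "P = ob X \<kappa>" "Q = ob Y \<kappa>'" "p = ar X \<kappa> Y \<kappa>' \<beta>" "valid X \<kappa> Y \<kappa>' \<beta>"
  using assms Hom_iff by blast

lemma Hom_from_ob_cases:
  assumes "p \<in> Hom C (ob X \<kappa>) Q" "K \<kappa>"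
  obtains Y \<kappa>' \<beta> where "Q = ob Y \<kappa>'" "p = ar X \<kappa> Y \<kappa>' \<beta>" "valid X \<kappa> Y \<kappa>' \<beta>"
proof -
  obtain X' \<kappa>'' Y \<kappa>' \<beta> where p: "ob X \<kappa> = ob X' \<kappa>''" "Q = ob Y \<kappa>'" "p = ar X' \<kappa>'' Y \<kappa>' \<beta>"
      "valid X' \<kappa>'' Y \<kappa>' \<beta>"
    using assms(1) by (rule Hom_cases)
  then have "X = X' \<and> \<kappa> = \<kappa>''" using assms(2) by (intro ob_inject) (auto simp: admissible_def)
  then show thesis using p that by blast
qed

lemma valid_id: "X \<in> A_obj \<Longrightarrow> K \<kappa> \<Longrightarrow> valid X \<kappa> X \<kappa> (\<lambda>_. 0)"
  by (simp add: admissible_def twisted_mor_id)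

lemma valid_comp:
  "valid X \<kappa> Y \<kappa>' \<beta> \<Longrightarrow> valid Y \<kappa>' Z \<kappa>'' \<beta>' \<Longrightarrow> valid X \<kappa> Z \<kappa>'' (\<lambda>a. \<beta>' a + \<beta> a)"
  unfolding admissible_def using twisted_mor_comp by blast

lemma valid_prod:
  "valid X\<^sub>1 \<kappa>\<^sub>1 Y\<^sub>1 \<kappa>\<^sub>1' \<beta>\<^sub>1 \<Longrightarrow> valid X\<^sub>2 \<kappa>\<^sub>2 Y\<^sub>2 \<kappa>\<^sub>2' \<beta>\<^sub>2 \<Longrightarrow>
    valid (A_prod X\<^sub>1 X\<^sub>2) (char_prod X\<^sub>1 \<kappa>\<^sub>1 X\<^sub>2 \<kappa>\<^sub>2) (A_prod Y\<^sub>1 Y\<^sub>2) (char_prod Y\<^sub>1 \<kappa>\<^sub>1' Y\<^sub>2 \<kappa>\<^sub>2')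
      (mor_prod X\<^sub>1 \<beta>\<^sub>1 X\<^sub>2 \<beta>\<^sub>2)"
  unfolding admissible_def using twisted_mor_prod A_prod_closed K_prod by blast

lemma validD:
  assumes "valid X \<kappa> Y \<kappa>' \<beta>"
  shows "X \<in> A_obj" "Y \<in> A_obj" "K \<kappa>" "K \<kappa>'" "fst X = fst Y"
  using assms by (auto simp: admissible_def twisted_mor_def)

lemma category: "category C"
proof
  show "Dom C p \<in> Obj C" "Cod C p \<in> Obj C" if "p \<in> Arr C" for p
    using that unfolding Arr_iff Obj_iff by (metis Dom_ar validD(1,3), metis Cod_ar validD(2,4))
  show "Idt C P \<in> Hom C P P" if "P \<in> Obj C" for P
    using that by (auto elim!: Obj_cases simp: Idt_ob intro!: ar_in_Hom valid_id)
  show "Comp C q p \<in> Hom C P R" if "p \<in> Hom C P Q" "q \<in> Hom C Q R" for p q P Q R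
    using that by (auto elim!: Hom_cases[of p] Hom_from_ob_cases dest: validD
        simp: Comp_ar intro!: ar_in_Hom valid_comp)
  show "Comp C p (Idt C P) = p" "Comp C (Idt C Q) p = p" if "p \<in> Hom C P Q" for p P Q
    using that by (auto elim!: Hom_cases simp: Idt_ob Comp_ar)
  show "Comp C (Comp C r q) p = Comp C r (Comp C q p)"
    if p: "p \<in> Hom C P Q" and q: "q \<in> Hom C Q R" and r: "r \<in> Hom C R S" for p q r P Q R S
  proof -
    obtain X \<kappa> Y \<kappa>' \<beta> where P: "Q = ob Y \<kappa>'" "p = ar X \<kappa> Y \<kappa>' \<beta>" "valid X \<kappa> Y \<kappa>' \<beta>"
      using p by (rule Hom_cases)
    obtain Z \<kappa>'' \<beta>' where Q: "R = ob Z \<kappa>''" "q = ar Y \<kappa>' Z \<kappa>'' \<beta>'" "valid Y \<kappa>' Z \<kappa>'' \<beta>'"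
      using q unfolding P(1) by (rule Hom_from_ob_cases) (rule validD(4)[OF P(3)])
    obtain W \<kappa>''' \<beta>'' where R: "r = ar Z \<kappa>'' W \<kappa>''' \<beta>''"
      using r unfolding Q(1) by (rule Hom_from_ob_cases) (rule validD(4)[OF Q(3)])
    show ?thesis by (simp add: P(2) Q(2) R Comp_ar add.assoc)
  qed
qed

lemma strict_monoidal_category: "strict_monoidal_category C"
proof (rule strict_monoidal_category.intro[OF category], unfold_locales)
  show "UnitO C \<in> Obj C"
    unfolding Obj_iff UnitO_ob using A_unit_closed K_zero by blast
  show "TensO C P Q \<in> Obj C" if "P \<in> Obj C" "Q \<in> Obj C" for P Q
    using that unfolding Obj_iff by (metis A_prod_closed K_prod TensO_ob)
  show "TensA C p q \<in> Hom C (TensO C P Q) (TensO C P' Q')"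
    if "p \<in> Hom C P P'" "q \<in> Hom C Q Q'" for p q P P' Q Q'
    using that by (auto elim!: Hom_cases simp: TensA_ar TensO_ob validD intro!: ar_in_Hom valid_prod)
  show "TensA C (Idt C P) (Idt C Q) = Idt C (TensO C P Q)" if "P \<in> Obj C" "Q \<in> Obj C" for P Q
    using that by (auto elim!: Obj_cases simp: Idt_ob TensO_ob TensA_ar valid_id mor_prod_zero)
  show "TensA C (Comp C p' p) (Comp C q' q) = Comp C (TensA C p' q') (TensA C p q)"
    if p: "p \<in> Hom C P P'" "p' \<in> Hom C P' P''" and q: "q \<in> Hom C Q Q'" "q' \<in> Hom C Q' Q''"
    for p p' q q' P P' P'' Q Q' Q''
  proof -
    obtain X\<^sub>1 \<kappa>\<^sub>1 Y\<^sub>1 \<kappa>\<^sub>1' \<beta>\<^sub>1 where P: "P' = ob Y\<^sub>1 \<kappa>\<^sub>1'" "p = ar X\<^sub>1 \<kappa>\<^sub>1 Y\<^sub>1 \<kappa>\<^sub>1' \<beta>\<^sub>1"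
      "valid X\<^sub>1 \<kappa>\<^sub>1 Y\<^sub>1 \<kappa>\<^sub>1' \<beta>\<^sub>1"
      using p(1) by (rule Hom_cases)
    obtain Z\<^sub>1 \<kappa>\<^sub>1'' \<beta>\<^sub>1' where P': "p' = ar Y\<^sub>1 \<kappa>\<^sub>1' Z\<^sub>1 \<kappa>\<^sub>1'' \<beta>\<^sub>1'" "valid Y\<^sub>1 \<kappa>\<^sub>1' Z\<^sub>1 \<kappa>\<^sub>1'' \<beta>\<^sub>1'"
      using p(2) unfolding P(1) by (rule Hom_from_ob_cases) (rule validD(4)[OF P(3)])
    obtain X\<^sub>2 \<kappa>\<^sub>2 Y\<^sub>2 \<kappa>\<^sub>2' \<beta>\<^sub>2 where Q: "Q' = ob Y\<^sub>2 \<kappa>\<^sub>2'" "q = ar X\<^sub>2 \<kappa>\<^sub>2 Y\<^sub>2 \<kappa>\<^sub>2' \<beta>\<^sub>2"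
      "valid X\<^sub>2 \<kappa>\<^sub>2 Y\<^sub>2 \<kappa>\<^sub>2' \<beta>\<^sub>2"
      using q(1) by (rule Hom_cases)
    obtain Z\<^sub>2 \<kappa>\<^sub>2'' \<beta>\<^sub>2' where Q': "q' = ar Y\<^sub>2 \<kappa>\<^sub>2' Z\<^sub>2 \<kappa>\<^sub>2'' \<beta>\<^sub>2'" "valid Y\<^sub>2 \<kappa>\<^sub>2' Z\<^sub>2 \<kappa>\<^sub>2'' \<beta>\<^sub>2'"
      using q(2) unfolding Q(1) by (rule Hom_from_ob_cases) (rule validD(4)[OF Q(3)])
    \<comment> \<open>The product of morphisms uses its objects only through their matrices, which
      morphisms preserve.\<close>
    have "mor_prod Y\<^sub>1 \<beta>\<^sub>1' Y\<^sub>2 \<beta>\<^sub>2' = mor_prod X\<^sub>1 \<beta>\<^sub>1' X\<^sub>2 \<beta>\<^sub>2'"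
      using validD(5)[OF P(3)] validD(5)[OF Q(3)] by (intro mor_prod_cong) auto
    then show ?thesis
      by (simp add: P(2) P'(1) Q(2) Q'(1) Comp_ar TensA_ar[OF P(3) Q(3)] TensA_ar[OF P'(2) Q'(2)]
          TensA_ar[OF valid_comp[OF P(3) P'(2)] valid_comp[OF Q(3) Q'(2)]] mor_prod_comp)
  qed
  show "TensO C (TensO C P Q) R = TensO C P (TensO C Q R)"
    if "P \<in> Obj C" "Q \<in> Obj C" "R \<in> Obj C" for P Q R
    using that by (auto elim!: Obj_cases
        simp: TensO_ob A_prod_closed K_prod A_prod_assoc char_prod_assoc)
  show "TensA C (TensA C p q) r = TensA C p (TensA C q r)"
    if pqr: "p \<in> Arr C" "q \<in> Arr C" "r \<in> Arr C" for p q r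
  proof -
    obtain X\<^sub>1 \<kappa>\<^sub>1 Y\<^sub>1 \<kappa>\<^sub>1' \<beta>\<^sub>1 where p: "p = ar X\<^sub>1 \<kappa>\<^sub>1 Y\<^sub>1 \<kappa>\<^sub>1' \<beta>\<^sub>1" "valid X\<^sub>1 \<kappa>\<^sub>1 Y\<^sub>1 \<kappa>\<^sub>1' \<beta>\<^sub>1"
      using pqr(1) by (rule Arr_cases)
    obtain X\<^sub>2 \<kappa>\<^sub>2 Y\<^sub>2 \<kappa>\<^sub>2' \<beta>\<^sub>2 where q: "q = ar X\<^sub>2 \<kappa>\<^sub>2 Y\<^sub>2 \<kappa>\<^sub>2' \<beta>\<^sub>2" "valid X\<^sub>2 \<kappa>\<^sub>2 Y\<^sub>2 \<kappa>\<^sub>2' \<beta>\<^sub>2"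
      using pqr(2) by (rule Arr_cases)
    obtain X\<^sub>3 \<kappa>\<^sub>3 Y\<^sub>3 \<kappa>\<^sub>3' \<beta>\<^sub>3 where r: "r = ar X\<^sub>3 \<kappa>\<^sub>3 Y\<^sub>3 \<kappa>\<^sub>3' \<beta>\<^sub>3" "valid X\<^sub>3 \<kappa>\<^sub>3 Y\<^sub>3 \<kappa>\<^sub>3' \<beta>\<^sub>3"
      using pqr(3) by (rule Arr_cases)
    show ?thesis
      by (simp add: p q r TensA_ar valid_prod validD[OF p(2)] validD[OF q(2)]
          A_prod_assoc char_prod_assoc mor_prod_assoc)
  qed
  show "TensO C (UnitO C) P = P" "TensO C P (UnitO C) = P" if "P \<in> Obj C" for P
    using that by (auto elim!: Obj_cases simp: UnitO_ob TensO_ob A_unit_closed K_zero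
        A_prod_unit_left A_prod_unit_right char_prod_unit)
  have unit: "valid (mat 1, \<lambda>_. 0) (\<lambda>_. 0) (mat 1, \<lambda>_. 0) (\<lambda>_. 0) (\<lambda>_. 0)"
    by (intro valid_id A_unit_closed K_zero)
  show "TensA C (Idt C (UnitO C)) p = p" "TensA C p (Idt C (UnitO C)) = p" if "p \<in> Arr C" for p
    using that by (auto elim!: Arr_cases simp: UnitO_ob Idt_ob TensA_ar unit
        A_prod_unit_left A_prod_unit_right char_prod_unit mor_prod_unit)
qed

lemma strict_two_group: "strict_two_group C"
proof (rule strict_two_group.intro[OF strict_monoidal_category], unfold_locales)
  fix p assume "p \<in> Arr C"
  then obtain X \<kappa> Y \<kappa>' \<beta> where p: "p = ar X \<kappa> Y \<kappa>' \<beta>" "valid X \<kappa> Y \<kappa>' \<beta>"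
    by (rule Arr_cases)
  have "valid Y \<kappa>' X \<kappa> (\<lambda>a. - \<beta> a)"
    using p(2) twisted_mor_minus unfolding admissible_def by blast
  then have "ar Y \<kappa>' X \<kappa> (\<lambda>a. - \<beta> a) \<in> Hom C (Cod C p) (Dom C p)"
    unfolding p(1) Dom_ar Cod_ar by (rule ar_in_Hom)
  moreover have "Comp C (ar Y \<kappa>' X \<kappa> (\<lambda>a. - \<beta> a)) p = Idt C (Dom C p)"
    "Comp C p (ar Y \<kappa>' X \<kappa> (\<lambda>a. - \<beta> a)) = Idt C (Cod C p)"
    by (simp_all add: p(1) Comp_ar Dom_ar Cod_ar Idt_ob)
  ultimately show "iso_arr C p"
    using \<open>p \<in> Arr C\<close> unfolding iso_arr_def by blast
next
  fix P assume "P \<in> Obj C"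
  then obtain X \<kappa> where P: "P = ob X \<kappa>" "X \<in> A_obj" "K \<kappa>" by (rule Obj_cases)
  obtain Y where Y: "Y \<in> A_obj" "A_prod X Y = (mat 1, \<lambda>_. 0)" "A_prod Y X = (mat 1, \<lambda>_. 0)"
    using A_obj_inverse[OF P(2)] by blast
  let ?e = "iso_sign (fst X)"
  define \<kappa>' where "\<kappa>' = (\<lambda>m. - int_scale ?e (\<kappa> (fst Y *v m)))"
  have K': "K \<kappa>'" unfolding \<kappa>'_def using P(3) by (rule K_inverse)
  have XY: "fst X ** fst Y = mat 1" "fst Y ** fst X = mat 1"
    using arg_cong[OF Y(2), of fst] arg_cong[OF Y(3), of fst] by simp_all
  have X: "fst X \<in> Opm" and "fst Y \<in> Opm" using P Y by (auto intro: A_objD_Opm)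
  then have "?e * iso_sign (fst Y) = 1"
    using Opm_mult[of "fst X" "fst Y"] XY by simp
  then have sign: "iso_sign (fst Y) = ?e"
    using iso_sign_cases[OF X] by auto
  have "char_prod X \<kappa> Y \<kappa>' = (\<lambda>_. 0)"
    using X by (simp add: char_prod_def \<kappa>'_def int_scale_minus int_scale_mult fun_eq_iff)
  moreover have "char_prod Y \<kappa>' X \<kappa> = (\<lambda>_. 0)"
    by (simp add: char_prod_def \<kappa>'_def sign matrix_vector_mul_assoc XY)
  ultimately have "TensO C P (ob Y \<kappa>') = UnitO C \<and> TensO C (ob Y \<kappa>') P = UnitO C"
    using P Y K' by (simp add: TensO_ob UnitO_ob)
  moreover have "ob Y \<kappa>' \<in> Obj C" using Y K' Obj_iff by blast
  ultimately show "\<exists>Q\<in>Obj C. TensO C P Q = UnitO C \<and> TensO C Q P = UnitO C" by blast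
qed

end

definition twisted_arr where
  "twisted_arr X \<kappa> Y \<kappa>' \<beta> = (twisted X \<kappa>, twisted Y \<kappa>', \<lambda>a. (0 :: ('n::finite) ivec, \<beta> a))"

interpretation A: twisted_two_group "A_two_group :: (('n::finite) pairA, _) monoidal_data"
    "\<lambda>\<kappa>. \<kappa> = (\<lambda>_. 0)" "\<lambda>X \<kappa>. X" "\<lambda>X \<kappa> Y \<kappa>' \<beta>. (X, Y, \<beta>)"
  by unfold_locales
    (auto simp: A_two_group_def A_mor_iff_twisted_mor admissible_def char_prod_zero mor_prod_def)

lemma invertible_intertwiner_iff:
  "invertible_intertwiner TD P \<longleftrightarrow> (\<exists>X \<kappa>. P = twisted X \<kappa> \<and> X \<in> A_obj \<and> Modules.additive \<kappa>)"
  by (metis invertible_intertwiner_twisted invertible_twisted prod.collapse)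

lemma additive_inverse_char:
  assumes "Modules.additive \<kappa>"
  shows "Modules.additive (\<lambda>m. - int_scale e (\<kappa> (B *v m)))"
  by (rule Modules.additive.intro)
     (simp add: Modules.additive.add[OF assms] matrix_vector_right_distrib int_scale_add)

lemma TensO_twisted:
  assumes "X \<in> A_obj" "Y \<in> A_obj" "Modules.additive \<kappa>"
  shows "TensO (AUT_CI TD) (twisted X \<kappa>) (twisted Y \<kappa>') = twisted (A_prod X Y) (char_prod X \<kappa> Y \<kappa>')"
  using Opm_mult[OF A_objD_Opm[OF assms(1)] A_objD_Opm[OF assms(2)]] Modules.additive.zero[OF assms(3)]
  by (simp add: AUT_CI_def twisted_def A_prod_def char_prod_def split_beta fun_eq_iff mat_act_mult
      matrix_vector_mul_assoc int_scale_add int_scale_mult add.assoc)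

lemma AUT_Arr_iff:
  "p \<in> Arr (AUT_CI TD) \<longleftrightarrow>
     (\<exists>X \<kappa> Y \<kappa>' \<beta>. p = twisted_arr X \<kappa> Y \<kappa>' \<beta> \<and> admissible Modules.additive X \<kappa> Y \<kappa>' \<beta>)"
  (is "?L \<longleftrightarrow> ?R")
proof
  assume ?L
  then obtain P Q B where p: "p = (P, Q, B)" "invertible_intertwiner TD P"
      "invertible_intertwiner TD Q" "crossed_transformation TD P Q B"
    by (auto simp: AUT_CI_def)
  obtain X \<kappa> where P: "P = twisted X \<kappa>" "X \<in> A_obj" "Modules.additive \<kappa>"
    using p(2) unfolding invertible_intertwiner_iff by blast
  obtain Y \<kappa>' where Q: "Q = twisted Y \<kappa>'" "Y \<in> A_obj" "Modules.additive \<kappa>'"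
    using p(3) unfolding invertible_intertwiner_iff by blast
  obtain \<beta> where "B = (\<lambda>a. (0, \<beta> a))" "twisted_mor X \<kappa> Y \<kappa>' \<beta>"
    using p(4) unfolding P Q crossed_transformation_iff_twisted_mor by blast
  then show ?R
    unfolding admissible_def twisted_arr_def using p(1) P Q by blast
next
  assume ?R
  then obtain X \<kappa> Y \<kappa>' \<beta> where p: "p = twisted_arr X \<kappa> Y \<kappa>' \<beta>"
      "admissible Modules.additive X \<kappa> Y \<kappa>' \<beta>"
    by blast
  have "invertible_intertwiner TD (twisted X \<kappa>)" "invertible_intertwiner TD (twisted Y \<kappa>')"
    "crossed_transformation TD (twisted X \<kappa>) (twisted Y \<kappa>') (\<lambda>a. (0, \<beta> a))"
    using p(2) unfolding invertible_intertwiner_iff crossed_transformation_iff_twisted_mor admissible_def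
    by blast+
  then show ?L by (simp add: p(1) twisted_arr_def AUT_CI_def)
qed

lemma TensA_twisted:
  assumes "X\<^sub>1 \<in> A_obj" "X\<^sub>2 \<in> A_obj" "Y\<^sub>1 \<in> A_obj" "Y\<^sub>2 \<in> A_obj"
    and "Modules.additive \<kappa>\<^sub>1" "Modules.additive \<kappa>\<^sub>1'"
  shows "TensA (AUT_CI TD) (twisted_arr X\<^sub>1 \<kappa>\<^sub>1 Y\<^sub>1 \<kappa>\<^sub>1' \<beta>\<^sub>1) (twisted_arr X\<^sub>2 \<kappa>\<^sub>2 Y\<^sub>2 \<kappa>\<^sub>2' \<beta>\<^sub>2) =
    twisted_arr (A_prod X\<^sub>1 X\<^sub>2) (char_prod X\<^sub>1 \<kappa>\<^sub>1 X\<^sub>2 \<kappa>\<^sub>2) (A_prod Y\<^sub>1 Y\<^sub>2) (char_prod Y\<^sub>1 \<kappa>\<^sub>1' Y\<^sub>2 \<kappa>\<^sub>2')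
      (mor_prod X\<^sub>1 \<beta>\<^sub>1 X\<^sub>2 \<beta>\<^sub>2)"
proof -
  let ?T = "AUT_CI TD"
  have TensA: "TensA ?T (P\<^sub>1, Q\<^sub>1, B\<^sub>1) (P\<^sub>2, Q\<^sub>2, B\<^sub>2) = (TensO ?T P\<^sub>1 P\<^sub>2, TensO ?T Q\<^sub>1 Q\<^sub>2,
      \<lambda>g. B\<^sub>1 (fst P\<^sub>2 g) + fst (snd P\<^sub>1) (B\<^sub>2 g))" for P\<^sub>1 Q\<^sub>1 B\<^sub>1 P\<^sub>2 Q\<^sub>2 B\<^sub>2
    by (simp add: AUT_CI_def split_beta)
  show ?thesis
    unfolding twisted_arr_def TensA TensO_twisted[OF assms(1,2,5)] TensO_twisted[OF assms(3,4,6)]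
    by (simp add: twisted_def mor_prod_def split_beta fun_eq_iff Modules.additive.zero[OF assms(5)])
qed

interpretation AUT: twisted_two_group
  "AUT_CI (TD :: (('n::finite) rvec, 'n ivec \<times> u1, 'n rvec, real) crossed_module)"
  Modules.additive twisted twisted_arr
proof (rule twisted_two_group.intro)
  show "twisted X \<kappa> = twisted X' \<kappa>' \<Longrightarrow> X = X' \<and> \<kappa> = \<kappa>'"
    for X X' :: "'n pairA" and \<kappa> \<kappa>'
    by (simp add: twisted_inject)
  show "P \<in> Obj (AUT_CI TD) \<longleftrightarrow> (\<exists>X \<kappa>. P = twisted X \<kappa> \<and> X \<in> A_obj \<and> Modules.additive \<kappa>)"
    for P :: "('n rvec, 'n ivec \<times> u1) intertwiner"
    unfolding invertible_intertwiner_iff[symmetric] by (simp add: AUT_CI_def)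
  show "UnitO (AUT_CI TD) = twisted (mat 1, \<lambda>_. 0) (\<lambda>_. 0)"
    by (simp add: AUT_CI_def twisted_def fun_eq_iff zero_prod_def)
qed (simp_all add: additive_zero additive_char_prod additive_inverse_char twisted_inject AUT_Arr_iff
    TensO_twisted TensA_twisted admissible_def, simp_all add: AUT_CI_def twisted_arr_def zero_prod_def)


section \<open>The comparison functor\<close>

text \<open>
  Since tensor products and the unit are preserved on the nose, the coherence conditions are
  equations between identity morphisms, and naturality is the preservation of tensor products of
  morphisms.
\<close>
lemma strict_two_group_hom_imp_monoidal_functor:
  assumes "strict_two_group_hom C D Fo Fa"
  shows "monoidal_functor C D Fo Fa (\<lambda>X Y. Idt D (Fo (TensO C X Y))) (Idt D (UnitO D))"
proof -
  interpret strict_two_group_hom C D Fo Fa by fact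
  have iso: "iso_arr D (Idt D P)" if "P \<in> Obj D" for P
    using D.idt_hom[OF that] by (intro D.groupoid) (simp add: Hom_def)
  have comp_idt: "Comp D (Idt D P) (Idt D P) = Idt D P" if "P \<in> Obj D" for P
    using D.idt_comp[OF D.idt_hom[OF that]] .
  note obj = map_obj C.tens_obj C.unit_obj D.unit_obj D.tens_obj
  show ?thesis
  proof
    show "Comp D (Fa (TensA C p q)) (Idt D (Fo (TensO C X Y))) =
        Comp D (Idt D (Fo (TensO C X' Y'))) (TensA D (Fa p) (Fa q))"
      if p: "p \<in> Hom C X X'" and q: "q \<in> Hom C Y Y'" for p q X X' Y Y'
    proof -
      have pq: "Fa (TensA C p q) \<in> Hom D (Fo (TensO C X Y)) (Fo (TensO C X' Y'))"
        by (intro map_hom C.tens_hom p q)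
      have "TensA D (Fa p) (Fa q) = Fa (TensA C p q)"
        using p q by (simp add: map_tens_arr Hom_def)
      then show ?thesis
        using D.comp_idt[OF pq] D.idt_comp[OF pq] by simp
    qed
  qed (simp_all add: obj iso map_unit D.idt_hom D.tens_idt comp_idt C.tens_assoc_obj C.unit_tens_obj
      C.tens_unit_obj D.unit_tens_obj D.tens_unit_obj flip: map_tens_obj)
qed

lemma additive_int_scale:
  fixes \<kappa> :: "int ^ 'k \<Rightarrow> u1"
  assumes "Modules.additive \<kappa>"
  shows "\<kappa> (c *s v) = int_scale c (\<kappa> v)"
proof (induction c rule: int_induct[of _ 0])
  case base
  then show ?case
    using Modules.additive.zero[OF assms] by (simp add: int_scale_zero_left)
next
  case (step1 i)
  then show ?case
    by (simp add: vector_sadd_rdistrib Modules.additive.add[OF assms] int_scale_add_left)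
next
  case (step2 i)
  have "\<kappa> ((i - 1) *s v) = \<kappa> (i *s v) - \<kappa> v"
    by (simp add: Modules.additive.diff[OF assms, symmetric] vec_eq_iff algebra_simps)
  then show ?case
    using step2 by (simp add: int_scale_diff_left)
qed

text \<open>
  Lift the values on the standard basis to real numbers; the linear form with these
  coefficients, reduced modulo \<open>\<int>\<close>, restricts to \<open>\<kappa>\<close> on the lattice.
\<close>
lemma extend_lattice_character:
  fixes \<kappa> :: "('n::finite) ivec \<Rightarrow> u1"
  assumes "Modules.additive \<kappa>"
  obtains \<beta> :: "'n rvec \<Rightarrow> u1" where "smooth_map euclidean_atlas u1_atlas \<beta>"
    "\<And>a b. \<beta> (a + b) = \<beta> a + \<beta> b" "\<And>m. \<beta> (rvec_of m) = \<kappa> m"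
proof -
  have "\<exists>c. \<forall>i. to_u1 (c i) = \<kappa> (axis i 1)"
    using to_u1_surj by (intro choice) blast
  then obtain c where c: "\<And>i. to_u1 (c i) = \<kappa> (axis i 1)" by blast
  define L where "L a = (\<Sum>i\<in>UNIV. a $ i * c i)" for a :: "'n rvec"
  have lin: "linear L"
    by (rule linearI) (simp_all add: L_def sum.distrib sum_distrib_left algebra_simps)
  have "to_u1 (L (rvec_of m)) = \<kappa> m" for m
  proof -
    have "to_u1 (L (rvec_of m)) = (\<Sum>i\<in>UNIV. int_scale (m $ i) (\<kappa> (axis i 1)))"
      by (simp add: L_def to_u1_sum c[symmetric] int_scale_to_u1 rvec_of_def)
    also have "\<dots> = \<kappa> (\<Sum>i\<in>UNIV. (m $ i) *s axis i 1)"
      by (simp add: Modules.additive.sum[OF assms] additive_int_scale[OF assms])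
    finally show ?thesis by (simp add: basis_expansion)
  qed
  then show thesis
    using that[of "\<lambda>a. to_u1 (L a)"] smooth_u1_linear[OF lin] linear_add[OF lin] by (simp add: to_u1_add)
qed

lemma I_arr_eq_twisted: "I_arr (X, Y, \<beta>) = twisted_arr X (\<lambda>_. 0) Y (\<lambda>_. 0) \<beta>"
  by (simp add: I_arr_def twisted_arr_def I_obj_eq_twisted)

lemma A_Hom_iff:
  "p \<in> Hom A_two_group X Y \<longleftrightarrow>
     (\<exists>\<beta>. p = (X, Y, \<beta>) \<and> X \<in> A_obj \<and> Y \<in> A_obj \<and> twisted_mor X (\<lambda>_. 0) Y (\<lambda>_. 0) \<beta>)"
  unfolding A.Hom_iff admissible_def by blast

lemma admissible_zero:
  "X \<in> A_obj \<Longrightarrow> Y \<in> A_obj \<Longrightarrow> twisted_mor X (\<lambda>_. 0) Y (\<lambda>_. 0) \<beta> \<Longrightarrow>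
     admissible Modules.additive X (\<lambda>_. 0) Y (\<lambda>_. 0) \<beta>"
  by (simp add: admissible_def additive_zero)

lemma strict_two_group_hom_I:
  "strict_two_group_hom (A_two_group :: (('n::finite) pairA, _) monoidal_data) (AUT_CI TD) I_obj I_arr"
proof (intro strict_two_group_hom.intro cat_functor.intro A.strict_two_group AUT.strict_two_group
    A.category AUT.category cat_functor_axioms.intro strict_two_group_hom_axioms.intro)
  let ?A = "A_two_group :: ('n pairA, _) monoidal_data" and ?T = "AUT_CI TD"
  have Obj: "X \<in> Obj ?A \<longleftrightarrow> X \<in> A_obj" for X
    by (simp add: A_two_group_def)
  show "I_obj X \<in> Obj ?T" if "X \<in> Obj ?A" for X
    using that additive_zero unfolding AUT.Obj_iff Obj I_obj_eq_twisted by blast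
  show "I_arr p \<in> Hom ?T (I_obj X) (I_obj Y)" if p: "p \<in> Hom ?A X Y" for p X Y
  proof -
    obtain \<beta> where "p = (X, Y, \<beta>)" "admissible Modules.additive X (\<lambda>_. 0) Y (\<lambda>_. 0) \<beta>"
      using p admissible_zero unfolding A_Hom_iff by blast
    then show ?thesis
      unfolding I_obj_eq_twisted by (simp add: I_arr_eq_twisted AUT.ar_in_Hom)
  qed
  show "I_arr (Idt ?A X) = Idt ?T (I_obj X)" for X
    by (simp add: A_two_group_def I_arr_eq_twisted I_obj_eq_twisted AUT.Idt_ob)
  show "I_arr (Comp ?A q p) = Comp ?T (I_arr q) (I_arr p)"
    if pq: "p \<in> Hom ?A X Y" "q \<in> Hom ?A Y Z" for p q X Y Z
  proof -
    obtain \<beta> \<beta>' where "p = (X, Y, \<beta>)" "q = (Y, Z, \<beta>')"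
      using pq unfolding A_Hom_iff by blast
    then show ?thesis
      by (simp add: A_two_group_def I_arr_eq_twisted AUT.Comp_ar)
  qed
  show "I_obj (UnitO ?A) = UnitO ?T"
    by (simp add: A_two_group_def I_obj_eq_twisted AUT.UnitO_ob)
  show "I_obj (TensO ?A X Y) = TensO ?T (I_obj X) (I_obj Y)" if "X \<in> Obj ?A" "Y \<in> Obj ?A" for X Y
    using that by (simp add: A_two_group_def I_obj_eq_twisted TensO_twisted additive_zero char_prod_zero)
  show "I_arr (TensA ?A p q) = TensA ?T (I_arr p) (I_arr q)" if pq: "p \<in> Arr ?A" "q \<in> Arr ?A" for p q
  proof -
    obtain X\<^sub>1 Y\<^sub>1 \<beta>\<^sub>1 X\<^sub>2 Y\<^sub>2 \<beta>\<^sub>2 where "p = (X\<^sub>1, Y\<^sub>1, \<beta>\<^sub>1)" "X\<^sub>1 \<in> A_obj" "Y\<^sub>1 \<in> A_obj"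
        "q = (X\<^sub>2, Y\<^sub>2, \<beta>\<^sub>2)" "X\<^sub>2 \<in> A_obj" "Y\<^sub>2 \<in> A_obj"
      using pq unfolding A.Arr_iff admissible_def by blast
    then show ?thesis
      by (simp add: A_two_group_def I_arr_eq_twisted TensA_twisted additive_zero char_prod_zero
          mor_prod_def)
  qed
qed

text \<open>
  On objects without a twist, a crossed transformation satisfies exactly the conditions of a
  morphism of pairs.
\<close>
lemma I_full:
  assumes "X \<in> A_obj" "Y \<in> A_obj" "q \<in> Hom (AUT_CI TD) (I_obj X) (I_obj Y)"
  shows "\<exists>p\<in>Hom A_two_group X Y. I_arr p = q"
proof -
  obtain Y' \<kappa>' \<beta> where q: "I_obj Y = twisted Y' \<kappa>'" "q = twisted_arr X (\<lambda>_. 0) Y' \<kappa>' \<beta>"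
      "admissible Modules.additive X (\<lambda>_. 0) Y' \<kappa>' \<beta>"
    using assms(3) additive_zero unfolding I_obj_eq_twisted[of X] by (rule AUT.Hom_from_ob_cases)
  have "Y' = Y" "\<kappa>' = (\<lambda>_. 0)"
    using q(1) unfolding I_obj_eq_twisted twisted_inject by auto
  then have "(X, Y, \<beta>) \<in> Hom A_two_group X Y" "I_arr (X, Y, \<beta>) = q"
    using q(2,3) unfolding A_Hom_iff I_arr_eq_twisted admissible_def by auto
  then show ?thesis by blast
qed

lemma I_faithful:
  assumes "p \<in> Hom A_two_group X Y" "p' \<in> Hom A_two_group X Y" "I_arr p = I_arr p'"
  shows "p = p'"
  using assms unfolding A_Hom_iff by (auto simp: I_arr_def fun_eq_iff)

text \<open>
  Let \<open>\<beta>\<close> be an additive extension of \<open>\<kappa>\<close> to the whole vector space. Being additive, it has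
  trivial coboundary, so as a crossed transformation it changes the twist from \<open>0\<close> to \<open>\<kappa>\<close> and
  leaves the cocycle unchanged.
\<close>
lemma I_essentially_surjective:
  assumes "P \<in> Obj (AUT_CI TD)"
  shows "\<exists>X\<in>A_obj. \<exists>t\<in>Hom (AUT_CI TD) (I_obj X) P. iso_arr (AUT_CI TD) t"
proof -
  obtain X \<kappa> where P: "P = twisted X \<kappa>" "X \<in> A_obj" "Modules.additive \<kappa>"
    using assms by (rule AUT.Obj_cases)
  obtain \<beta> where \<beta>: "smooth_map euclidean_atlas u1_atlas \<beta>"
      "\<And>a b. \<beta> (a + b) = \<beta> a + \<beta> b" "\<And>m. \<beta> (rvec_of m) = \<kappa> m"
    using extend_lattice_character[OF P(3)] by blast
  have "admissible Modules.additive X (\<lambda>_. 0) X \<kappa> \<beta>"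
    using P \<beta> by (simp add: admissible_def twisted_mor_def additive_zero add.commute)
  then have t: "twisted_arr X (\<lambda>_. 0) X \<kappa> \<beta> \<in> Hom (AUT_CI TD) (I_obj X) P"
    unfolding P(1) I_obj_eq_twisted by (rule AUT.ar_in_Hom)
  then have "iso_arr (AUT_CI TD) (twisted_arr X (\<lambda>_. 0) X \<kappa> \<beta>)"
    by (intro strict_two_group.groupoid[OF AUT.strict_two_group]) (simp add: Hom_def)
  then show ?thesis using P(2) t by blast
qed

theorem theorem4p3p4:
  shows "strict_two_group_hom (A_two_group :: (('n::finite) pairA, _) monoidal_data)
           (AUT_CI TD) I_obj I_arr \<and>
         two_group_equivalence (A_two_group :: ('n pairA, _) monoidal_data)
           (AUT_CI TD) I_obj I_arr
           (\<lambda>X Y. Idt (AUT_CI TD) (I_obj (TensO A_two_group X Y)))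
           (Idt (AUT_CI TD) (UnitO (AUT_CI TD)))"
proof -
  let ?A = "A_two_group :: ('n pairA, _) monoidal_data" and ?T = "AUT_CI TD"
  have hom: "strict_two_group_hom ?A ?T I_obj I_arr" by (rule strict_two_group_hom_I)
  have Obj: "Obj ?A = A_obj" by (simp add: A_two_group_def)
  have "equivalence_of_categories ?A ?T I_obj I_arr"
  proof (rule equivalence_if_fully_faithful_essentially_surjective)
    show "cat_functor ?A ?T I_obj I_arr"
      using hom by (rule strict_two_group_hom.axioms)
  qed (unfold Obj, (rule I_full I_faithful I_essentially_surjective; assumption)+)
  then show ?thesis
    unfolding two_group_equivalence_def
    using hom A.strict_two_group AUT.strict_two_group strict_two_group_hom_imp_monoidal_functor[OF hom]
    by blast
qed

end
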